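(* Let $0<\tau<1$ and $C$ be real constants, and let $\mathcal{T}$ be any set of primes with $$\sum_{\substack{p\le x\\ p\in\mathcal{T}}}\frac{\log p}{p}=\tau\log x+C+o(1)\qquad(x\to\infty).$$ Let $\mathcal{Q}(\mathcal{T})=\{n\in\mathbb{N}: p\mid n\Rightarrow p\in\mathcal{T}\}$, where $p$ denotes primes. If $\mathcal{Q}(\mathcal{T})\sim\mathcal{A}+\mathcal{B}$, where $\mathcal{A},\mathcal{B}$ are sets of positive integers containing at least two elements each, then $$\max(\mathcal{A}(x),\mathcal{B}(x))\ll_{\mathcal{T}}x^{1/2}(\log x)^{4}.$$
   Context: For sets of positive integers, $\mathcal{A}+\mathcal{B}:=\{a+b: a\in\mathcal{A}, b\in\mathcal{B}\}$. We write $\mathcal{S}\sim\mathcal{A}+\mathcal{B}$ if there is some $x_0$ with $(\mathcal{A}+\mathcal{B})\cap[x_0,\infty)=\mathcal{S}\cap[x_0,\infty)$. The counting function is $\mathcal{A}(x):=\#\{n\le x: n\in\mathcal{A}\}$, and similarly $\mathcal{B}(x)$. The notation $F(x)\ll_{\mathcal{T}}G(x)$ means that there is a constant $C_0>0$ depending only on $\mathcal{T}$ with $F(x)\le C_0G(x)$ for all sufficiently large $x$ (how large may depend on the sets involved). *)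

theory Defs
  imports
    Complex_Main
    "HOL-Library.Landau_Symbols"
    "HOL-Library.Set_Algebras"
    "HOL-Computational_Algebra.Primes"
begin

(* The sumset of A and B is the pointwise set addition A + B of HOL-Library.Set_Algebras. *)

(* Natural numbers start at 1 in the source, so 0 is excluded. *)
definition Q_set :: "nat set \<Rightarrow> nat set" where
  "Q_set T = {n. n > 0 \<and> (\<forall>p. prime p \<longrightarrow> p dvd n \<longrightarrow> p \<in> T)}"

definition eventually_same :: "nat set \<Rightarrow> nat set \<Rightarrow> bool" where
  "eventually_same S S' \<longleftrightarrow> (\<exists>x0. S' \<inter> {x0..} = S \<inter> {x0..})"

definition counting :: "nat set \<Rightarrow> real \<Rightarrow> nat" where
  "counting A x = card {n \<in> A. real n \<le> x}"

end

theory Submission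
  imports Defs "HOL-Analysis.Analysis" "HOL-Real_Asymp.Real_Asymp"
begin

text \<open>
  For a prime \<open>p\<close> outside \<open>T\<close>, no large sum \<open>a + b\<close> is divisible by \<open>p\<close>, so \<open>A\<close> avoids as many
  residue classes modulo \<open>p\<close> as \<open>B\<close> occupies. Any lower bound for the residues occupied by \<open>B\<close> thus
  gives, by the large sieve, an upper bound for \<open>A(x)\<close>, and this in turn a lower bound
  \<open>B(x) \<ge> S(x) / A(x)\<close>, where \<open>S(x)\<close>, the number of elements of \<open>Q(T)\<close> up to \<open>x\<close>, is at least a constant
  times \<open>x (ln x)\<close> to the power \<open>\<tau> - 1\<close>. The bounds are bootstrapped. Two elements of \<open>B\<close> occupy two classes modulo
  almost every prime, which forces \<open>B\<close> to be infinite; with \<open>k\<close> elements in place of two, \<open>B(x)\<close> exceeds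
  every power of \<open>ln x\<close>. By Gallagher's larger sieve a set with \<open>B(x) \<ge> y\<close> occupies many classes modulo most
  primes up to \<open>y\<close>. With \<open>y\<close> a large power of \<open>ln x\<close>, sieving by products of many such primes gives
  \<open>A(x) \<le> x\<close> to the power \<open>3/5\<close> and hence \<open>B(x) \<ge> x\<close> to the power \<open>3/8\<close>. Now almost all primes up to
  that bound are good, and sieving by products of two of them gives the square root bound.
\<close>

subsection \<open>The large sieve\<close>

text \<open>Square-root strength needs moduli up to \<open>Q = sqrt (x / ln x)\<close> with a
  positive proportion of classes removed. But knowing \<open>B(x) \<ge> y\<close> controls
  \<open>B\<close> only modulo primes up to \<open>y\<close>, since beyond that the diagonal term of
  the larger sieve takes over. While \<open>y\<close> stays below \<open>Q\<close>, the moduli must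
  therefore be products of smaller primes, and this dictates the exponents. For a pair
  \<open>p * q \<le> Q\<close> with \<open>p > x^(1/8)\<close> the partner \<open>q\<close> is below
  \<open>x^(3/8)\<close>, so \<open>B(x) \<ge> x^(3/8)\<close> is what the last stage asks for;
  \<open>3/5 + 3/8 < 1\<close> leaves room for the logarithms when \<open>S(x)\<close> is divided by
  \<open>A(x)\<close>. In the middle stage good primes are sought in a window of bounded ratio. Its
  logarithmic mass is bounded, while the bad primes may weigh a constant times
  \<open>\<epsilon> * ln x\<close>, so only a proportion of order \<open>1 / ln x\<close> of the
  classes can be demanded there. A large power of \<open>ln x\<close> as size of the primes makes
  that loss affordable. In the last stage a range of positive logarithmic length is available, and
  \<open>\<epsilon>\<close> can be constant. Elements of \<open>A\<close> and \<open>B\<close> and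
  the threshold \<open>x0\<close> influence only how large \<open>x\<close> must be, never the final
  constant.\<close>

lemma sin_pi_mult_ge:
  fixes t :: real
  assumes "0 \<le> t" "t \<le> 1/2"
  shows "2 * t \<le> sin (pi * t)"
proof -
  have cv: "convex_on {0..pi/2} (\<lambda>x. - sin x)"
  proof (rule f''_ge0_imp_convex[where f' = "\<lambda>x. - cos x" and f'' = sin])
    fix x :: real assume "x \<in> {0..pi/2}"
    then show "0 \<le> sin x" by (intro sin_ge_zero) auto
  qed (auto intro!: derivative_eq_intros)
  have "- sin ((1 - 2*t) *\<^sub>R 0 + (2*t) *\<^sub>R (pi/2)) \<le> (1 - 2*t) * (- sin 0) + (2*t) * (- sin (pi/2))"
    by (rule convex_onD[OF cv]) (use assms in auto)
  then show ?thesis by (simp add: mult.commute)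
qed

text \<open>One of the two terms already dominates. Keeping both makes the bound symmetric under
  \<open>t\<close> to \<open>1 - t\<close> and lets separated points be summed from either
  end.\<close>

lemma inverse_sin_pi_mult_le:
  fixes t :: real
  assumes "0 < t" "t < 1"
  shows "1 / sin (pi * t) \<le> (1 / t + 1 / (1 - t)) / 2"
proof (cases "t \<le> 1/2")
  case True
  have "1 / sin (pi * t) \<le> 1 / (2 * t)"
    using sin_pi_mult_ge[of t] True assms by (intro divide_left_mono mult_pos_pos) auto
  also have "\<dots> \<le> (1 / t + 1 / (1 - t)) / 2"
    using assms divide_pos_pos[of 1 "1 - t"] by simp
  finally show ?thesis .
next
  case False
  have eq: "sin (pi * t) = sin (pi * (1 - t))"
    by (simp add: right_diff_distrib sin_diff)
  have "1 / sin (pi * t) \<le> 1 / (2 * (1 - t))"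
    unfolding eq
    using sin_pi_mult_ge[of "1 - t"] False assms by (intro divide_left_mono mult_pos_pos) auto
  also have "\<dots> = (1 / (1 - t)) / 2" by simp
  also have "\<dots> \<le> (1 / t + 1 / (1 - t)) / 2"
    using assms by (intro divide_right_mono) auto
  finally show ?thesis .
qed

text \<open>Geometric series with ratio \<open>z = cis (2 * pi * \<beta>)\<close>: the numerator has
  norm at most 2 and \<open>norm (1 - z) = 2 * sin (pi * frac \<beta>)\<close>. The bound is uniform
  in \<open>N\<close>.\<close>

lemma norm_sum_cis_le:
  fixes \<beta> :: real
  assumes "\<beta> \<notin> \<int>"
  shows "norm (\<Sum>n=1..N. cis (2 * pi * (real n * \<beta>))) \<le> 1 / sin (pi * frac \<beta>)"
proof -
  define t where "t = frac \<beta>"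
  have t: "0 < t" "t < 1"
    using assms frac_lt_1[of \<beta>] frac_ge_0[of \<beta>] frac_eq_0_iff[of \<beta>] by (auto simp: t_def less_le)
  have sp: "0 < sin (pi * t)"
    using t by (intro sin_gt_zero) auto
  define z where "z = cis (2 * pi * \<beta>)"
  have zt: "z = cis (2 * pi * t)"
  proof -
    have "2 * pi * \<beta> = 2 * pi * t + 2 * pi * of_int \<lfloor>\<beta>\<rfloor>"
      by (simp add: t_def frac_def algebra_simps)
    then have "z = cis (2 * pi * t) * cis (2 * pi * of_int \<lfloor>\<beta>\<rfloor>)"
      unfolding z_def cis_mult by (rule arg_cong)
    also have "cis (2 * pi * of_int \<lfloor>\<beta>\<rfloor>) = 1"
      by (rule cis_multiple_2pi) auto
    finally show ?thesis by simp
  qed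
  have pw: "cis (2 * pi * (real n * \<beta>)) = z ^ n" for n
    unfolding z_def Complex.DeMoivre by (rule arg_cong[where f = cis]) simp
  have nz: "norm z = 1" by (simp add: z_def)
  have n1: "(norm (1 - z))\<^sup>2 = (2 * sin (pi * t))\<^sup>2"
  proof -
    have "(norm (1 - z))\<^sup>2 = (1 - cos (2 * (pi * t)))\<^sup>2 + (sin (2 * (pi * t)))\<^sup>2"
      by (simp add: zt cmod_power2 mult.assoc)
    also have "\<dots> = (1 - (1 - 2 * (sin (pi*t))\<^sup>2))\<^sup>2 + (2 * sin (pi*t) * cos (pi*t))\<^sup>2"
      by (simp only: cos_double_sin sin_double)
    also have "\<dots> = 4 * (sin (pi*t))\<^sup>2 * ((sin (pi*t))\<^sup>2 + (cos (pi*t))\<^sup>2)"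
      by algebra
    also have "\<dots> = (2 * sin (pi * t))\<^sup>2" by (simp add: power_mult_distrib sin_cos_squared_add)
    finally show ?thesis .
  qed
  then have n2: "norm (1 - z) = 2 * sin (pi * t)"
    using sp by (intro power2_eq_imp_eq[OF n1]) auto
  have "(1 - z) * (\<Sum>n=1..N. z ^ n) = z - z ^ Suc N"
  proof (induction N)
    case (Suc N)
    have "(1 - z) * (\<Sum>n=1..Suc N. z ^ n) = (1 - z) * (\<Sum>n=1..N. z ^ n) + (1 - z) * z ^ Suc N"
      by (simp add: distrib_left)
    also have "\<dots> = z - z ^ Suc (Suc N)"
      unfolding Suc.IH by (simp add: algebra_simps)
    finally show ?case .
  qed simp
  then have "norm (1 - z) * norm (\<Sum>n=1..N. z ^ n) = norm (z - z ^ Suc N)"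
    by (metis norm_mult)
  also have "\<dots> \<le> norm z + norm (z ^ Suc N)" by (rule norm_triangle_ineq4)
  also have "\<dots> = 2" by (simp only: norm_power nz) simp
  finally have "2 * sin (pi * t) * norm (\<Sum>n=1..N. z ^ n) \<le> 2" by (simp add: n2)
  then have "norm (\<Sum>n=1..N. z ^ n) \<le> 1 / sin (pi * t)"
    using sp by (simp add: field_simps)
  then show ?thesis by (simp add: pw t_def)
qed

lemma harm_le_ln: "n > 0 \<Longrightarrow> harm n \<le> 1 + ln (real n)"
proof (induction n rule: nat_induct_non_zero)
  case 1
  then show ?case by (simp add: harm_def)
next
  case (Suc n)
  have "ln (real n / real (Suc n)) \<le> real n / real (Suc n) - 1"
    using Suc by (intro ln_le_minus_one) auto
  then have "ln (real n) - ln (real (Suc n)) \<le> - inverse (real (Suc n))"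
    using Suc by (simp add: ln_div field_simps)
  with Suc show ?case by (simp add: harm_Suc)
qed

text \<open>The integers \<open>\<lfloor>t s / \<delta>\<rfloor>\<close> are distinct, positive and
  at most \<open>1 / \<delta>\<close>, which compares the sum with a harmonic sum.\<close>

lemma sum_inverse_separated_le:
  fixes t :: "'s \<Rightarrow> real"
  assumes "finite S" and \<delta>: "0 < \<delta>" "\<delta> \<le> 1"
    and range: "\<And>s. s \<in> S \<Longrightarrow> \<delta> \<le> t s \<and> t s \<le> 1"
    and sep: "\<And>s s'. s \<in> S \<Longrightarrow> s' \<in> S \<Longrightarrow> s \<noteq> s' \<Longrightarrow> \<delta> \<le> \<bar>t s - t s'\<bar>"
  shows "(\<Sum>s\<in>S. 1 / t s) \<le> (1 / \<delta>) * (1 + ln (1 / \<delta>))"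
proof -
  define k where "k s = nat \<lfloor>t s / \<delta>\<rfloor>" for s
  define R where "R = nat \<lfloor>1 / \<delta>\<rfloor>"
  have R: "R \<ge> 1" "real R \<le> 1 / \<delta>"
    using \<delta> by (auto simp: R_def le_nat_iff le_floor_iff)
  have k1: "1 \<le> k s" "k s \<le> R" "real (k s) \<le> t s / \<delta>" if "s \<in> S" for s
  proof -
    have "1 \<le> t s / \<delta>" "t s / \<delta> \<le> 1 / \<delta>" using range[OF that] \<delta> by (auto simp: field_simps)
    then show "1 \<le> k s" "k s \<le> R" "real (k s) \<le> t s / \<delta>"
      by (auto simp: k_def R_def le_nat_iff le_floor_iff intro!: nat_mono floor_mono)
  qed
  have inj: "inj_on k S"
  proof (rule inj_onI, rule ccontr)
    fix s s' assume s: "s \<in> S" "s' \<in> S" "k s = k s'" "s \<noteq> s'"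
    have "0 \<le> t s / \<delta>" "0 \<le> t s' / \<delta>" using range s \<delta> by (auto intro!: divide_nonneg_pos intro: order_trans[OF less_imp_le])
    then have "\<lfloor>t s / \<delta>\<rfloor> = \<lfloor>t s' / \<delta>\<rfloor>"
      using s(3) by (simp add: k_def nat_eq_iff)
    then have "\<bar>t s / \<delta> - t s' / \<delta>\<bar> < 1" by linarith
    then have "\<bar>t s - t s'\<bar> < \<delta>"
      using \<delta> by (simp add: diff_divide_distrib[symmetric] abs_divide)
    with sep[OF s(1,2,4)] show False by simp
  qed
  have "(\<Sum>s\<in>S. 1 / t s) \<le> (\<Sum>s\<in>S. (1 / \<delta>) * inverse (real (k s)))"
  proof (rule sum_mono)
    fix s assume s: "s \<in> S"
    have "real (k s) * \<delta> \<le> t s" using k1(3)[OF s] \<delta> by (simp add: field_simps)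
    then have "1 / t s \<le> 1 / (real (k s) * \<delta>)"
      using k1(1)[OF s] \<delta> range[OF s] by (intro divide_left_mono mult_pos_pos) auto
    then show "1 / t s \<le> (1 / \<delta>) * inverse (real (k s))" by (simp add: field_simps)
  qed
  also have "\<dots> = (1 / \<delta>) * (\<Sum>i\<in>k ` S. inverse (real i))"
    by (simp add: sum_distrib_left sum.reindex[OF inj])
  also have "\<dots> \<le> (1 / \<delta>) * harm R"
    unfolding harm_def using \<delta> k1 by (intro mult_left_mono sum_mono2) auto
  also have "\<dots> \<le> (1 / \<delta>) * (1 + ln (1 / \<delta>))"
  proof (rule mult_left_mono)
    have "harm R \<le> 1 + ln (real R)" using R by (intro harm_le_ln) auto
    also have "ln (real R) \<le> ln (1 / \<delta>)" using R \<delta> by (subst ln_le_cancel_iff) auto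
    finally show "harm R \<le> 1 + ln (1 / \<delta>)" by simp
  qed (use \<delta> in auto)
  finally show ?thesis .
qed

text \<open>The kernel of a spaced set of frequencies has rows of size \<open>N + O(Q\<^sup>2 log Q)\<close> when
  \<open>\<delta> = 1/Q\<^sup>2\<close>. The logarithm lost against the optimal constant is harmless: sieving up to
  \<open>Q = sqrt (x / ln x)\<close> instead of \<open>sqrt x\<close> removes it.\<close>

lemma dual_large_sieve:
  fixes c :: "'s \<Rightarrow> complex" and x :: "'s \<Rightarrow> real"
  assumes "finite S" and \<delta>: "0 < \<delta>" "\<delta> \<le> 1"
    and sep: "\<And>s s' k. s \<in> S \<Longrightarrow> s' \<in> S \<Longrightarrow> s \<noteq> s' \<Longrightarrow> \<delta> \<le> \<bar>x s - x s' - of_int k\<bar>"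
  shows "(\<Sum>n=1..N. (norm (\<Sum>s\<in>S. c s * cis (2 * pi * (real n * x s))))\<^sup>2)
       \<le> (real N + (1 / \<delta>) * (1 + ln (1 / \<delta>))) * (\<Sum>s\<in>S. (norm (c s))\<^sup>2)"
proof -
  define K where "K s s' = (\<Sum>n=1..N. cis (2 * pi * (real n * (x s - x s'))))" for s s'
  have Ksym: "norm (K s' s) = norm (K s s')" for s s'
  proof -
    have "K s' s = cnj (K s s')"
      unfolding K_def cnj_sum cis_cnj by (simp add: algebra_simps)
    then show ?thesis by simp
  qed
  \<comment> \<open>The diagonal contributes \<open>N\<close>. Off it, the fractional parts of
    \<open>x s - x s'\<close> are separated by \<delta> from each other and from both ends of the
    unit interval.\<close>
  have row: "(\<Sum>s'\<in>S. norm (K s s')) \<le> real N + (1 / \<delta>) * (1 + ln (1 / \<delta>))" if s: "s \<in> S" for s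
  proof -
    define t where "t s' = frac (x s - x s')" for s'
    have tb: "\<delta> \<le> t s'" "\<delta> \<le> 1 - t s'" if "s' \<in> S - {s}" for s'
      using sep[of s s' "\<lfloor>x s - x s'\<rfloor>"] sep[of s s' "\<lfloor>x s - x s'\<rfloor> + 1"] that s
        frac_lt_1[of "x s - x s'"] frac_ge_0[of "x s - x s'"]
      by (auto simp: t_def frac_def)
    have ts: "\<delta> \<le> \<bar>t s1 - t s2\<bar>" if "s1 \<in> S - {s}" "s2 \<in> S - {s}" "s1 \<noteq> s2" for s1 s2
      using sep[of s2 s1 "\<lfloor>x s - x s1\<rfloor> - \<lfloor>x s - x s2\<rfloor>"] that by (auto simp: t_def frac_def algebra_simps)
    have "(\<Sum>s'\<in>S - {s}. norm (K s s')) \<le> (\<Sum>s'\<in>S - {s}. (1 / t s' + 1 / (1 - t s')) / 2)"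
    proof (rule sum_mono)
      fix s' assume s': "s' \<in> S - {s}"
      have "0 < t s'" "t s' < 1" using tb[OF s'] \<delta> by auto
      then have "norm (K s s') \<le> 1 / sin (pi * t s')"
        unfolding K_def t_def by (intro norm_sum_cis_le) auto
      also have "\<dots> \<le> (1 / t s' + 1 / (1 - t s')) / 2"
        by (rule inverse_sin_pi_mult_le) fact+
      finally show "norm (K s s') \<le> (1 / t s' + 1 / (1 - t s')) / 2" .
    qed
    also have "\<dots> = ((\<Sum>s'\<in>S - {s}. 1 / t s') + (\<Sum>s'\<in>S - {s}. 1 / (1 - t s'))) / 2"
      by (simp add: sum.distrib sum_divide_distrib[symmetric])
    also have "\<dots> \<le> ((1 / \<delta>) * (1 + ln (1 / \<delta>)) + (1 / \<delta>) * (1 + ln (1 / \<delta>))) / 2"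
    proof (intro divide_right_mono add_mono)
      show "(\<Sum>s'\<in>S - {s}. 1 / t s') \<le> (1 / \<delta>) * (1 + ln (1 / \<delta>))"
        by (rule sum_inverse_separated_le) (use tb ts assms in \<open>auto simp: t_def intro: less_imp_le[OF frac_lt_1]\<close>)
      have "\<delta> \<le> \<bar>(1 - t s1) - (1 - t s2)\<bar>" if "s1 \<in> S - {s}" "s2 \<in> S - {s}" "s1 \<noteq> s2" for s1 s2
        using ts[OF that] by (simp add: abs_minus_commute)
      then show "(\<Sum>s'\<in>S - {s}. 1 / (1 - t s')) \<le> (1 / \<delta>) * (1 + ln (1 / \<delta>))"
        by (intro sum_inverse_separated_le) (use tb assms in \<open>auto simp: t_def\<close>)
    qed auto
    finally have "(\<Sum>s'\<in>S - {s}. norm (K s s')) \<le> (1 / \<delta>) * (1 + ln (1 / \<delta>))" by (simp only: add_divide_distrib field_sum_of_halves)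
    moreover have "norm (K s s) \<le> real N" by (simp add: K_def)
    ultimately show ?thesis using s assms(1) by (simp add: sum.remove)
  qed
  have "of_real (\<Sum>n=1..N. (norm (\<Sum>s\<in>S. c s * cis (2 * pi * (real n * x s))))\<^sup>2)
      = (\<Sum>n=1..N. \<Sum>s\<in>S. \<Sum>s'\<in>S. (c s * cis (2 * pi * (real n * x s))) * cnj (c s' * cis (2 * pi * (real n * x s'))))"
    by (simp only: of_real_sum complex_norm_square cnj_sum sum_product)
  also have "\<dots> = (\<Sum>n=1..N. \<Sum>s\<in>S. \<Sum>s'\<in>S. c s * cnj (c s') * cis (2 * pi * (real n * (x s - x s'))))"
    unfolding complex_cnj_mult cis_cnj
  proof (intro sum.cong refl)
    fix n s s'
    have "cis (2 * pi * (real n * (x s - x s'))) = cis (2 * pi * (real n * x s)) * cis (- (2 * pi * (real n * x s')))"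
      by (simp add: cis_mult algebra_simps)
    then show "c s * cis (2 * pi * (real n * x s)) * (cnj (c s') * cis (- (2 * pi * (real n * x s'))))
        = c s * cnj (c s') * cis (2 * pi * (real n * (x s - x s')))" by simp
  qed
  also have "\<dots> = (\<Sum>s\<in>S. \<Sum>n=1..N. \<Sum>s'\<in>S. c s * cnj (c s') * cis (2 * pi * (real n * (x s - x s'))))"
    by (rule sum.swap)
  also have "\<dots> = (\<Sum>s\<in>S. \<Sum>s'\<in>S. c s * cnj (c s') * K s s')"
    unfolding K_def by (subst sum.swap) (simp add: sum_distrib_left)
  finally have eq: "of_real (\<Sum>n=1..N. (norm (\<Sum>s\<in>S. c s * cis (2 * pi * (real n * x s))))\<^sup>2)
      = (\<Sum>s\<in>S. \<Sum>s'\<in>S. c s * cnj (c s') * K s s')" .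
  have "(\<Sum>n=1..N. (norm (\<Sum>s\<in>S. c s * cis (2 * pi * (real n * x s))))\<^sup>2)
      = norm (of_real (\<Sum>n=1..N. (norm (\<Sum>s\<in>S. c s * cis (2 * pi * (real n * x s))))\<^sup>2) :: complex)"
    by (simp add: sum_nonneg del: of_real_sum of_real_power)
  also have "\<dots> = norm (\<Sum>s\<in>S. \<Sum>s'\<in>S. c s * cnj (c s') * K s s')" by (simp only: eq)
  also have "\<dots> \<le> (\<Sum>s\<in>S. \<Sum>s'\<in>S. norm (c s) * norm (c s') * norm (K s s'))"
    by (intro sum_norm_le order_trans[OF norm_sum]) (auto simp: norm_mult intro!: sum_mono)
  \<comment> \<open>Schur's test: \<open>norm (K s s')\<close> is symmetric, so the
    arithmetic-geometric mean inequality reduces the quadratic form to its row sums.\<close>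
  also have "\<dots> \<le> (\<Sum>s\<in>S. \<Sum>s'\<in>S. ((norm (c s))\<^sup>2 * norm (K s s') + (norm (c s'))\<^sup>2 * norm (K s s')) / 2)"
  proof (intro sum_mono)
    fix s s'
    have "norm (c s) * norm (c s') * norm (K s s') \<le> ((norm (c s))\<^sup>2 + (norm (c s'))\<^sup>2) / 2 * norm (K s s')"
      using sum_squares_bound[of "norm (c s)" "norm (c s')"] by (intro mult_right_mono) auto
    then show "norm (c s) * norm (c s') * norm (K s s')
      \<le> ((norm (c s))\<^sup>2 * norm (K s s') + (norm (c s'))\<^sup>2 * norm (K s s')) / 2"
      by (simp add: field_simps)
  qed
  also have "\<dots> = ((\<Sum>s\<in>S. \<Sum>s'\<in>S. (norm (c s))\<^sup>2 * norm (K s s'))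
                + (\<Sum>s\<in>S. \<Sum>s'\<in>S. (norm (c s'))\<^sup>2 * norm (K s s'))) / 2"
    by (simp add: sum.distrib sum_divide_distrib[symmetric])
  also have "(\<Sum>s\<in>S. \<Sum>s'\<in>S. (norm (c s'))\<^sup>2 * norm (K s s')) = (\<Sum>s\<in>S. \<Sum>s'\<in>S. (norm (c s))\<^sup>2 * norm (K s s'))"
    by (subst sum.swap) (simp add: Ksym)
  also have "((\<Sum>s\<in>S. \<Sum>s'\<in>S. (norm (c s))\<^sup>2 * norm (K s s')) + (\<Sum>s\<in>S. \<Sum>s'\<in>S. (norm (c s))\<^sup>2 * norm (K s s'))) / 2
      = (\<Sum>s\<in>S. (norm (c s))\<^sup>2 * (\<Sum>s'\<in>S. norm (K s s')))"
    by (simp only: add_divide_distrib field_sum_of_halves sum_distrib_left)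
  also have "\<dots> \<le> (\<Sum>s\<in>S. (norm (c s))\<^sup>2 * (real N + (1 / \<delta>) * (1 + ln (1 / \<delta>))))"
    by (intro sum_mono mult_left_mono row) auto
  also have "\<dots> = (real N + (1 / \<delta>) * (1 + ln (1 / \<delta>))) * (\<Sum>s\<in>S. (norm (c s))\<^sup>2)"
    by (subst mult.commute) (rule sum_distrib_right[symmetric])
  finally show ?thesis .
qed

section \<open>Fourier analysis modulo primes and the spacing of the fractions\<close>

lemma sum_cis_residues:
  fixes k :: int
  assumes "p > 0"
  shows "(\<Sum>a<p. cis (2 * pi * (real a * of_int k / real p))) = (if int p dvd k then of_nat p else 0)"
proof -
  define z where "z = cis (2 * pi * (of_int k / real p))"
  have pw: "cis (2 * pi * (real a * of_int k / real p)) = z ^ a" for a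
    unfolding z_def Complex.DeMoivre by (rule arg_cong[where f = cis]) simp
  have zp: "z ^ p = 1"
  proof -
    have "z ^ p = cis (2 * pi * of_int k)" using assms by (simp add: z_def Complex.DeMoivre mult_ac)
    also have "\<dots> = 1" by (rule cis_multiple_2pi) auto
    finally show ?thesis .
  qed
  have z1: "z = 1 \<longleftrightarrow> int p dvd k"
  proof
    assume "z = 1"
    then have "cos (2 * pi * (of_int k / real p)) = 1" by (simp add: z_def cis.ctr complex_eq_iff)
    then obtain m :: int where "2 * pi * (of_int k / real p) = of_int m * 2 * pi"
      unfolding cos_one_2pi_int by auto
    then have "of_int k = (of_int m * of_int (int p) :: real)" using assms by (simp add: field_simps)
    then have "k = m * int p" by (metis of_int_mult of_int_eq_iff)
    then show "int p dvd k" by simp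
  next
    assume "int p dvd k"
    then obtain m where "k = int p * m" by (auto elim: dvdE)
    then have "z = cis (2 * pi * of_int m)" using assms by (simp add: z_def)
    also have "\<dots> = 1" by (rule cis_multiple_2pi) auto
    finally show "z = 1" .
  qed
  show ?thesis
  proof (cases "z = 1")
    case True
    then have "(\<Sum>a<p. z ^ a) = of_nat p" by simp
    then show ?thesis using z1 True by (simp only: pw) simp
  next
    case False
    have "(\<Sum>a<p. z ^ a) = (1 - z ^ p) / (1 - z)" using False by (subst sum_gp_strict) auto
    then show ?thesis using False z1 zp by (simp only: pw) simp
  qed
qed

lemma int_dvd_diff_small:
  fixes r n :: nat
  assumes "r < p"
  shows "int p dvd int n - int r \<longleftrightarrow> r = n mod p"
proof -
  have "int p dvd int n - int r \<longleftrightarrow> int n mod int p = int r mod int p"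
    by (rule mod_eq_dvd_iff[symmetric])
  also have "\<dots> \<longleftrightarrow> n mod p = r mod p" by (metis of_nat_eq_iff zmod_int)
  finally show ?thesis using assms by auto
qed

text \<open>Fourier inversion and Parseval modulo \<open>p\<close>. The vanishing mean removes the
  coefficient at \<open>a = 0\<close>, which is why the sums start at 1.\<close>

lemma dft_mean_zero:
  fixes g :: "nat \<Rightarrow> real"
  assumes p: "p > 0" and z: "(\<Sum>r<p. g r) = 0"
  obtains c :: "nat \<Rightarrow> complex" where
    "\<And>n. of_real (g (n mod p)) = (\<Sum>a\<in>{1..<p}. c a * cis (2 * pi * (real n * (real a / real p))))"
    "(\<Sum>a\<in>{1..<p}. (norm (c a))\<^sup>2) = (\<Sum>r<p. (g r)\<^sup>2) / real p"
proof -
  define c where "c a = (\<Sum>r<p. of_real (g r) * cis (- (2 * pi * (real r * (real a / real p))))) / of_nat p" for a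
  have c0: "c 0 = 0" using z by (simp add: c_def flip: of_real_sum)
  have sp: "{..<p} = insert 0 {1..<p}" using p by auto
  have inv: "(\<Sum>a<p. c a * cis (2 * pi * (real n * (real a / real p)))) = of_real (g (n mod p))" for n
  proof -
    have "(\<Sum>a<p. c a * cis (2 * pi * (real n * (real a / real p))))
       = (\<Sum>a<p. \<Sum>r<p. of_real (g r) / of_nat p * cis (2 * pi * (real a * of_int (int n - int r) / real p)))"
      unfolding c_def sum_divide_distrib sum_distrib_right
    proof (intro sum.cong refl)
      fix a r
      have "cis (2 * pi * (real a * of_int (int n - int r) / real p))
          = cis (- (2 * pi * (real r * (real a / real p)))) * cis (2 * pi * (real n * (real a / real p)))"
        using p by (simp add: cis_mult field_simps)
      then show "of_real (g r) * cis (- (2 * pi * (real r * (real a / real p)))) / of_nat p * cis (2 * pi * (real n * (real a / real p)))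
        = of_real (g r) / of_nat p * cis (2 * pi * (real a * of_int (int n - int r) / real p))"
        by simp
    qed
    also have "\<dots> = (\<Sum>r<p. of_real (g r) / of_nat p * (\<Sum>a<p. cis (2 * pi * (real a * of_int (int n - int r) / real p))))"
      by (subst sum.swap) (simp add: sum_distrib_left)
    also have "\<dots> = (\<Sum>r<p. of_real (g r) / of_nat p * (if r = n mod p then of_nat p else 0))"
      by (intro sum.cong refl) (subst sum_cis_residues[OF p], subst int_dvd_diff_small, auto)
    also have "\<dots> = (\<Sum>r<p. if r = n mod p then of_real (g r) else 0)"
      using p by (intro sum.cong refl) auto
    also have "\<dots> = of_real (g (n mod p))" using p by simp
    finally show ?thesis .
  qed
  have pars: "of_real (\<Sum>a<p. (norm (c a))\<^sup>2) = (of_real ((\<Sum>r<p. (g r)\<^sup>2) / real p) :: complex)"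
  proof -
    have "of_real (\<Sum>a<p. (norm (c a))\<^sup>2) = (\<Sum>a<p. c a * cnj (c a))"
      by (simp only: of_real_sum complex_norm_square)
    also have "\<dots> = (\<Sum>a<p. c a * (\<Sum>r<p. of_real (g r) * cis (2 * pi * (real r * (real a / real p)))) / of_nat p)"
    proof (intro sum.cong refl)
      fix a
      have "cnj (c a) = (\<Sum>r<p. of_real (g r) * cis (2 * pi * (real r * (real a / real p)))) / of_nat p"
        unfolding c_def complex_cnj_divide cnj_sum complex_cnj_mult cis_cnj by simp
      then show "c a * cnj (c a) = c a * (\<Sum>r<p. of_real (g r) * cis (2 * pi * (real r * (real a / real p)))) / of_nat p"
        by simp
    qed
    also have "\<dots> = (\<Sum>a<p. \<Sum>r<p. of_real (g r) / of_nat p * (c a * cis (2 * pi * (real r * (real a / real p)))))"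
      by (simp add: sum_distrib_left sum_divide_distrib mult_ac)
    also have "\<dots> = (\<Sum>r<p. of_real (g r) / of_nat p * (\<Sum>a<p. c a * cis (2 * pi * (real r * (real a / real p)))))"
      by (subst sum.swap) (simp add: sum_distrib_left)
    also have "\<dots> = (\<Sum>r<p. of_real (g r) / of_nat p * of_real (g r))"
      by (intro sum.cong refl) (subst inv, simp)
    also have "\<dots> = of_real ((\<Sum>r<p. (g r)\<^sup>2) / real p)"
      by (simp add: sum_divide_distrib power2_eq_square)
    finally show ?thesis .
  qed
  then have pars': "(\<Sum>a<p. (norm (c a))\<^sup>2) = (\<Sum>r<p. (g r)\<^sup>2) / real p"
    by (simp only: of_real_eq_iff)
  show ?thesis
    using inv pars' by (intro that[of c]) (simp_all add: sp c0)
qed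

lemma prod_cis: "(\<Prod>i\<in>A. cis (f i)) = cis (\<Sum>i\<in>A. f i)"
  by (induction A rule: infinite_finite_induct) (auto simp: cis_mult)

text \<open>Multiplying by the product \<open>R\<close> of the other primes clears every denominator
  but \<open>q\<close>, and \<open>q\<close> is coprime to \<open>R\<close>.\<close>

lemma sum_fractions_int_imp_dvd:
  fixes d :: "nat \<Rightarrow> int"
  assumes "finite U" and pr: "\<And>p. p \<in> U \<Longrightarrow> prime p"
    and int: "(\<Sum>p\<in>U. of_int (d p) / real p) \<in> \<int>" and q: "q \<in> U"
  shows "int q dvd d q"
proof -
  define R where "R = \<Prod>(U - {q})"
  obtain k where k: "(\<Sum>p\<in>U. of_int (d p) / real p) = of_int k" using int by (auto elim: Ints_cases)
  have Rp: "real R / real p \<in> \<int>" if "p \<in> U - {q}" for p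
  proof -
    have "p dvd R" unfolding R_def using that assms(1) by (intro dvd_prodI) auto
    then obtain m where "R = p * m" by (auto elim: dvdE)
    moreover have "p > 0" using pr that prime_gt_0_nat by auto
    ultimately show ?thesis by auto
  qed
  have "of_int k = of_int (d q) / real q + (\<Sum>p\<in>U - {q}. of_int (d p) / real p)"
    unfolding k[symmetric] by (rule sum.remove) fact+
  then have "real R * of_int (d q) / real q = real R * of_int k - (\<Sum>p\<in>U - {q}. real R * (of_int (d p) / real p))"
    by (simp only: sum_distrib_left[symmetric]) (simp add: algebra_simps)
  also have "(\<Sum>p\<in>U - {q}. real R * (of_int (d p) / real p)) = (\<Sum>p\<in>U - {q}. of_int (d p) * (real R / real p))"
    by (simp add: mult_ac)
  also have "real R * of_int k - \<dots> \<in> \<int>"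
    by (intro Ints_diff Ints_mult Ints_sum Ints_of_int Ints_of_nat Rp)
  finally obtain m :: int where m: "real R * of_int (d q) / real q = of_int m" by (auto elim: Ints_cases)
  have q0: "prime q" "q > 0" using pr q prime_gt_0_nat by auto
  have "of_int (int R * d q) = (of_int (m * int q) :: real)" using m q0 by (simp add: field_simps)
  then have "int R * d q = m * int q" by (simp only: of_int_eq_iff)
  then have "int q dvd int R * d q" by simp
  moreover have "coprime (int q) (int R)"
  proof -
    have "coprime q R" unfolding R_def
    proof (rule prod_coprime_right)
      fix p assume "p \<in> U - {q}"
      then show "coprime q p" using pr q0 by (intro primes_coprime) auto
    qed
    then show ?thesis by simp
  qed
  ultimately show ?thesis by (simp add: coprime_dvd_mult_right_iff)
qed

text \<open>The difference is a rational number with denominator dividing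
  \<open>\<Prod>I * \<Prod>J\<close>, so it is enough that it does not vanish. Since every numerator
  is prime to its denominator, the fraction modulo 1 determines both the set of primes and the
  numerators.\<close>

lemma fractions_separated:
  fixes a b :: "nat \<Rightarrow> nat" and k :: int
  assumes fin: "finite I" "finite J" and pr: "\<And>p. p \<in> I \<union> J \<Longrightarrow> prime p"
    and a: "a \<in> Pi\<^sub>E I (\<lambda>p. {1..<p})" and b: "b \<in> Pi\<^sub>E J (\<lambda>p. {1..<p})"
    and ne: "(I, a) \<noteq> (J, b)"
  shows "1 \<le> \<bar>(\<Sum>p\<in>I. real (a p) / real p) - (\<Sum>p\<in>J. real (b p) / real p) - of_int k\<bar> * (real (\<Prod>I) * real (\<Prod>J))"
proof -
  define y where "y = (\<Sum>p\<in>I. real (a p) / real p) - (\<Sum>p\<in>J. real (b p) / real p) - of_int k"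
  have y0: "y \<noteq> 0"
  proof
    assume "y = 0"
    \<comment> \<open>Extension by zero puts both sums over \<open>I \<union> J\<close>; the sets
      are recovered as the places where the numerators do not vanish.\<close>
    define a' where "a' p = (if p \<in> I then int (a p) else 0)" for p
    define b' where "b' p = (if p \<in> J then int (b p) else 0)" for p
    have "(\<Sum>p\<in>I. real (a p) / real p) = (\<Sum>p\<in>I \<union> J. of_int (a' p) / real p)"
      using fin by (intro sum.mono_neutral_cong_left) (auto simp: a'_def)
    moreover have "(\<Sum>p\<in>J. real (b p) / real p) = (\<Sum>p\<in>I \<union> J. of_int (b' p) / real p)"
      using fin by (intro sum.mono_neutral_cong_left) (auto simp: b'_def)
    ultimately have "(\<Sum>p\<in>I \<union> J. of_int (a' p - b' p) / real p) = of_int k"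
      using \<open>y = 0\<close> by (simp add: y_def diff_divide_distrib sum_subtractf)
    then have dv: "int q dvd a' q - b' q" if "q \<in> I \<union> J" for q
      using fin pr that by (intro sum_fractions_int_imp_dvd[of "I \<union> J"]) auto
    have eq: "a' q = b' q" if q: "q \<in> I \<union> J" for q
    proof -
      have "q > 0" using pr[OF q] by (rule prime_gt_0_nat)
      then have "0 \<le> a' q" "a' q < int q" "0 \<le> b' q" "b' q < int q"
        using a b by (auto simp: a'_def b'_def PiE_iff)
      then have "\<bar>a' q - b' q\<bar> < int q" by linarith
      then show ?thesis using dv[OF q] zdvd_not_zless[of "\<bar>a' q - b' q\<bar>" "int q"] by fastforce
    qed
    have aI: "a' q \<noteq> 0 \<longleftrightarrow> q \<in> I" for q using a by (force simp: a'_def PiE_iff)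
    have bJ: "b' q \<noteq> 0 \<longleftrightarrow> q \<in> J" for q using b by (force simp: b'_def PiE_iff)
    have "I = J" using aI bJ eq by (metis Un_iff subset_antisym subsetI)
    moreover have "a = b"
    proof
      fix q show "a q = b q"
      proof (cases "q \<in> I")
        case True
        then show ?thesis using eq[of q] \<open>I = J\<close> by (simp add: a'_def b'_def)
      next
        case False
        then show ?thesis using a b \<open>I = J\<close> by (simp add: PiE_iff extensional_def)
      qed
    qed
    ultimately show False using ne by simp
  qed
  have clear: "real (\<Prod>K) * (\<Sum>p\<in>K. real (f p) / real p) \<in> \<int>"
    if "finite K" "\<And>p. p \<in> K \<Longrightarrow> prime p" for K and f :: "nat \<Rightarrow> nat"
    unfolding sum_distrib_left
  proof (rule Ints_sum)
    fix p assume p: "p \<in> K"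
    then have "p dvd \<Prod>K" using that by (intro dvd_prodI) auto
    then obtain m where "\<Prod>K = p * m" by (auto elim: dvdE)
    moreover have "p > 0" using that p prime_gt_0_nat by auto
    ultimately show "real (\<Prod>K) * (real (f p) / real p) \<in> \<int>" by auto
  qed
  have "y * (real (\<Prod>I) * real (\<Prod>J)) = real (\<Prod>J) * (real (\<Prod>I) * (\<Sum>p\<in>I. real (a p) / real p))
     - real (\<Prod>I) * (real (\<Prod>J) * (\<Sum>p\<in>J. real (b p) / real p)) - of_int k * (real (\<Prod>I) * real (\<Prod>J))"
    by (simp add: y_def algebra_simps)
  also have "\<dots> \<in> \<int>"
    using fin pr by (intro Ints_diff Ints_mult Ints_of_int Ints_of_nat clear) auto
  finally obtain m :: int where m: "y * (real (\<Prod>I) * real (\<Prod>J)) = of_int m" by (auto elim: Ints_cases)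
  have pos: "0 < real (\<Prod>I) * real (\<Prod>J)"
    using pr prime_gt_0_nat by (auto intro!: mult_pos_pos prod_pos)
  then have "m \<noteq> 0" using m y0 by auto
  then have "1 \<le> \<bar>of_int m :: real\<bar>" by linarith
  also have "\<dots> = \<bar>y\<bar> * (real (\<Prod>I) * real (\<Prod>J))" unfolding m[symmetric] abs_mult[of y] using pos by (simp only: abs_of_pos)
  finally show ?thesis by (simp add: y_def)
qed

text \<open>Weights of the dual form: \<open>g p\<close> equals \<open>-1\<close> on the forbidden classes and \<open>h p\<close> elsewhere, so it has mean
  zero modulo \<open>p\<close> and mean square \<open>h p\<close>. Mean zero means that products of the \<open>g p\<close> only involve
  frequencies \<open>\<Sum> a\<^sub>p / p\<close> with all \<open>a\<^sub>p \<noteq> 0\<close>; these are distinct reduced fractions of denominator at most \<open>Q\<close>.\<close>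

theorem large_sieve:
  fixes D Z :: "nat set" and Om :: "nat \<Rightarrow> nat set" and Q :: real
  assumes finD: "finite D" and pr: "\<And>p. p \<in> D \<Longrightarrow> prime p"
    and Z: "Z \<subseteq> {1..N}"
    and Om: "\<And>p. p \<in> D \<Longrightarrow> Om p \<subseteq> {..<p}" "\<And>p. p \<in> D \<Longrightarrow> card (Om p) < p"
    and avoid: "\<And>p z. p \<in> D \<Longrightarrow> z \<in> Z \<Longrightarrow> z mod p \<notin> Om p"
    and Q: "Q \<ge> 1"
  shows "real (card Z) * (\<Sum>I | I \<subseteq> D \<and> real (\<Prod>I) \<le> Q. \<Prod>p\<in>I. real (card (Om p)) / real (p - card (Om p)))
     \<le> real N + Q\<^sup>2 * (1 + 2 * ln Q)"
proof -
  define F where "F = {I. I \<subseteq> D \<and> real (\<Prod>I) \<le> Q}"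
  have finF: "finite F" using finD by (auto simp: F_def)
  have FD: "finite I" "I \<subseteq> D" "real (\<Prod>I) \<le> Q" if "I \<in> F" for I
    using that finD by (auto simp: F_def finite_subset)
  define h where "h p = real (card (Om p)) / real (p - card (Om p))" for p
  define L where "L = (\<Sum>I\<in>F. \<Prod>p\<in>I. h p)"
  define g where "g p r = (if r \<in> Om p then -1 else h p)" for p r
  have split: "{..<p} = Om p \<union> ({..<p} - Om p)" "card ({..<p} - Om p) = p - card (Om p)" "finite (Om p)" if "p \<in> D" for p
    using Om(1)[OF that] by (auto simp: card_Diff_subset finite_subset)
  have sg: "(\<Sum>r<p. f (g p r)) = real (card (Om p)) * f (-1) + real (p - card (Om p)) * f (h p)" if p: "p \<in> D" for p and f :: "real \<Rightarrow> real"
  proof -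
    have "(\<Sum>r<p. f (g p r)) = (\<Sum>r\<in>Om p. f (g p r)) + (\<Sum>r\<in>{..<p} - Om p. f (g p r))"
      using split[OF p] by (subst split(1)[OF p]) (intro sum.union_disjoint, auto)
    also have "\<dots> = real (card (Om p)) * f (-1) + real (p - card (Om p)) * f (h p)"
      using split(2)[OF p] by (simp add: g_def)
    finally show ?thesis .
  qed
  have g0: "(\<Sum>r<p. g p r) = 0" if p: "p \<in> D" for p
    using sg[OF p, of "\<lambda>x. x"] Om(2)[OF p] by (simp add: h_def)
  have g2: "(\<Sum>r<p. (g p r)\<^sup>2) / real p = h p" if p: "p \<in> D" for p
  proof -
    define u where "u = real (p - card (Om p))"
    have u: "u > 0" "real p = real (card (Om p)) + u" using Om(2)[OF p] by (auto simp: u_def)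
    have "(\<Sum>r<p. (g p r)\<^sup>2) = real (card (Om p)) + u * (real (card (Om p)) / u)\<^sup>2"
      using sg[OF p, of "\<lambda>x. x\<^sup>2"] by (simp add: h_def u_def)
    also have "\<dots> = real (card (Om p)) / u * real p"
      unfolding u(2) using u(1) by (simp add: field_simps power2_eq_square)
    also have "\<dots> = h p * real p" by (simp only: h_def u_def)
    finally have eq: "(\<Sum>r<p. (g p r)\<^sup>2) = h p * real p" .
    have "real p \<noteq> 0" using Om(2)[OF p] by simp
    then show ?thesis unfolding eq by simp
  qed
  have "\<forall>p\<in>D. \<exists>c. (\<forall>n. of_real (g p (n mod p)) = (\<Sum>a\<in>{1..<p}. c a * cis (2 * pi * (real n * (real a / real p)))))
     \<and> (\<Sum>a\<in>{1..<p}. (norm (c a))\<^sup>2) = h p"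
  proof
    fix p assume p: "p \<in> D"
    have "p > 0" using pr[OF p] by (rule prime_gt_0_nat)
    from this g0[OF p] obtain c where c: "\<And>n. of_real (g p (n mod p)) = (\<Sum>a\<in>{1..<p}. c a * cis (2 * pi * (real n * (real a / real p))))"
      "(\<Sum>a\<in>{1..<p}. (norm (c a))\<^sup>2) = (\<Sum>r<p. (g p r)\<^sup>2) / real p"
      by (rule dft_mean_zero) blast
    show "\<exists>c. (\<forall>n. of_real (g p (n mod p)) = (\<Sum>a\<in>{1..<p}. c a * cis (2 * pi * (real n * (real a / real p)))))
     \<and> (\<Sum>a\<in>{1..<p}. (norm (c a))\<^sup>2) = h p"
      by (rule exI[of _ c]) (use c g2[OF p] in auto)
  qed
  from bchoice[OF this] obtain C where C:
    "\<forall>p\<in>D. (\<forall>n. of_real (g p (n mod p)) = (\<Sum>a\<in>{1..<p}. C p a * cis (2 * pi * (real n * (real a / real p)))))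
       \<and> (\<Sum>a\<in>{1..<p}. (norm (C p a))\<^sup>2) = h p"
    by (elim exE)
  have C1: "of_real (g p (n mod p)) = (\<Sum>a\<in>{1..<p}. C p a * cis (2 * pi * (real n * (real a / real p))))"
    if "p \<in> D" for p n
    by (rule bspec[OF C that, THEN conjunct1, THEN spec])
  have C2: "(\<Sum>a\<in>{1..<p}. (norm (C p a))\<^sup>2) = h p" if "p \<in> D" for p
    by (rule bspec[OF C that, THEN conjunct2])
  define S where "S = Sigma F (\<lambda>I. Pi\<^sub>E I (\<lambda>p. {1..<p}))"
  define cc where "cc = (\<lambda>(I, a). \<Prod>p\<in>I. C p (a p))"
  define x where "x = (\<lambda>(I, a). \<Sum>p\<in>I. real (a p) / real p)"
  have finS: "finite S" unfolding S_def using finF FD by (auto intro!: finite_PiE)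
  have expand: "of_real (\<Prod>p\<in>I. g p (n mod p)) = (\<Sum>a\<in>Pi\<^sub>E I (\<lambda>p. {1..<p}). cc (I, a) * cis (2 * pi * (real n * x (I, a))))"
    if I: "I \<in> F" for I n
  proof -
    have "of_real (\<Prod>p\<in>I. g p (n mod p)) = (\<Prod>p\<in>I. \<Sum>a\<in>{1..<p}. C p a * cis (2 * pi * (real n * (real a / real p))))"
      unfolding of_real_prod using FD[OF I] by (intro prod.cong refl C1) auto
    also have "\<dots> = (\<Sum>a\<in>Pi\<^sub>E I (\<lambda>p. {1..<p}). \<Prod>p\<in>I. C p (a p) * cis (2 * pi * (real n * (real (a p) / real p))))"
      using FD[OF I] by (intro prod_sum_PiE) auto
    also have "\<dots> = (\<Sum>a\<in>Pi\<^sub>E I (\<lambda>p. {1..<p}). cc (I, a) * cis (2 * pi * (real n * x (I, a))))"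
      unfolding prod.distrib prod_cis by (simp add: cc_def x_def sum_distrib_left)
    finally show ?thesis .
  qed
  have total: "(\<Sum>s\<in>S. cc s * cis (2 * pi * (real n * x s))) = of_real (\<Sum>I\<in>F. \<Prod>p\<in>I. g p (n mod p))" for n
  proof -
    have "(\<Sum>s\<in>S. cc s * cis (2 * pi * (real n * x s)))
        = (\<Sum>I\<in>F. \<Sum>a\<in>Pi\<^sub>E I (\<lambda>p. {1..<p}). cc (I, a) * cis (2 * pi * (real n * x (I, a))))"
      unfolding S_def using finF FD by (subst sum.Sigma) (auto intro!: finite_PiE simp: case_prod_unfold)
    then show ?thesis by (simp only: expand of_real_sum cong: sum.cong)
  qed
  have cc2: "(\<Sum>s\<in>S. (norm (cc s))\<^sup>2) = L"
  proof -
    have "(\<Sum>s\<in>S. (norm (cc s))\<^sup>2) = (\<Sum>I\<in>F. \<Sum>a\<in>Pi\<^sub>E I (\<lambda>p. {1..<p}). (norm (cc (I, a)))\<^sup>2)"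
      unfolding S_def using finF FD by (subst sum.Sigma) (auto intro!: finite_PiE simp: case_prod_unfold)
    also have "\<dots> = (\<Sum>I\<in>F. \<Sum>a\<in>Pi\<^sub>E I (\<lambda>p. {1..<p}). \<Prod>p\<in>I. (norm (C p (a p)))\<^sup>2)"
      by (simp add: cc_def prod_norm[symmetric] prod_power_distrib)
    also have "\<dots> = (\<Sum>I\<in>F. \<Prod>p\<in>I. \<Sum>a\<in>{1..<p}. (norm (C p a))\<^sup>2)"
      using FD by (intro sum.cong refl prod_sum_PiE[symmetric]) auto
    also have "\<dots> = L"
      unfolding L_def using FD(2) by (intro sum.cong prod.cong refl C2) blast
    finally show ?thesis .
  qed
  have sep: "1 / Q\<^sup>2 \<le> \<bar>x s - x s' - of_int k\<bar>" if "s \<in> S" "s' \<in> S" "s \<noteq> s'" for s s' k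
  proof -
    obtain I a J b where s: "s = (I, a)" "s' = (J, b)" by (cases s, cases s')
    have IJ: "I \<in> F" "J \<in> F" "a \<in> Pi\<^sub>E I (\<lambda>p. {1..<p})" "b \<in> Pi\<^sub>E J (\<lambda>p. {1..<p})"
      using that by (auto simp: s S_def)
    have "1 \<le> \<bar>x s - x s' - of_int k\<bar> * (real (\<Prod>I) * real (\<Prod>J))"
      unfolding s x_def prod.case using IJ FD[OF IJ(1)] FD[OF IJ(2)] pr that
      by (intro fractions_separated) (auto simp: s)
    also have "\<dots> \<le> \<bar>x s - x s' - of_int k\<bar> * (Q * Q)"
      using FD[OF IJ(1)] FD[OF IJ(2)] Q by (intro mult_left_mono mult_mono) (auto intro!: prod_nonneg)
    finally show ?thesis using Q by (simp add: field_simps power2_eq_square)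
  qed
  have h0: "h p \<ge> 0" for p by (simp add: h_def)
  have F0: "{} \<in> F" using Q by (simp add: F_def)
  \<comment> \<open>The empty set of primes contributes 1, so \<open>L\<close> is positive and can
    be cancelled at the end.\<close>
  have L1: "L \<ge> 1"
  proof -
    have "(\<Prod>p\<in>{}. h p) \<le> L" unfolding L_def
      by (rule member_le_sum) (use F0 finF h0 in \<open>auto intro!: prod_nonneg\<close>)
    then show ?thesis by simp
  qed
  \<comment> \<open>On the sifted set every \<open>g p\<close> takes the value \<open>h p\<close>,
    so the exponential sum equals \<open>L\<close> there, while its coefficients have square sum
    \<open>L\<close> by \<open>cc2\<close>. One factor \<open>L\<close> survives the
    comparison.\<close>
  have "real (card Z) * L\<^sup>2 = (\<Sum>n\<in>Z. (norm (\<Sum>s\<in>S. cc s * cis (2 * pi * (real n * x s))))\<^sup>2)"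
  proof -
    have "(\<Sum>n\<in>Z. (norm (\<Sum>s\<in>S. cc s * cis (2 * pi * (real n * x s))))\<^sup>2) = (\<Sum>n\<in>Z. L\<^sup>2)"
    proof (intro sum.cong refl)
      fix n assume n: "n \<in> Z"
      have "(\<Sum>I\<in>F. \<Prod>p\<in>I. g p (n mod p)) = L"
      proof -
        have gz: "g p (n mod p) = h p" if "p \<in> D" for p
          using avoid[OF that n] by (simp add: g_def)
        show ?thesis unfolding L_def using FD(2) by (intro sum.cong prod.cong refl gz) blast
      qed
      then show "(norm (\<Sum>s\<in>S. cc s * cis (2 * pi * (real n * x s))))\<^sup>2 = L\<^sup>2"
        unfolding total norm_of_real by simp
    qed
    then show ?thesis by simp
  qed
  also have "\<dots> \<le> (\<Sum>n=1..N. (norm (\<Sum>s\<in>S. cc s * cis (2 * pi * (real n * x s))))\<^sup>2)"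
    using Z by (intro sum_mono2) auto
  also have "\<dots> \<le> (real N + (1 / (1 / Q\<^sup>2)) * (1 + ln (1 / (1 / Q\<^sup>2)))) * (\<Sum>s\<in>S. (norm (cc s))\<^sup>2)"
    using finS Q sep by (intro dual_large_sieve) auto
  also have "\<dots> = (real N + Q\<^sup>2 * (1 + 2 * ln Q)) * L"
    using Q by (simp add: cc2 ln_realpow)
  finally have "real (card Z) * L * L \<le> (real N + Q\<^sup>2 * (1 + 2 * ln Q)) * L"
    by (simp add: power2_eq_square mult.assoc)
  then have "real (card Z) * L \<le> real N + Q\<^sup>2 * (1 + 2 * ln Q)"
    using L1 by (simp add: mult_le_cancel_right)
  then show ?thesis by (simp add: L_def F_def h_def)
qed

subsection \<open>Sieving sumsets\<close>

lemma large_sieve_sqrt: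
  fixes D Z :: "nat set" and Om :: "nat \<Rightarrow> nat set" and x :: real
  assumes "finite D" "\<And>p. p \<in> D \<Longrightarrow> prime p"
    and "Z \<subseteq> {1..nat \<lfloor>x\<rfloor>}" and x: "x \<ge> 3"
    and "\<And>p. p \<in> D \<Longrightarrow> Om p \<subseteq> {..<p}" "\<And>p. p \<in> D \<Longrightarrow> card (Om p) < p"
    and "\<And>p z. p \<in> D \<Longrightarrow> z \<in> Z \<Longrightarrow> z mod p \<notin> Om p"
  shows "real (card Z) * (\<Sum>I | I \<subseteq> D \<and> real (\<Prod>I) \<le> sqrt (x / ln x).
           \<Prod>p\<in>I. real (card (Om p)) / real (p - card (Om p))) \<le> 3 * x"
proof -
  define Q where "Q = sqrt (x / ln x)"
  have l1: "1 \<le> ln x" using x exp_le by (subst ln_ge_iff) auto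
  have lx: "ln x \<le> x" using ln_le_minus_one[of x] x by simp
  have q: "1 \<le> x / ln x" using l1 lx x by (subst le_divide_eq_1_pos) auto
  then have Q1: "Q \<ge> 1" by (simp add: Q_def)
  have "real (card Z) * (\<Sum>I | I \<subseteq> D \<and> real (\<Prod>I) \<le> Q.
           \<Prod>p\<in>I. real (card (Om p)) / real (p - card (Om p))) \<le> real (nat \<lfloor>x\<rfloor>) + Q\<^sup>2 * (1 + 2 * ln Q)"
    by (rule large_sieve) (use assms Q1 in auto)
  also have "Q\<^sup>2 * (1 + 2 * ln Q) = (x / ln x) * (1 + ln (x / ln x))"
    using q by (simp add: Q_def ln_sqrt)
  also have "\<dots> \<le> (x / ln x) * (1 + ln x)"
    using q l1 x by (intro mult_left_mono) (auto simp: ln_div)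
  also have "\<dots> \<le> 2 * x" using l1 x by (simp add: field_simps)
  also have "real (nat \<lfloor>x\<rfloor>) \<le> x" using x by simp
  finally show ?thesis by (simp add: Q_def)
qed

definition residue_count :: "nat set \<Rightarrow> nat \<Rightarrow> nat" where
  "residue_count B p = card ((\<lambda>b. b mod p) ` B)"

lemma residue_count_pos: "finite B \<Longrightarrow> B \<noteq> {} \<Longrightarrow> residue_count B p > 0"
  by (auto simp: residue_count_def card_gt_0_iff)

text \<open>The classes forbidden to \<open>A\<close> modulo \<open>p\<close> are the negatives of
  those occupied by \<open>B\<close>, hence \<open>residue_count B p\<close> in number. A nonempty
  \<open>A\<close> leaves one class free, which keeps the sieve weights well defined.\<close>

lemma sumset_sieve:
  fixes A B D :: "nat set" and x :: real
  assumes "finite D" "\<And>p. p \<in> D \<Longrightarrow> prime p" and A: "A \<subseteq> {1..nat \<lfloor>x\<rfloor>}" "A \<noteq> {}" and "finite B" and "x \<ge> 3"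
    and nd: "\<And>p a b. p \<in> D \<Longrightarrow> a \<in> A \<Longrightarrow> b \<in> B \<Longrightarrow> \<not> p dvd a + b"
  shows "\<And>p. p \<in> D \<Longrightarrow> residue_count B p < p"
    and "real (card A) * (\<Sum>I | I \<subseteq> D \<and> real (\<Prod>I) \<le> sqrt (x / ln x).
           \<Prod>p\<in>I. real (residue_count B p) / real (p - residue_count B p)) \<le> 3 * x"
proof -
  \<comment> \<open>The outer \<open>mod\<close> sends the class 0 to itself instead of to
    \<open>p\<close>.\<close>
  define Om where "Om p = (\<lambda>r. (p - r) mod p) ` ((\<lambda>b. b mod p) ` B)" for p
  have pos: "p > 0" if "p \<in> D" for p using assms(2)[OF that] by (rule prime_gt_0_nat)
  have card_Om: "card (Om p) = residue_count B p" if "p \<in> D" for p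
    unfolding Om_def residue_count_def
  proof (rule card_image, rule inj_onI)
    fix r s assume rs: "r \<in> (\<lambda>b. b mod p) ` B" "s \<in> (\<lambda>b. b mod p) ` B" "(p - r) mod p = (p - s) mod p"
    have "r < p" "s < p" using rs pos[OF that] by auto
    with rs(3) show "r = s" by (cases "r = 0"; cases "s = 0") auto
  qed
  have sub: "Om p \<subseteq> {..<p}" if "p \<in> D" for p using pos[OF that] by (auto simp: Om_def)
  have av: "a mod p \<notin> Om p" if p: "p \<in> D" and a: "a \<in> A" for p a
  proof
    assume "a mod p \<in> Om p"
    then obtain b where b: "b \<in> B" "a mod p = (p - b mod p) mod p" by (auto simp: Om_def)
    have "(a + b) mod p = ((p - b mod p) + b mod p) mod p"
      using b(2) by (metis mod_add_cong mod_mod_trivial)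
    also have "(p - b mod p) + b mod p = p" using pos[OF p] by (simp add: less_imp_le)
    finally have "p dvd a + b" by auto
    with nd[OF p a b(1)] show False by simp
  qed
  have lt: "card (Om p) < p" if p: "p \<in> D" for p
  proof -
    obtain a where a: "a \<in> A" using A by auto
    have "Om p \<subset> {..<p}" using sub[OF p] av[OF p a] pos[OF p] by (auto intro!: psubsetI)
    then have "card (Om p) < card {..<p}" by (intro psubset_card_mono) auto
    then show ?thesis by simp
  qed
  then show "\<And>p. p \<in> D \<Longrightarrow> residue_count B p < p" using card_Om by simp
  have "real (card A) * (\<Sum>I | I \<subseteq> D \<and> real (\<Prod>I) \<le> sqrt (x / ln x).
           \<Prod>p\<in>I. real (card (Om p)) / real (p - card (Om p))) \<le> 3 * x"
    by (rule large_sieve_sqrt) (use assms sub av lt in auto)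
  also have "(\<Sum>I | I \<subseteq> D \<and> real (\<Prod>I) \<le> sqrt (x / ln x). \<Prod>p\<in>I. real (card (Om p)) / real (p - card (Om p)))
     = (\<Sum>I | I \<subseteq> D \<and> real (\<Prod>I) \<le> sqrt (x / ln x). \<Prod>p\<in>I. real (residue_count B p) / real (p - residue_count B p))"
    by (intro sum.cong prod.cong refl) (auto simp: card_Om)
  finally show "real (card A) * (\<Sum>I | I \<subseteq> D \<and> real (\<Prod>I) \<le> sqrt (x / ln x).
           \<Prod>p\<in>I. real (residue_count B p) / real (p - residue_count B p)) \<le> 3 * x" .
qed

section \<open>Gallagher's larger sieve\<close>

lemma sum_ln_prime_divisors_le:
  fixes m :: nat
  assumes "finite D" "\<And>p. p \<in> D \<Longrightarrow> prime p \<and> p dvd m" "m > 0"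
  shows "(\<Sum>p\<in>D. ln (real p)) \<le> ln (real m)"
proof -
  have "\<Prod>D dvd m"
    using assms(1,2)
  proof (induction D rule: finite_induct)
    case (insert p D)
    have "coprime p (\<Prod>D)"
    proof (rule prod_coprime_right)
      fix q assume "q \<in> D"
      then show "coprime p q" using insert by (intro primes_coprime) auto
    qed
    then show ?case using insert by (simp add: divides_mult)
  qed simp
  then have le: "\<Prod>D \<le> m" using assms(3) by (rule dvd_imp_le)
  have pos: "\<And>p. p \<in> D \<Longrightarrow> 0 < real p" using assms(2) prime_gt_0_nat by auto
  have "(\<Sum>p\<in>D. ln (real p)) = ln (\<Prod>p\<in>D. real p)"
    using pos by (intro ln_prod[symmetric]) (use assms in auto)
  also have "\<dots> \<le> ln (real m)"
  proof -
    have "0 < (\<Prod>p\<in>D. real p)" using pos by (intro prod_pos) auto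
    moreover have "(\<Prod>p\<in>D. real p) \<le> real m" using le by (simp flip: of_nat_prod)
    ultimately show ?thesis by simp
  qed
  finally show ?thesis .
qed

text \<open>Cauchy-Schwarz over the occupied classes; the double sum counts the pairs of
  \<open>B\<close> that agree modulo \<open>p\<close>.\<close>

lemma card_squared_le_residue_pairs:
  assumes "finite B"
  shows "(real (card B))\<^sup>2 \<le> real (residue_count B p) * (\<Sum>b\<in>B. \<Sum>b'\<in>B. if b mod p = b' mod p then 1 else 0)"
proof -
  define R where "R = (\<lambda>b. b mod p) ` B"
  define z where "z r = (\<Sum>b\<in>B. if b mod p = r then 1 else (0::real))" for r
  have finR: "finite R" using assms by (simp add: R_def)
  have "real (card B) = (\<Sum>b\<in>B. \<Sum>r\<in>R. if b mod p = r then 1 else 0)"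
    using finR by (simp add: R_def)
  also have "\<dots> = (\<Sum>r\<in>R. z r)" unfolding z_def by (rule sum.swap)
  finally have "(real (card B))\<^sup>2 = (\<Sum>r\<in>R. z r)\<^sup>2" by simp
  also have "\<dots> \<le> (\<Sum>r\<in>R. (z r)\<^sup>2) * real (card R)"
    using finR by (intro sum_squared_le_sum_of_squares)
  also have "(\<Sum>r\<in>R. (z r)\<^sup>2) = (\<Sum>r\<in>R. \<Sum>b\<in>B. \<Sum>b'\<in>B. if b mod p = r \<and> b' mod p = r then 1 else 0)"
    unfolding z_def power2_eq_square sum_product by (intro sum.cong refl) auto
  also have "\<dots> = (\<Sum>b\<in>B. \<Sum>b'\<in>B. \<Sum>r\<in>R. if b mod p = r \<and> b' mod p = r then 1 else 0)"
    by (rule trans[OF sum.swap], rule sum.cong[OF refl], rule sum.swap)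
  also have "\<dots> = (\<Sum>b\<in>B. \<Sum>b'\<in>B. if b mod p = b' mod p then 1 else 0)"
  proof (intro sum.cong refl)
    fix b b' assume b: "b \<in> B" "b' \<in> B"
    have "(\<Sum>r\<in>R. if b mod p = r \<and> b' mod p = r then 1 else (0::real))
        = (\<Sum>r\<in>R. if b mod p = r then (if b mod p = b' mod p then 1 else 0) else 0)"
      by (intro sum.cong refl) auto
    also have "\<dots> = (if b mod p = b' mod p then 1 else 0)" using finR b by (simp add: R_def)
    finally show "(\<Sum>r\<in>R. if b mod p = r \<and> b' mod p = r then 1 else (0::real)) = (if b mod p = b' mod p then 1 else 0)" .
  qed
  finally show ?thesis by (simp add: R_def residue_count_def mult.commute)
qed

text \<open>Congruent pairs are weighted by \<open>ln p\<close> and summed over \<open>p\<close>.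
  For two distinct elements only primes dividing their difference occur, with total weight at most
  \<open>ln N\<close>. The inequality is usually solved for the size of the set; here the size is
  known and the residue counts are to be bounded from below.\<close>

theorem larger_sieve:
  fixes B D :: "nat set"
  assumes B: "B \<subseteq> {1..N}" "B \<noteq> {}" and D: "finite D" "\<And>p. p \<in> D \<Longrightarrow> prime p"
  shows "(\<Sum>p\<in>D. ln (real p) / real (residue_count B p)) \<le> ln (real N) + (\<Sum>p\<in>D. ln (real p)) / real (card B)"
proof -
  define n where "n = real (card B)"
  have finB: "finite B" using B finite_subset by blast
  have n0: "n > 0" using B finB by (simp add: n_def card_gt_0_iff)
  have N1: "N \<ge> 1" using B by auto
  have lp: "ln (real p) \<ge> 0" if "p \<in> D" for p using prime_ge_1_nat[OF D(2)[OF that]] by simp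
  have "n\<^sup>2 * (\<Sum>p\<in>D. ln (real p) / real (residue_count B p))
      = (\<Sum>p\<in>D. n\<^sup>2 * (ln (real p) / real (residue_count B p)))"
    by (rule sum_distrib_left)
  also have "\<dots> \<le> (\<Sum>p\<in>D. ln (real p) * (\<Sum>b\<in>B. \<Sum>b'\<in>B. if b mod p = b' mod p then 1 else 0))"
  proof (rule sum_mono)
    fix p assume p: "p \<in> D"
    have r: "real (residue_count B p) > 0" using residue_count_pos[OF finB B(2)] by simp
    have "n\<^sup>2 / real (residue_count B p) \<le> (\<Sum>b\<in>B. \<Sum>b'\<in>B. if b mod p = b' mod p then 1 else 0)"
      using card_squared_le_residue_pairs[OF finB, of p] r by (simp add: n_def pos_divide_le_eq mult.commute)
    from mult_left_mono[OF this lp[OF p]]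
    show "n\<^sup>2 * (ln (real p) / real (residue_count B p)) \<le> (ln (real p) * (\<Sum>b\<in>B. \<Sum>b'\<in>B. if b mod p = b' mod p then 1 else 0))"
      by (simp add: mult.commute)
  qed
  also have "\<dots> = (\<Sum>b\<in>B. \<Sum>b'\<in>B. \<Sum>p\<in>D. if b mod p = b' mod p then ln (real p) else 0)"
  proof -
    have "(\<Sum>p\<in>D. ln (real p) * (\<Sum>b\<in>B. \<Sum>b'\<in>B. if b mod p = b' mod p then 1 else 0))
        = (\<Sum>p\<in>D. \<Sum>b\<in>B. \<Sum>b'\<in>B. if b mod p = b' mod p then ln (real p) else 0)"
      unfolding sum_distrib_left by (intro sum.cong refl) auto
    also have "\<dots> = (\<Sum>b\<in>B. \<Sum>b'\<in>B. \<Sum>p\<in>D. if b mod p = b' mod p then ln (real p) else 0)"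
      by (rule trans[OF sum.swap], rule sum.cong[OF refl], rule sum.swap)
    finally show ?thesis .
  qed
  \<comment> \<open>The term \<open>ln N\<close> is granted to the diagonal pairs as well, so that
    it occurs exactly \<open>n\<^sup>2\<close> times.\<close>
  also have "\<dots> \<le> (\<Sum>b\<in>B. \<Sum>b'\<in>B. (if b = b' then (\<Sum>p\<in>D. ln (real p)) else 0) + ln (real N))"
  proof (intro sum_mono)
    fix b b' assume b: "b \<in> B" "b' \<in> B"
    show "(\<Sum>p\<in>D. if b mod p = b' mod p then ln (real p) else 0)
       \<le> (if b = b' then (\<Sum>p\<in>D. ln (real p)) else 0) + ln (real N)"
    proof (cases "b = b'")
      case True
      then show ?thesis using N1 by simp
    next
      case False
      define m where "m = nat \<bar>int b - int b'\<bar>"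
      have "b \<in> {1..N}" "b' \<in> {1..N}" using b B by blast+
      then have m: "m > 0" "m \<le> N" using False by (auto simp: m_def)
      have dv: "p dvd m" if "b mod p = b' mod p" for p
      proof -
        have "int b mod int p = int b' mod int p" using that by (metis zmod_int)
        then have "int p dvd int b - int b'" by (simp add: mod_eq_dvd_iff)
        then show ?thesis unfolding m_def by (simp only: dvd_nat_abs_iff)
      qed
      have "(\<Sum>p\<in>D. if b mod p = b' mod p then ln (real p) else 0) = (\<Sum>p\<in>{p\<in>D. b mod p = b' mod p}. ln (real p))"
        using D(1) by (simp add: sum.inter_filter)
      also have "\<dots> \<le> ln (real m)" by (rule sum_ln_prime_divisors_le) (use D dv m in auto)
      also have "\<dots> \<le> ln (real N)" using m by simp
      finally show ?thesis using False by simp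
    qed
  qed
  also have "\<dots> = n * (\<Sum>p\<in>D. ln (real p)) + n\<^sup>2 * ln (real N)"
    using finB by (simp add: sum.distrib n_def power2_eq_square distrib_left)
  also have "\<dots> = n\<^sup>2 * (ln (real N) + (\<Sum>p\<in>D. ln (real p)) / n)"
    using n0 by (simp add: field_simps power2_eq_square)
  finally have "n\<^sup>2 * (\<Sum>p\<in>D. ln (real p) / real (residue_count B p)) \<le> n\<^sup>2 * (ln (real N) + (\<Sum>p\<in>D. ln (real p)) / n)" .
  then show ?thesis using n0 by (simp add: n_def)
qed

section \<open>Chebyshev's upper bound and Mertens' first theorem\<close>

lemma central_binomial_le: "(2 * k + 1) choose k \<le> 4 ^ k"
proof -
  have "(\<Sum>i\<in>{k, Suc k}. (2 * k + 1) choose i) \<le> (\<Sum>i\<le>2 * k + 1. (2 * k + 1) choose i)"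
    by (rule sum_mono2) auto
  also have "\<dots> = 2 ^ (2 * k + 1)" by (rule choose_row_sum)
  also have "(\<Sum>i\<in>{k, Suc k}. (2 * k + 1) choose i) = 2 * ((2 * k + 1) choose k)"
    using binomial_symmetric[of k "2 * k + 1"] by simp
  finally show ?thesis by (simp add: power_mult)
qed

text \<open>For odd \<open>n = 2 * k + 1\<close> the primes in \<open>(k + 1, n]\<close> all divide
  \<open>n choose k\<close>, which is at most \<open>4 ^ k\<close>; an even \<open>n > 2\<close> is
  not prime and adds nothing.\<close>

lemma theta_le: "(\<Sum>p | prime p \<and> p \<le> n. ln (real p)) \<le> real n * ln 4"
proof (induction n rule: less_induct)
  case (less n)
  have fin: "finite {p. prime p \<and> p \<le> m}" for m :: nat by simp
  consider "n \<le> 1" | "n = 2" | "n > 2" "even n" | "n > 2" "odd n" by linarith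
  then show ?case
  proof cases
    case 1
    then have "{p::nat. prime p \<and> p \<le> n} = {}" by (auto dest!: prime_ge_2_nat)
    then show ?thesis by (simp only: sum.empty) simp
  next
    case 2
    then have "{p::nat. prime p \<and> p \<le> n} = {2}" using prime_ge_2_nat by (auto intro!: antisym)
    moreover have "ln (2::real) \<le> ln 4" "0 \<le> ln (4::real)" by auto
    then have "ln (2::real) \<le> 2 * ln 4" by linarith
    ultimately show ?thesis using 2 by simp
  next
    case 3
    have "{p::nat. prime p \<and> p \<le> n} = {p. prime p \<and> p \<le> n - 1}"
    proof -
      have "\<not> prime n" using 3 prime_odd_nat by auto
      then show ?thesis using 3 by (auto simp: le_less)
    qed
    then have "(\<Sum>p | prime p \<and> p \<le> n. ln (real p)) \<le> real (n - 1) * ln 4" using less[of "n - 1"] 3 by simp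
    also have "\<dots> \<le> real n * ln 4" by (intro mult_right_mono) auto
    finally show ?thesis .
  next
    case 4
    then obtain k where k: "n = 2 * k + 1" by (auto elim: oddE)
    have k1: "k \<ge> 1" using 4 k by simp
    have un: "{p::nat. prime p \<and> p \<le> n} = {p. prime p \<and> p \<le> k + 1} \<union> {p. prime p \<and> k + 1 < p \<and> p \<le> n}"
      using k by auto
    have "(\<Sum>p | prime p \<and> p \<le> n. ln (real p))
       = (\<Sum>p | prime p \<and> p \<le> k + 1. ln (real p)) + (\<Sum>p | prime p \<and> k + 1 < p \<and> p \<le> n. ln (real p))"
      unfolding un by (rule sum.union_disjoint) auto
    also have "(\<Sum>p | prime p \<and> p \<le> k + 1. ln (real p)) \<le> real (k + 1) * ln 4"
      using k k1 by (intro less) auto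
    also have "(\<Sum>p | prime p \<and> k + 1 < p \<and> p \<le> n. ln (real p)) \<le> ln (real (n choose k))"
    proof (rule sum_ln_prime_divisors_le)
      fix p assume "p \<in> {p. prime p \<and> k + 1 < p \<and> p \<le> n}"
      then have p: "prime p" "k + 1 < p" "p \<le> n" by auto
      have "fact k * fact (n - k) * (n choose k) = (fact n :: nat)"
        using k by (intro binomial_fact_lemma) auto
      moreover have "p dvd (fact n :: nat)" using p by (simp add: prime_dvd_fact_iff)
      ultimately have "p dvd fact k * fact (n - k) * (n choose k)" by simp
      moreover have "\<not> p dvd (fact k :: nat)" "\<not> p dvd (fact (n - k) :: nat)"
        unfolding prime_dvd_fact_iff[OF p(1)] using p k by auto
      ultimately show "prime p \<and> p dvd n choose k" using p by (simp add: prime_dvd_mult_iff)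
    qed (use k in auto)
    also have "ln (real (n choose k)) \<le> ln (4 ^ k)"
    proof -
      have "real (n choose k) \<le> real (4 ^ k)" unfolding k by (intro of_nat_mono central_binomial_le)
      moreover have "0 < real (n choose k)" using k by simp
      ultimately show ?thesis by simp
    qed
    also have "ln ((4::real) ^ k) = real k * ln 4" by (rule ln_realpow)
    finally show ?thesis by (simp add: k algebra_simps)
  qed
qed

text \<open>Legendre's formula in recursive form: each multiple of \<open>p\<close> up to
  \<open>n\<close> gives one factor \<open>p\<close>, and the cofactors make up
  \<open>fact (n div p)\<close>.\<close>

lemma multiplicity_fact_div:
  fixes p :: nat
  assumes p: "prime p"
  shows "multiplicity p (fact n :: nat) = multiplicity p (fact (n div p) :: nat) + n div p"
proof (induction n)
  case 0
  then show ?case by simp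
next
  case (Suc n)
  have pe: "prime_elem p" using p by simp
  have "multiplicity p (fact (Suc n) :: nat) = multiplicity p (Suc n) + multiplicity p (fact n :: nat)"
    unfolding fact_Suc of_nat_id by (rule prime_elem_multiplicity_mult_distrib[OF pe]) auto
  also have "\<dots> = multiplicity p (fact (Suc n div p) :: nat) + Suc n div p"
  proof (cases "p dvd Suc n")
    case False
    then have "multiplicity p (Suc n) = 0" by (rule not_dvd_imp_multiplicity_0)
    moreover have "Suc n div p = n div p" using False by (simp add: div_Suc dvd_eq_mod_eq_0)
    ultimately show ?thesis using Suc by simp
  next
    case True
    then obtain m where m: "Suc n = p * m" by (auto elim: dvdE)
    have m0: "m > 0" using m by (cases m) auto
    have d1: "Suc n div p = m" using m prime_gt_0_nat[OF p] by simp
    have d2: "Suc (n div p) = m" using True d1 by (simp add: div_Suc dvd_eq_mod_eq_0)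
    have "multiplicity p (Suc n) = 1 + multiplicity p m"
      unfolding m using m0 p by (subst prime_elem_multiplicity_mult_distrib) auto
    moreover have "multiplicity p (fact m :: nat) = multiplicity p m + multiplicity p (fact (n div p) :: nat)"
      unfolding d2[symmetric] fact_Suc of_nat_id by (rule prime_elem_multiplicity_mult_distrib[OF pe]) auto
    ultimately show ?thesis using Suc d1 d2 by simp
  qed
  finally show ?case .
qed

text \<open>The recursion sums the geometric series with value \<open>n / (p - 1)\<close>,
  multiplied out to stay within the natural numbers.\<close>

lemma multiplicity_fact_le:
  fixes p :: nat
  assumes p: "prime p"
  shows "multiplicity p (fact n :: nat) * (p - 1) \<le> n"
proof (induction n rule: less_induct)
  case (less n)
  show ?case
  proof (cases "n = 0")
    case True
    then show ?thesis by simp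
  next
    case False
    define q where "q = n div p"
    have p2: "p \<ge> 2" using p by (rule prime_ge_2_nat)
    have "q < n" using False p2 by (simp add: q_def)
    from less[OF this] have "multiplicity p (fact n :: nat) * (p - 1) \<le> q + q * (p - 1)"
      using multiplicity_fact_div[OF p, of n] by (simp add: q_def algebra_simps)
    also have "\<dots> = q * p" using p2 by (cases p) auto
    also have "\<dots> \<le> n" by (simp add: q_def)
    finally show ?thesis .
  qed
qed

lemma ln_fact_eq:
  "ln (fact n :: real) = (\<Sum>p | prime p \<and> p \<le> n. real (multiplicity p (fact n :: nat)) * ln (real p))"
proof -
  have pf: "prime_factors (fact n :: nat) = {p. prime p \<and> p \<le> n}"
    using prime_dvd_fact_iff by (auto simp: prime_factors_dvd)
  have "real (fact n) = real (\<Prod>p\<in>prime_factors (fact n :: nat). p ^ multiplicity p (fact n :: nat))"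
    by (subst prod_prime_factors) auto
  also have "\<dots> = (\<Prod>p | prime p \<and> p \<le> n. real p ^ multiplicity p (fact n :: nat))"
    by (simp add: pf)
  finally have "ln (fact n :: real) = ln (\<Prod>p | prime p \<and> p \<le> n. real p ^ multiplicity p (fact n :: nat))" by simp
  also have "\<dots> = (\<Sum>p | prime p \<and> p \<le> n. ln (real p ^ multiplicity p (fact n :: nat)))"
    by (rule ln_prod) (auto simp: prime_gt_0_nat)
  also have "\<dots> = (\<Sum>p | prime p \<and> p \<le> n. real (multiplicity p (fact n :: nat)) * ln (real p))"
    by (intro sum.cong refl ln_realpow)
  finally show ?thesis .
qed

lemma ln_fact_ge: "n > 0 \<Longrightarrow> real n * ln (real n) - real n \<le> ln (fact n)"
proof (induction n rule: nat_induct_non_zero)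
  case 1
  then show ?case by simp
next
  case (Suc n)
  have "ln (real (Suc n) / real n) \<le> real (Suc n) / real n - 1"
    using Suc by (intro ln_le_minus_one) auto
  then have "real n * (ln (real (Suc n)) - ln (real n)) \<le> 1"
    using Suc by (simp add: ln_div field_simps)
  moreover have "ln (fact (Suc n) :: real) = ln (real (Suc n)) + ln (fact n)"
    by (simp add: ln_mult)
  ultimately show ?case using Suc by (simp add: algebra_simps)
qed

lemma ln_fact_le: "ln (fact n :: real) \<le> real n * ln (real n)"
proof (cases "n = 0")
  case False
  have "(fact n :: real) \<le> real (n ^ n)" by (rule fact_le_power)
  then have "ln (fact n :: real) \<le> ln (real n ^ n)" using False by (subst ln_le_cancel_iff) auto
  then show ?thesis using False by (simp add: ln_realpow)
qed simp

lemma ln_le_two_sqrt: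
  fixes x :: real
  assumes "x > 0"
  shows "ln x \<le> 2 * sqrt x"
proof -
  have "ln (sqrt x) \<le> sqrt x - 1" using assms by (intro ln_le_minus_one) auto
  then show ?thesis using assms by (simp add: ln_sqrt)
qed

text \<open>This series pays for replacing \<open>1 / (p - 1)\<close> by \<open>1 / p\<close>, both
  in \<open>ln (fact n)\<close> and in Euler products. It is summed over integers, where convergence
  follows from \<open>ln m \<le> 2 * sqrt m\<close>.\<close>

lemma sum_ln_div_pronic_bounded:
  obtains C where "\<And>S :: nat set. finite S \<Longrightarrow> S \<subseteq> {2..} \<Longrightarrow> (\<Sum>m\<in>S. ln (real m) / (real m * (real m - 1))) \<le> C"
proof -
  define f where "f m = 4 * real m powr (-3/2)" for m :: nat
  have sm: "summable f" unfolding f_def by (intro summable_mult) (simp add: summable_real_powr_iff)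
  have "(\<Sum>m\<in>S. ln (real m) / (real m * (real m - 1))) \<le> suminf f" if "finite S" "S \<subseteq> {2..}" for S :: "nat set"
  proof -
    have "(\<Sum>m\<in>S. ln (real m) / (real m * (real m - 1))) \<le> (\<Sum>m\<in>S. f m)"
    proof (rule sum_mono)
      fix m assume "m \<in> S"
      then have m: "m \<ge> 2" using that by auto
      have "ln (real m) / (real m * (real m - 1)) \<le> 2 * sqrt (real m) / (real m * (real m / 2))"
        using m ln_le_two_sqrt[of "real m"] by (intro frac_le mult_left_mono) auto
      also have "\<dots> = 4 * (real m powr (1/2) / real m powr 2)"
        using m by (simp add: powr_half_sqrt field_simps power2_eq_square)
      also have "real m powr (1/2) / real m powr 2 = real m powr (1/2 - 2)" by (rule powr_diff[symmetric])
      also have "4 * \<dots> = f m" by (simp add: f_def)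
      finally show "ln (real m) / (real m * (real m - 1)) \<le> f m" .
    qed
    also have "\<dots> \<le> suminf f" using that by (intro sum_le_suminf sm) (auto simp: f_def)
    finally show ?thesis .
  qed
  then show ?thesis by (rule that)
qed

definition mertens_sum :: "nat set \<Rightarrow> real \<Rightarrow> real" where
  "mertens_sum R x = (\<Sum>p | p \<in> R \<and> real p \<le> x. ln (real p) / real p)"

lemma finite_real_le: "finite {n \<in> R. real n \<le> x}"
  by (rule finite_subset[of _ "{..nat \<lfloor>x\<rfloor>}"]) (auto simp: le_nat_floor)

text \<open>The value \<open>ln (fact n) = n * ln n + O(n)\<close> is compared with its
  factorization, where the multiplicity of \<open>p\<close> lies between \<open>n / p - 1\<close>
  and \<open>n / (p - 1)\<close>. The loss of 1 is paid by \<open>theta_le\<close>, the other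
  deviation by the pronic series. The estimate transfers the hypothesis on \<open>T\<close> to the
  primes outside \<open>T\<close>, over which the sieve runs.\<close>

lemma mertens_first:
  obtains C where "\<And>x. x \<ge> 1 \<Longrightarrow> \<bar>mertens_sum {p. prime p} x - ln x\<bar> \<le> C"
proof -
  obtain C where C: "\<And>S :: nat set. finite S \<Longrightarrow> S \<subseteq> {2..} \<Longrightarrow> (\<Sum>m\<in>S. ln (real m) / (real m * (real m - 1))) \<le> C"
    using sum_ln_div_pronic_bounded by blast
  have "\<bar>mertens_sum {p. prime p} x - ln x\<bar> \<le> C + 3" if x: "x \<ge> 1" for x
  proof -
    define n where "n = nat \<lfloor>x\<rfloor>"
    have n1: "n \<ge> 1" using x by (simp add: n_def le_nat_iff le_floor_iff)
    have nx: "real n \<le> x" "x < real n + 1" using x by (auto simp: n_def)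
    define P where "P = {p. prime p \<and> p \<le> n}"
    have PS: "finite P" "P \<subseteq> {2..}" by (auto simp: P_def prime_ge_2_nat)
    have Pp: "prime p" "p \<ge> 2" "ln (real p) \<ge> 0" if "p \<in> P" for p
      using that prime_ge_2_nat[of p] by (auto simp: P_def)
    define M where "M = (\<Sum>p\<in>P. ln (real p) / real p)"
    have "{p. p \<in> {p. prime p} \<and> real p \<le> x} = P"
      using x by (auto simp: P_def n_def le_nat_iff le_floor_iff)
    then have M: "mertens_sum {p. prime p} x = M" by (simp add: mertens_sum_def M_def)
    have c0: "C \<ge> 0" using C[of "{}"] by simp
    have "real n * M - real n * ln 4 \<le> (\<Sum>p\<in>P. (real n / real p - 1) * ln (real p))"
      using theta_le[of n] by (simp add: M_def P_def algebra_simps sum_subtractf sum_distrib_left)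
    also have "\<dots> \<le> (\<Sum>p\<in>P. real (multiplicity p (fact n :: nat)) * ln (real p))"
    proof (intro sum_mono mult_right_mono)
      fix p assume p: "p \<in> P"
      have "real n / real p - 1 \<le> real (n div p)"
        using Pp(2)[OF p] floor_divide_of_nat_eq[where ?'a = real, of n p] by linarith
      also have "\<dots> \<le> real (multiplicity p (fact n :: nat))"
        using multiplicity_fact_div[OF Pp(1)[OF p], of n] by simp
      finally show "real n / real p - 1 \<le> real (multiplicity p (fact n :: nat))" .
    qed (use Pp in auto)
    also have "\<dots> = ln (fact n)" by (simp add: ln_fact_eq P_def)
    also have "\<dots> \<le> real n * ln (real n)" by (rule ln_fact_le)
    finally have "real n * (M - ln 4) \<le> real n * ln (real n)" by (simp add: algebra_simps)
    then have up: "M \<le> ln (real n) + ln 4" using n1 by simp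
    have "real n * ln (real n) - real n \<le> ln (fact n)" using n1 by (intro ln_fact_ge) auto
    also have "\<dots> = (\<Sum>p\<in>P. real (multiplicity p (fact n :: nat)) * ln (real p))" by (simp add: ln_fact_eq P_def)
    also have "\<dots> \<le> (\<Sum>p\<in>P. (real n / (real p - 1)) * ln (real p))"
    proof (intro sum_mono mult_right_mono)
      fix p assume p: "p \<in> P"
      have "real (multiplicity p (fact n :: nat) * (p - 1)) \<le> real n"
        by (intro of_nat_mono multiplicity_fact_le Pp(1)[OF p])
      then show "real (multiplicity p (fact n :: nat)) \<le> real n / (real p - 1)"
        using Pp(2)[OF p] by (simp add: field_simps of_nat_diff)
    qed (use Pp in auto)
    also have "\<dots> = real n * (\<Sum>p\<in>P. ln (real p) / real p + ln (real p) / (real p * (real p - 1)))"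
      unfolding sum_distrib_left
    proof (intro sum.cong refl)
      fix p assume p: "p \<in> P"
      have "ln (real p) / (real p - 1) = ln (real p) / real p + ln (real p) / (real p * (real p - 1))"
        using Pp(2)[OF p] by (simp add: field_simps)
      then show "real n / (real p - 1) * ln (real p) = real n * (ln (real p) / real p + ln (real p) / (real p * (real p - 1)))"
        by (metis times_divide_eq_left times_divide_eq_right)
    qed
    also have "\<dots> \<le> real n * (M + C)"
      unfolding sum.distrib M_def using C[OF PS] by (intro mult_left_mono add_mono) auto
    finally have "real n * (ln (real n) - 1) \<le> real n * (M + C)" by (simp add: algebra_simps)
    then have lo: "ln (real n) - 1 \<le> M + C" using n1 by simp
    have l4: "ln (4::real) \<le> 3" using ln_le_minus_one[of "4::real"] by simp
    have l1: "ln (real n) \<le> ln x" using nx n1 by simp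
    have "x \<le> real n * 2" using nx n1 by linarith
    then have "ln x \<le> ln (real n * 2)" using n1 x by (subst ln_le_cancel_iff) auto
    also have "\<dots> = ln (real n) + ln 2" using n1 by (subst ln_mult) auto
    also have "ln (2::real) \<le> 1" using ln_le_minus_one[of "2::real"] by simp
    finally have l2: "ln x \<le> ln (real n) + 1" by simp
    show ?thesis unfolding M using up lo l4 l1 l2 c0 by linarith
  qed
  then show ?thesis by (rule that)
qed

subsection \<open>Prime sums and multiplicative sums\<close>

text \<open>A bounded error, valid from \<open>x = 1\<close> on, is stable under complements and
  under the removal of finitely many primes, and it carries no threshold along.\<close>

definition log_density :: "nat set \<Rightarrow> real \<Rightarrow> bool" where
  "log_density R \<rho> \<longleftrightarrow> R \<subseteq> {p. prime p} \<and> (\<exists>C. \<forall>x\<ge>1. \<bar>mertens_sum R x - \<rho> * ln x\<bar> \<le> C)"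

lemma log_densityE:
  assumes "log_density R \<rho>"
  obtains C where "C \<ge> 0" "\<And>x. x \<ge> 1 \<Longrightarrow> \<bar>mertens_sum R x - \<rho> * ln x\<bar> \<le> C"
proof -
  obtain C where C: "\<And>x. x \<ge> 1 \<Longrightarrow> \<bar>mertens_sum R x - \<rho> * ln x\<bar> \<le> C"
    using assms by (auto simp: log_density_def)
  have "C \<ge> 0" using C[of 1] by simp
  then show ?thesis using C by (rule that)
qed

lemma log_density_prime: "log_density R \<rho> \<Longrightarrow> p \<in> R \<Longrightarrow> prime p"
  by (auto simp: log_density_def)

lemma mertens_sum_split:
  assumes "x \<le> y"
  shows "mertens_sum R y = mertens_sum R x + (\<Sum>p | p \<in> R \<and> x < real p \<and> real p \<le> y. ln (real p) / real p)"
proof -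
  have "{p. p \<in> R \<and> real p \<le> y} = {p. p \<in> R \<and> real p \<le> x} \<union> {p. p \<in> R \<and> x < real p \<and> real p \<le> y}"
    using assms by auto
  moreover have "finite {p. p \<in> R \<and> x < real p \<and> real p \<le> y}"
    by (rule finite_subset[OF _ finite_real_le[of R y]]) auto
  ultimately show ?thesis
    unfolding mertens_sum_def by (simp add: sum.union_disjoint[OF finite_real_le] disjoint_iff)
qed

lemma ln_div_nat_nonneg: "0 \<le> ln (real p) / real p"
  by (cases "p = 0") auto

lemma mertens_sum_nonneg: "0 \<le> mertens_sum R x"
  unfolding mertens_sum_def by (intro sum_nonneg ln_div_nat_nonneg)

lemma mertens_sum_mono: "x \<le> y \<Longrightarrow> mertens_sum R x \<le> mertens_sum R y"
  by (subst mertens_sum_split[of x y]) (auto intro!: sum_nonneg ln_div_nat_nonneg)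

lemma mertens_sum_disjoint_union:
  "R \<inter> R' = {} \<Longrightarrow> mertens_sum (R \<union> R') x = mertens_sum R x + mertens_sum R' x"
proof -
  assume d: "R \<inter> R' = {}"
  have "{p. p \<in> R \<union> R' \<and> real p \<le> x} = {p \<in> R. real p \<le> x} \<union> {p \<in> R'. real p \<le> x}" by auto
  then show ?thesis unfolding mertens_sum_def using d
    by (simp add: sum.union_disjoint[OF finite_real_le finite_real_le] disjoint_iff)
qed

lemma log_density_asymp:
  assumes R: "R \<subseteq> {p. prime p}" and r: "\<rho> \<ge> 0"
    and o: "(\<lambda>x::real. mertens_sum R x - (\<rho> * ln x + C)) \<in> o[at_top](\<lambda>_. 1)"
  shows "log_density R \<rho>"
proof -
  have "\<forall>\<^sub>F x in at_top. \<bar>mertens_sum R x - (\<rho> * ln x + C)\<bar> \<le> 1"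
    using landau_o.smallD[OF o, of 1] by simp
  then obtain X0 where X0: "\<And>x. x \<ge> X0 \<Longrightarrow> \<bar>mertens_sum R x - (\<rho> * ln x + C)\<bar> \<le> 1"
    by (auto simp: eventually_at_top_linorder)
  define X where "X = max X0 1"
  have "\<bar>mertens_sum R x - \<rho> * ln x\<bar> \<le> 1 + \<bar>C\<bar> + mertens_sum R X + \<rho> * ln X" if x: "x \<ge> 1" for x
  proof (cases "x \<ge> X0")
    case True
    have "0 \<le> \<rho> * ln X" using r by (simp add: X_def)
    then show ?thesis using X0[OF True] mertens_sum_nonneg[of R X] by linarith
  next
    case False
    then have "x \<le> X" by (simp add: X_def)
    then have "mertens_sum R x \<le> mertens_sum R X" "\<rho> * ln x \<le> \<rho> * ln X" "0 \<le> \<rho> * ln x"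
      using x r by (auto intro!: mertens_sum_mono mult_left_mono)
    then show ?thesis using mertens_sum_nonneg[of R x] by linarith
  qed
  then show ?thesis using R by (auto simp: log_density_def)
qed

lemma log_density_complement:
  assumes "log_density R \<rho>"
  shows "log_density {p. prime p \<and> p \<notin> R} (1 - \<rho>)"
proof -
  obtain C where C: "\<And>x. x \<ge> 1 \<Longrightarrow> \<bar>mertens_sum R x - \<rho> * ln x\<bar> \<le> C" using log_densityE[OF assms] by blast
  obtain C1 where C1: "\<And>x. x \<ge> 1 \<Longrightarrow> \<bar>mertens_sum {p. prime p} x - ln x\<bar> \<le> C1" using mertens_first by blast
  have "\<bar>mertens_sum {p. prime p \<and> p \<notin> R} x - (1 - \<rho>) * ln x\<bar> \<le> C + C1" if "x \<ge> 1" for x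
  proof -
    have "R \<union> {p. prime p \<and> p \<notin> R} = {p. prime p}" using log_density_prime[OF assms] by auto
    then have "mertens_sum {p. prime p} x = mertens_sum R x + mertens_sum {p. prime p \<and> p \<notin> R} x"
      using mertens_sum_disjoint_union[of R "{p. prime p \<and> p \<notin> R}" x] by (simp add: disjoint_iff)
    then show ?thesis using C[OF that] C1[OF that] by (simp add: algebra_simps)
  qed
  then show ?thesis by (auto simp: log_density_def)
qed

lemma log_density_tail:
  assumes "log_density R \<rho>"
  shows "log_density {p \<in> R. p0 < p} \<rho>"
proof -
  obtain C where C: "\<And>x. x \<ge> 1 \<Longrightarrow> \<bar>mertens_sum R x - \<rho> * ln x\<bar> \<le> C" using log_densityE[OF assms] by blast
  have "\<bar>mertens_sum {p \<in> R. p0 < p} x - \<rho> * ln x\<bar> \<le> C + mertens_sum R (real p0)" if "x \<ge> 1" for x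
  proof -
    have "{p \<in> R. p0 < p} \<union> {p \<in> R. p \<le> p0} = R" by auto
    then have "mertens_sum R x = mertens_sum {p \<in> R. p0 < p} x + mertens_sum {p \<in> R. p \<le> p0} x"
      using mertens_sum_disjoint_union[of "{p \<in> R. p0 < p}" "{p \<in> R. p \<le> p0}" x] by (simp add: disjoint_iff)
    moreover have "mertens_sum {p \<in> R. p \<le> p0} x \<le> mertens_sum R (real p0)"
      unfolding mertens_sum_def using finite_real_le[of R "real p0"] by (intro sum_mono2) (auto intro: ln_div_nat_nonneg)
    ultimately show ?thesis using C[OF that] mertens_sum_nonneg[of "{p \<in> R. p \<le> p0}" x] by linarith
  qed
  moreover have "{p \<in> R. p0 < p} \<subseteq> {p. prime p}" using log_density_prime[OF assms] by auto
  ultimately show ?thesis by (auto simp: log_density_def)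
qed

text \<open>The mass in \<open>(z / M, z]\<close> is \<open>\<rho> * ln M\<close> up to twice the
  error bound, so a fixed ratio \<open>M\<close> reaches any prescribed \<open>c\<close>. This
  supplies primes of the set on every scale.\<close>

lemma log_density_window:
  assumes d: "log_density R \<rho>" and r: "\<rho> > 0"
  obtains M C where "M > 1" "C \<ge> 0"
    "\<And>z. z \<ge> M \<Longrightarrow> c \<le> (\<Sum>p | p \<in> R \<and> z / M < real p \<and> real p \<le> z. ln (real p) / real p)"
    "\<And>z. z \<ge> M \<Longrightarrow> (\<Sum>p | p \<in> R \<and> z / M < real p \<and> real p \<le> z. ln (real p) / real p) \<le> C"
proof -
  obtain C where C: "C \<ge> 0" "\<And>x. x \<ge> 1 \<Longrightarrow> \<bar>mertens_sum R x - \<rho> * ln x\<bar> \<le> C" using log_densityE[OF d] by blast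
  define M where "M = exp ((\<bar>c\<bar> + 2 * C + 1) / \<rho>)"
  have M1: "M > 1" using C r by (auto simp: M_def intro!: divide_pos_pos)
  have lM: "\<rho> * ln M = \<bar>c\<bar> + 2 * C + 1" using r by (simp add: M_def)
  have eq: "\<bar>(\<Sum>p | p \<in> R \<and> z / M < real p \<and> real p \<le> z. ln (real p) / real p) - \<rho> * ln M\<bar> \<le> 2 * C" if z: "z \<ge> M" for z
  proof -
    have z1: "z / M \<ge> 1" "z \<ge> 1" using z M1 by (auto simp: field_simps)
    have "z / M \<le> z" using z1 M1 by (simp add: field_simps)
    from mertens_sum_split[OF this, of R]
    have "(\<Sum>p | p \<in> R \<and> z / M < real p \<and> real p \<le> z. ln (real p) / real p) = mertens_sum R z - mertens_sum R (z / M)" by simp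
    moreover have "\<rho> * ln (z / M) = \<rho> * ln z - \<rho> * ln M" using z1 M1 by (simp add: ln_div right_diff_distrib)
    ultimately show ?thesis using C(2)[OF z1(1)] C(2)[OF z1(2)] by linarith
  qed
  show ?thesis
  proof (rule that[of M "\<bar>c\<bar> + 4 * C + 1"])
    show "M > 1" by fact
    show "0 \<le> \<bar>c\<bar> + 4 * C + 1" using C by simp
    fix z assume "z \<ge> M"
    from eq[OF this] lM
    show "c \<le> (\<Sum>p | p \<in> R \<and> z / M < real p \<and> real p \<le> z. ln (real p) / real p)"
      "(\<Sum>p | p \<in> R \<and> z / M < real p \<and> real p \<le> z. ln (real p) / real p) \<le> \<bar>c\<bar> + 4 * C + 1"
      by linarith+
  qed
qed

text \<open>Partial summation, phrased as monotonicity of \<open>H\<close>.\<close>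

lemma log_density_sum_inverse:
  assumes d: "log_density R \<rho>" and r: "\<rho> \<ge> 0"
  obtains C where "\<And>n::nat. n \<ge> 2 \<Longrightarrow> (\<Sum>p | p \<in> R \<and> p \<le> n. 1 / real p) \<le> \<rho> * ln (ln (real n)) + C"
proof -
  obtain C where C: "C \<ge> 0" "\<And>x. x \<ge> 1 \<Longrightarrow> \<bar>mertens_sum R x - \<rho> * ln x\<bar> \<le> C" using log_densityE[OF d] by blast
  define G where "G n = (\<Sum>p | p \<in> R \<and> p \<le> n. 1 / real p)" for n :: nat
  define F where "F n = mertens_sum R (real n)" for n :: nat
  \<comment> \<open>Abel summation: \<open>G - F / ln\<close> grows by
    \<open>F n * (1 / ln n - 1 / ln (n + 1))\<close> in one step. Once
    \<open>F n \<le> \<rho> * ln n + C\<close> is inserted, the last two terms of \<open>H\<close>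
    compensate the two parts of that bound.\<close>
  define H where "H n = G n - F n / ln (real n) - \<rho> * ln (ln (real n)) + C / ln (real n)" for n :: nat
  have Fup: "F n \<le> \<rho> * ln (real n) + C" if "n \<ge> 1" for n
    using C(2)[of "real n"] that by (simp add: F_def abs_le_iff)
  have set_Suc: "{p. p \<in> R \<and> p \<le> Suc n} = (if Suc n \<in> R then insert (Suc n) {p. p \<in> R \<and> p \<le> n} else {p. p \<in> R \<and> p \<le> n})" for n
    by (auto simp: le_Suc_eq)
  have F_eq: "F n = (\<Sum>p | p \<in> R \<and> p \<le> n. ln (real p) / real p)" for n
    by (simp add: F_def mertens_sum_def)
  have step: "H (Suc n) \<le> H n" if n: "n \<ge> 2" for n
  proof -
    define a where "a = ln (real n)"
    define b where "b = ln (real (Suc n))"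
    have ab: "0 < a" "a < b" "0 < b" using n by (auto simp: a_def b_def)
    have GF: "G (Suc n) - G n = (F (Suc n) - F n) / b"
      using ab by (simp add: G_def F_eq set_Suc b_def)
    have "H (Suc n) - H n = F n * (1 / a - 1 / b) - \<rho> * (ln b - ln a) - C * (1 / a - 1 / b)"
      using GF ab by (simp add: H_def a_def[symmetric] b_def[symmetric] diff_divide_distrib algebra_simps del: of_nat_Suc)
    also have "\<dots> \<le> (\<rho> * a + C) * (1 / a - 1 / b) - \<rho> * (ln b - ln a) - C * (1 / a - 1 / b)"
      using Fup[of n] n ab by (intro diff_right_mono mult_right_mono) (auto simp: a_def field_simps)
    also have "\<dots> = \<rho> * ((1 - a / b) - (ln b - ln a))"
      using ab by (simp add: field_simps)
    also have "\<dots> \<le> 0"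
    proof -
      have "ln (a / b) \<le> a / b - 1" using ab by (intro ln_le_minus_one) auto
      then have "(1 - a / b) - (ln b - ln a) \<le> 0" using ab by (simp add: ln_div)
      then show ?thesis using r by (intro mult_nonneg_nonpos)
    qed
    finally show ?thesis by simp
  qed
  have H2: "H n \<le> H 2" if "n \<ge> 2" for n
    using that by (induction n rule: dec_induct) (auto intro: order_trans[OF step])
  have "G n \<le> \<rho> * ln (ln (real n)) + (H 2 + \<rho>)" if n: "n \<ge> 2" for n
  proof -
    have l: "ln (real n) > 0" using n by simp
    have "F n / ln (real n) \<le> (\<rho> * ln (real n) + C) / ln (real n)"
      using Fup[of n] n l by (intro divide_right_mono) auto
    also have "\<dots> = \<rho> + C / ln (real n)" using l by (simp add: field_simps)
    finally show ?thesis using H2[OF n] by (simp add: H_def)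
  qed
  then show ?thesis unfolding G_def by (rule that)
qed

text \<open>An integer is determined by its exponents, and with the set of prime factors fixed every
  exponent is at least 1. The geometric series therefore start at \<open>j = 1\<close>, giving
  \<open>w / (1 - w)\<close>, the shape of the sieve weights as well as of Euler factors minus
  1.\<close>

lemma sum_fixed_prime_factors_le:
  fixes w :: "nat \<Rightarrow> real"
  assumes I: "finite I" "\<And>p. p \<in> I \<Longrightarrow> prime p \<and> 0 \<le> w p \<and> w p < 1"
    and S: "finite S" "\<And>n. n \<in> S \<Longrightarrow> n > 0 \<and> prime_factors n = I"
  shows "(\<Sum>n\<in>S. \<Prod>p\<in>I. w p ^ multiplicity p n) \<le> (\<Prod>p\<in>I. w p / (1 - w p))"
proof -
  \<comment> \<open>A crude common bound for all exponents, so that the exponent vectors lie in a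
    finite box.\<close>
  define K where "K = \<Sum>S"
  define e where "e n = (\<lambda>p\<in>I. multiplicity p n)" for n
  have mult_le: "multiplicity p n \<le> n" if "n > 0" "prime p" for p n :: nat
  proof -
    have "multiplicity p n < p ^ multiplicity p n" using that prime_gt_1_nat[of p] by (intro power_gt_expt) auto
    also have "\<dots> \<le> n" using that by (intro dvd_imp_le multiplicity_dvd) auto
    finally show ?thesis by simp
  qed
  have eS: "e n \<in> Pi\<^sub>E I (\<lambda>_. {1..K})" if n: "n \<in> S" for n
  proof -
    have "n \<le> K" unfolding K_def using S n by (intro member_le_sum[of n S "\<lambda>x. x"]) auto
    then show ?thesis using S(2)[OF n] I(2) mult_le[of n]
      by (auto simp: e_def PiE_iff prime_factors_multiplicity Suc_le_eq intro: order_trans)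
  qed
  have inj: "inj_on e S"
  proof (rule inj_onI)
    fix n m assume nm: "n \<in> S" "m \<in> S" "e n = e m"
    have "multiplicity p n = multiplicity p m" if "p \<in> I" for p
      using fun_cong[OF nm(3), of p] that by (simp add: e_def)
    then have "(\<Prod>p\<in>prime_factors n. p ^ multiplicity p n) = (\<Prod>p\<in>prime_factors m. p ^ multiplicity p m)"
      using S(2)[OF nm(1)] S(2)[OF nm(2)] by (intro prod.cong) auto
    moreover have "(\<Prod>p\<in>prime_factors k. p ^ multiplicity p k) = k" if "k \<in> S" for k
      by (subst prod_prime_factors) (use S(2)[OF that] in auto)
    ultimately show "n = m" using nm by metis
  qed
  have "(\<Sum>n\<in>S. \<Prod>p\<in>I. w p ^ multiplicity p n) = (\<Sum>n\<in>S. \<Prod>p\<in>I. w p ^ e n p)"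
    by (intro sum.cong prod.cong refl) (simp add: e_def)
  also have "\<dots> = (\<Sum>f\<in>e ` S. \<Prod>p\<in>I. w p ^ f p)"
    by (simp add: sum.reindex[OF inj])
  also have "\<dots> \<le> (\<Sum>f\<in>Pi\<^sub>E I (\<lambda>_. {1..K}). \<Prod>p\<in>I. w p ^ f p)"
    using eS I by (intro sum_mono2 finite_PiE prod_nonneg) auto
  also have "\<dots> = (\<Prod>p\<in>I. \<Sum>j\<in>{1..K}. w p ^ j)"
    using I by (intro prod_sum_PiE[symmetric]) auto
  also have "\<dots> \<le> (\<Prod>p\<in>I. w p / (1 - w p))"
  proof (intro prod_mono conjI)
    fix p assume p: "p \<in> I"
    show "0 \<le> (\<Sum>j\<in>{1..K}. w p ^ j)" using I(2)[OF p] by (intro sum_nonneg) auto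
    have "(1 - w p) * (\<Sum>j\<in>{1..K}. w p ^ j) = w p - w p ^ Suc K"
    proof (induction K)
      case (Suc K)
      have "(1 - w p) * (\<Sum>j\<in>{1..Suc K}. w p ^ j) = (1 - w p) * (\<Sum>j\<in>{1..K}. w p ^ j) + (1 - w p) * w p ^ Suc K"
        by (simp add: distrib_left)
      also have "\<dots> = w p - w p ^ Suc (Suc K)" unfolding Suc.IH by (simp add: algebra_simps)
      finally show ?case .
    qed simp
    also have "\<dots> \<le> w p" using I(2)[OF p] by simp
    finally show "(\<Sum>j\<in>{1..K}. w p ^ j) \<le> w p / (1 - w p)"
      using I(2)[OF p] by (simp add: field_simps)
  qed
  finally show ?thesis .
qed

text \<open>After grouping by the set of prime factors, the sum over subsets of \<open>D\<close>
  expands the product of \<open>1 + w p / (1 - w p)\<close>.\<close>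

lemma sum_le_euler_product:
  fixes w :: "nat \<Rightarrow> real"
  assumes D: "finite D" "\<And>p. p \<in> D \<Longrightarrow> prime p \<and> 0 \<le> w p \<and> w p < 1"
    and S: "finite S" "\<And>n. n \<in> S \<Longrightarrow> n > 0 \<and> prime_factors n \<subseteq> D"
  shows "(\<Sum>n\<in>S. \<Prod>p\<in>prime_factors n. w p ^ multiplicity p n) \<le> (\<Prod>p\<in>D. 1 / (1 - w p))"
proof -
  have "(\<Sum>n\<in>S. \<Prod>p\<in>prime_factors n. w p ^ multiplicity p n)
     = (\<Sum>I\<in>Pow D. \<Sum>n\<in>{n\<in>S. prime_factors n = I}. \<Prod>p\<in>prime_factors n. w p ^ multiplicity p n)"
    using D S by (intro sum.group[symmetric]) auto
  also have "\<dots> = (\<Sum>I\<in>Pow D. \<Sum>n\<in>{n\<in>S. prime_factors n = I}. \<Prod>p\<in>I. w p ^ multiplicity p n)"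
    by (intro sum.cong refl) auto
  also have "\<dots> \<le> (\<Sum>I\<in>Pow D. \<Prod>p\<in>I. w p / (1 - w p))"
    using D S by (intro sum_mono sum_fixed_prime_factors_le) (auto intro: finite_subset)
  also have "\<dots> = (\<Prod>p\<in>D. w p / (1 - w p) + 1)"
    by (subst prod_add) (use D in auto)
  also have "\<dots> = (\<Prod>p\<in>D. 1 / (1 - w p))"
  proof (intro prod.cong refl)
    fix p assume "p \<in> D"
    then have "w p < 1" using D by auto
    then show "w p / (1 - w p) + 1 = 1 / (1 - w p)" by (simp add: field_simps)
  qed
  finally show ?thesis .
qed

section \<open>Reciprocal sums over \<open>Q_set\<close>\<close>

definition inv_sum :: "nat set \<Rightarrow> real \<Rightarrow> real" where
  "inv_sum R x = (\<Sum>n | n \<in> Q_set R \<and> real n \<le> x. 1 / real n)"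

lemma Q_set_prime_factors: "n \<in> Q_set R \<longleftrightarrow> n > 0 \<and> prime_factors n \<subseteq> R"
  by (auto simp: Q_set_def prime_factors_dvd)

lemma prod_inverse_prime_factors:
  "n > 0 \<Longrightarrow> (\<Prod>p\<in>prime_factors n. (1 / real p) ^ multiplicity p n) = 1 / real n"
proof -
  assume n: "n > 0"
  have "real n = real (\<Prod>p\<in>prime_factors n. p ^ multiplicity p n)"
    using n by (subst prod_prime_factors) auto
  then show ?thesis by (simp add: power_divide prod_dividef)
qed

lemma inv_sum_le:
  assumes d: "log_density R \<rho>" and r: "\<rho> \<ge> 0"
  obtains C where "C > 0" "\<And>x. x \<ge> 2 \<Longrightarrow> inv_sum R x \<le> C * ln x powr \<rho>"
proof -
  obtain C1 where C1: "\<And>n::nat. n \<ge> 2 \<Longrightarrow> (\<Sum>p | p \<in> R \<and> p \<le> n. 1 / real p) \<le> \<rho> * ln (ln (real n)) + C1"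
    using log_density_sum_inverse[OF d r] by blast
  obtain C2 where C2: "\<And>S :: nat set. finite S \<Longrightarrow> S \<subseteq> {2..} \<Longrightarrow> (\<Sum>m\<in>S. ln (real m) / (real m * (real m - 1))) \<le> C2"
    using sum_ln_div_pronic_bounded by blast
  have "inv_sum R x \<le> exp (C1 + 2 * C2) * ln x powr \<rho>" if x: "x \<ge> 2" for x
  proof -
    define n where "n = nat \<lfloor>x\<rfloor>"
    have n2: "n \<ge> 2" "real n \<le> x" using x by (auto simp: n_def le_nat_iff le_floor_iff)
    define D where "D = {p. p \<in> R \<and> p \<le> n}"
    have D: "finite D" "D \<subseteq> {2..}" "\<And>p. p \<in> D \<Longrightarrow> prime p \<and> p \<ge> 2"
      using log_density_prime[OF d] prime_ge_2_nat by (auto simp: D_def)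
    have "inv_sum R x = (\<Sum>m | m \<in> Q_set R \<and> real m \<le> x. \<Prod>p\<in>prime_factors m. (1 / real p) ^ multiplicity p m)"
      unfolding inv_sum_def by (intro sum.cong refl prod_inverse_prime_factors[symmetric]) (auto simp: Q_set_def)
    also have "\<dots> \<le> (\<Prod>p\<in>D. 1 / (1 - 1 / real p))"
    proof (rule sum_le_euler_product)
      show "finite D" by fact
      show "prime p \<and> 0 \<le> 1 / real p \<and> 1 / real p < 1" if "p \<in> D" for p using D(3)[OF that] by simp
      show "finite {m. m \<in> Q_set R \<and> real m \<le> x}" using finite_real_le[of "Q_set R" x] by simp
      fix m assume m: "m \<in> {m. m \<in> Q_set R \<and> real m \<le> x}"
      then have "m \<le> n" by (auto simp: n_def le_nat_floor)
      moreover have "p \<le> m" if "p \<in> prime_factors m" for p using that m by (auto simp: Q_set_def prime_factors_dvd dvd_imp_le)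
      ultimately show "m > 0 \<and> prime_factors m \<subseteq> D" using m by (fastforce simp: Q_set_prime_factors D_def)
    qed
    also have "\<dots> \<le> (\<Prod>p\<in>D. exp (1 / real p + 2 * (ln (real p) / (real p * (real p - 1)))))"
    proof (intro prod_mono conjI)
      fix p assume "p \<in> D"
      then have p: "p \<ge> 2" using D by auto
      show "0 \<le> 1 / (1 - 1 / real p)" using p by simp
      \<comment> \<open>From \<open>2 * ln p \<ge> 1\<close>, the term
        \<open>1 / (p * (p - 1))\<close> is dominated by twice a term of the bounded series.\<close>
      have l: "1/2 \<le> ln (real p)"
      proof -
        have "1/2 \<le> ln (2::real)" using ln2_ge_two_thirds by simp
        also have "\<dots> \<le> ln (real p)" using p by simp
        finally show ?thesis .
      qed
      have "1 / (1 - 1 / real p) = 1 + 1 / (real p - 1)" using p by (simp add: field_simps)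
      also have "\<dots> \<le> exp (1 / (real p - 1))" by (rule exp_ge_add_one_self)
      also have "1 / (real p - 1) = 1 / real p + 1 / (real p * (real p - 1))" using p by (simp add: field_simps)
      also have "exp \<dots> \<le> exp (1 / real p + 2 * (ln (real p) / (real p * (real p - 1))))"
        using p l by (simp add: divide_right_mono)
      finally show "1 / (1 - 1 / real p) \<le> exp (1 / real p + 2 * (ln (real p) / (real p * (real p - 1))))" .
    qed
    also have "\<dots> = exp ((\<Sum>p\<in>D. 1 / real p) + 2 * (\<Sum>p\<in>D. ln (real p) / (real p * (real p - 1))))"
      using D(1) by (simp add: exp_sum[symmetric] sum.distrib sum_distrib_left)
    also have "\<dots> \<le> exp ((\<rho> * ln (ln (real n)) + C1) + 2 * C2)"
      using C1[OF n2(1)] C2[OF D(1,2)] by (simp add: D_def)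
    also have "\<dots> \<le> exp ((\<rho> * ln (ln x) + C1) + 2 * C2)"
    proof -
      have "0 < ln (real n)" "ln (real n) \<le> ln x" using n2 by auto
      then have "ln (ln (real n)) \<le> ln (ln x)" by simp
      then show ?thesis using r by (simp add: mult_left_mono)
    qed
    also have "\<dots> = exp (C1 + 2 * C2) * ln x powr \<rho>"
      using x by (simp add: powr_def exp_add[symmetric] algebra_simps)
    finally show ?thesis .
  qed
  then show ?thesis by (intro that[of "exp (C1 + 2 * C2)"]) auto
qed

lemma Q_set_mult_prime: "prime p \<Longrightarrow> p \<in> R \<Longrightarrow> n \<in> Q_set R \<Longrightarrow> p * n \<in> Q_set R"
  by (auto simp: Q_set_def prime_gt_0_nat prime_dvd_mult_iff dest: primes_dvd_imp_eq)

lemma Q_set_factorization: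
  assumes "\<And>p. prime p \<Longrightarrow> p \<in> R \<or> p \<in> R'" and "n > 0"
  shows "\<exists>a\<in>Q_set R. \<exists>b\<in>Q_set R'. n = a * b"
  using assms(2)
proof (induction n rule: prime_divisors_induct)
  case (unit n)
  then show ?case by (auto simp: Q_set_def)
next
  case (factor p n)
  then obtain a b where ab: "a \<in> Q_set R" "b \<in> Q_set R'" "n = a * b" by auto
  from assms(1)[of p] factor have "p \<in> R \<or> p \<in> R'" by simp
  then show ?case
  proof
    assume "p \<in> R"
    then have "p * a \<in> Q_set R" using factor ab by (intro Q_set_mult_prime)
    then show ?thesis using ab by (intro bexI[of _ "p * a"] bexI[of _ b]) auto
  next
    assume "p \<in> R'"
    then have "p * b \<in> Q_set R'" using factor ab by (intro Q_set_mult_prime)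
    then show ?thesis using ab by (intro bexI[of _ a] bexI[of _ "p * b"]) auto
  qed
qed simp

text \<open>Every \<open>k \<le> x\<close> is a product of an element of each set, both at most
  \<open>x\<close>, so the product of the two sums dominates a harmonic sum.\<close>

lemma ln_le_inv_sum_mult:
  assumes "\<And>p. prime p \<Longrightarrow> p \<in> R \<or> p \<in> R'" and x: "x \<ge> 1"
  shows "ln x \<le> inv_sum R x * inv_sum R' x"
proof -
  define n where "n = nat \<lfloor>x\<rfloor>"
  have n: "x < real n + 1" using x by (simp add: n_def)
  define A where "A = {m. m \<in> Q_set R \<and> real m \<le> x}"
  define B where "B = {m. m \<in> Q_set R' \<and> real m \<le> x}"
  have fin: "finite A" "finite B"
    using finite_real_le[of "Q_set R" x] finite_real_le[of "Q_set R'" x] by (auto simp: A_def B_def)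
  have "ln x \<le> ln (real n + 1)" using n x by simp
  also have "\<dots> \<le> harm n" by (rule ln_le_harm)
  also have "\<dots> = (\<Sum>k\<in>{1..n}. 1 / real k)" by (simp add: harm_def divide_inverse)
  also have "\<dots> \<le> (\<Sum>k\<in>(\<lambda>(a, b). a * b) ` (A \<times> B). 1 / real k)"
  proof (rule sum_mono2)
    show "{1..n} \<subseteq> (\<lambda>(a, b). a * b) ` (A \<times> B)"
    proof
      fix k assume k: "k \<in> {1..n}"
      then obtain a b where ab: "a \<in> Q_set R" "b \<in> Q_set R'" "k = a * b"
        using Q_set_factorization[OF assms(1), of k] by auto
      have kx: "real k \<le> x" using k x by (auto simp: n_def le_nat_iff le_floor_iff)
      have "a \<le> k" "b \<le> k" using ab k by (auto intro!: dvd_imp_le)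
      then have "real a \<le> x" "real b \<le> x" using kx by linarith+
      then show "k \<in> (\<lambda>(a, b). a * b) ` (A \<times> B)" using ab by (auto simp: A_def B_def)
    qed
  qed (use fin in auto)
  also have "\<dots> \<le> (\<Sum>ab\<in>A \<times> B. 1 / real (fst ab * snd ab))"
    using fin sum_image_le[of "A \<times> B" "\<lambda>k. 1 / real k" "\<lambda>(a, b). a * b"] by (simp add: case_prod_unfold comp_def)
  also have "\<dots> = inv_sum R x * inv_sum R' x"
    unfolding inv_sum_def A_def[symmetric] B_def[symmetric] by (simp add: sum_product sum.cartesian_product case_prod_unfold)
  finally show ?thesis .
qed

text \<open>The lower bound comes from the upper bound for the complementary primes, with exponent
  \<open>1 - \<rho>\<close>. The Euler product over primes up to \<open>x\<close> bounds the
  truncated sum only from above.\<close>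

lemma inv_sum_ge:
  assumes d: "log_density R \<rho>" and r: "\<rho> \<le> 1"
  obtains c where "c > 0" "\<And>x. x \<ge> 2 \<Longrightarrow> c * ln x powr \<rho> \<le> inv_sum R x"
proof -
  define R' where "R' = {p. prime p \<and> p \<notin> R}"
  have "log_density R' (1 - \<rho>)" unfolding R'_def by (rule log_density_complement[OF d])
  then obtain C where C: "C > 0" "\<And>x. x \<ge> 2 \<Longrightarrow> inv_sum R' x \<le> C * ln x powr (1 - \<rho>)"
    using inv_sum_le[of R' "1 - \<rho>"] r by auto
  have "(1 / C) * ln x powr \<rho> \<le> inv_sum R x" if x: "x \<ge> 2" for x
  proof -
    have l: "ln x > 0" using x by simp
    have "ln x powr \<rho> * ln x powr (1 - \<rho>) = ln x" using l by (simp flip: powr_add)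
    also have "ln x \<le> inv_sum R x * inv_sum R' x"
      using x by (intro ln_le_inv_sum_mult) (auto simp: R'_def)
    also have "\<dots> \<le> inv_sum R x * (C * ln x powr (1 - \<rho>))"
      using C(2)[OF x] by (intro mult_left_mono) (auto simp: inv_sum_def intro: sum_nonneg)
    finally have "ln x powr \<rho> * ln x powr (1 - \<rho>) \<le> (inv_sum R x * C) * ln x powr (1 - \<rho>)" by (simp add: mult_ac)
    then have "ln x powr \<rho> \<le> inv_sum R x * C" using l by (simp add: mult_le_cancel_right)
    then show ?thesis using C(1) by (simp add: field_simps)
  qed
  then show ?thesis using C(1) by (intro that[of "1 / C"]) auto
qed

text \<open>Pairs \<open>(m, p)\<close> with \<open>m * p \<le> x\<close> are weighted by
  \<open>ln p\<close>. An integer \<open>n \<le> x\<close> receives at most \<open>ln n\<close>,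
  since its distinct prime factors multiply to a divisor of \<open>n\<close>, while each
  \<open>m \<le> x / M\<close> contributes at least \<open>x / (m * M)\<close>, which brings in the
  reciprocal sum. Dividing by \<open>ln x\<close> lowers the exponent from \<tau> to
  \<open>\<tau> - 1\<close>.\<close>

lemma card_Q_set_ge:
  assumes d: "log_density T \<tau>" and t: "0 < \<tau>" "\<tau> \<le> 1"
  obtains c X where "c > 0" "X \<ge> 2" "\<And>x. x \<ge> X \<Longrightarrow> c * x * ln x powr (\<tau> - 1) \<le> real (card {n \<in> Q_set T. real n \<le> x})"
proof -
  obtain M C where M: "M > 1"
    "\<And>z. z \<ge> M \<Longrightarrow> 1 \<le> (\<Sum>p | p \<in> T \<and> z / M < real p \<and> real p \<le> z. ln (real p) / real p)"
    by (rule log_density_window[OF d t(1), of 1]) blast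
  obtain c where c: "c > 0" "\<And>x. x \<ge> 2 \<Longrightarrow> c * ln x powr \<tau> \<le> inv_sum T x"
    using inv_sum_ge[OF d t(2)] by blast
  have finT: "finite {p. p \<in> T \<and> real p \<le> y}" for y using finite_real_le[of T y] by simp
  have pos: "0 < real p" "0 \<le> ln (real p)" if "p \<in> T" for p
    using prime_ge_1_nat[OF log_density_prime[OF d that]] by auto
  \<comment> \<open>Chebyshev's lower bound for \<open>T\<close>: above \<open>y / M\<close> the
    weight \<open>ln p\<close> is at least \<open>y / M\<close> times \<open>ln p / p\<close>, and
    the window has mass at least 1.\<close>
  have theta: "y / M \<le> (\<Sum>p | p \<in> T \<and> real p \<le> y. ln (real p))" if y: "y \<ge> M" for y
  proof -
    have "y / M \<le> y / M * (\<Sum>p | p \<in> T \<and> y / M < real p \<and> real p \<le> y. ln (real p) / real p)"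
      using mult_left_mono[OF M(2)[OF y], of "y / M"] y M(1) by simp
    also have "\<dots> \<le> (\<Sum>p | p \<in> T \<and> y / M < real p \<and> real p \<le> y. ln (real p))"
      unfolding sum_distrib_left
    proof (rule sum_mono)
      fix p assume "p \<in> {p. p \<in> T \<and> y / M < real p \<and> real p \<le> y}"
      then have p: "p \<in> T" "y / M < real p" by auto
      have "y / M * (ln (real p) / real p) \<le> real p * (ln (real p) / real p)"
        using p pos[OF p(1)] by (intro mult_right_mono) auto
      then show "y / M * (ln (real p) / real p) \<le> ln (real p)" using pos[OF p(1)] by simp
    qed
    also have "\<dots> \<le> (\<Sum>p | p \<in> T \<and> real p \<le> y. ln (real p))"
      using finT[of y] pos by (intro sum_mono2) auto
    finally show ?thesis .
  qed
  define c' where "c' = c * (1/2) powr \<tau> / M"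
  have "c' * x * ln x powr (\<tau> - 1) \<le> real (card {n \<in> Q_set T. real n \<le> x})" if x: "x \<ge> max 2 (max (2 * M) (M\<^sup>2))" for x
  proof -
    define S where "S = {n \<in> Q_set T. real n \<le> x}"
    have finS: "finite S" unfolding S_def by (rule finite_real_le)
    have x2: "x \<ge> 2" "x / M \<ge> 2" "x \<ge> M\<^sup>2" using x M(1) by (auto simp: field_simps)
    have lx: "ln x > 0" using x2 by simp
    define W where "W = {(m, p). m \<in> Q_set T \<and> real m \<le> x / M \<and> p \<in> T \<and> real p \<le> x / real m}"
    have WS: "W = Sigma {m. m \<in> Q_set T \<and> real m \<le> x / M} (\<lambda>m. {p. p \<in> T \<and> real p \<le> x / real m})"
      by (auto simp: W_def)
    have inj: "inj_on (\<lambda>(m, p). (m * p, p)) W"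
      using pos by (auto simp: inj_on_def W_def)
    have "(x / M) * inv_sum T (x / M) = (\<Sum>m | m \<in> Q_set T \<and> real m \<le> x / M. (x / real m) / M)"
      unfolding inv_sum_def sum_distrib_left by (simp add: mult_ac)
    also have "\<dots> \<le> (\<Sum>m | m \<in> Q_set T \<and> real m \<le> x / M. \<Sum>p | p \<in> T \<and> real p \<le> x / real m. ln (real p))"
    proof (intro sum_mono theta)
      fix m assume "m \<in> {m. m \<in> Q_set T \<and> real m \<le> x / M}"
      then have "real m \<le> x / M" "real m > 0" by (auto simp: Q_set_def)
      then show "M \<le> x / real m" using M(1) by (simp add: field_simps)
    qed
    also have "\<dots> = (\<Sum>(m, p)\<in>W. ln (real p))"
      unfolding WS using finT finite_real_le[of "Q_set T" "x / M"] by (subst sum.Sigma) auto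
    also have "\<dots> = (\<Sum>(n, p)\<in>(\<lambda>(m, p). (m * p, p)) ` W. ln (real p))"
      by (subst sum.reindex[OF inj]) (auto intro!: sum.cong)
    also have "\<dots> \<le> (\<Sum>(n, p)\<in>Sigma S prime_factors. ln (real p))"
    proof (rule sum_mono2)
      show "finite (Sigma S prime_factors)" using finS by auto
      show "(\<lambda>(m, p). (m * p, p)) ` W \<subseteq> Sigma S prime_factors"
      proof clarify
        fix m p assume "(m, p) \<in> W"
        then have mp: "m \<in> Q_set T" "real m \<le> x / M" "p \<in> T" "real p \<le> x / real m" by (auto simp: W_def)
        have m0: "m > 0" using mp by (auto simp: Q_set_def)
        have pp: "prime p" using log_density_prime[OF d mp(3)] .
        have "p * m \<in> Q_set T" using pp mp by (intro Q_set_mult_prime)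
        moreover have "real (p * m) \<le> x" using mp(4) m0 by (simp add: field_simps)
        ultimately have "m * p \<in> S" by (simp add: S_def mult.commute)
        moreover have "p \<in> prime_factors (m * p)" using pp m0 by (auto simp: prime_factors_dvd prime_gt_0_nat)
        ultimately show "m * p \<in> S \<and> p \<in> prime_factors (m * p)" by blast
      qed
      show "0 \<le> (case b of (n, p) \<Rightarrow> ln (real p))" if bW: "b \<in> Sigma S prime_factors - (\<lambda>(m, p). (m * p, p)) ` W" for b
      proof -
        obtain n p where "b = (n, p)" "prime p" using bW by auto
        then show ?thesis using prime_ge_1_nat[of p] by simp
      qed
    qed
    also have "\<dots> = (\<Sum>n\<in>S. \<Sum>p\<in>prime_factors n. ln (real p))"
      using finS by (subst sum.Sigma) auto
    also have "\<dots> \<le> (\<Sum>n\<in>S. ln x)"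
    proof (rule sum_mono)
      fix n assume n: "n \<in> S"
      then have n0: "n > 0" "real n \<le> x" by (auto simp: S_def Q_set_def)
      have "(\<Sum>p\<in>prime_factors n. ln (real p)) \<le> ln (real n)"
        by (rule sum_ln_prime_divisors_le) (use n0 in auto)
      also have "\<dots> \<le> ln x" using n0 by simp
      finally show "(\<Sum>p\<in>prime_factors n. ln (real p)) \<le> ln x" .
    qed
    also have "\<dots> = real (card S) * ln x" by simp
    finally have le: "(x / M) * inv_sum T (x / M) \<le> real (card S) * ln x" .
    \<comment> \<open>By \<open>x \<ge> M\<^sup>2\<close>, passing from \<open>x\<close> to
      \<open>x / M\<close> costs only a constant factor in the logarithm.\<close>
    have "ln x \<le> 2 * ln (x / M)"
    proof -
      have "ln (M\<^sup>2) \<le> ln x" using x2 M(1) by (subst ln_le_cancel_iff) auto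
      then have "2 * ln M \<le> ln x" using M(1) by (simp add: ln_realpow)
      then show ?thesis using x2 M(1) by (simp add: ln_div)
    qed
    then have "(ln x * (1/2)) powr \<tau> \<le> ln (x / M) powr \<tau>" using lx t by (intro powr_mono2) auto
    moreover have "(ln x * (1/2)) powr \<tau> = ln x powr \<tau> * (1/2) powr \<tau>"
      by (rule powr_mult)
    ultimately have "c * (ln x powr \<tau> * (1/2) powr \<tau>) \<le> c * ln (x / M) powr \<tau>"
      using c(1) by (intro mult_left_mono) (simp_all only: less_imp_le)
    also have "\<dots> \<le> inv_sum T (x / M)" by (rule c(2)[OF x2(2)])
    finally have "(x / M) * (c * (ln x powr \<tau> * (1/2) powr \<tau>)) \<le> (x / M) * inv_sum T (x / M)"
      using x2 by (intro mult_left_mono) auto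
    also note le
    also have "(x / M) * (c * (ln x powr \<tau> * (1/2) powr \<tau>)) = (c' * x * ln x powr (\<tau> - 1)) * ln x"
    proof -
      have "ln x powr \<tau> = ln x powr (\<tau> - 1) * ln x" using lx by (simp add: powr_diff)
      then show ?thesis by (simp add: c'_def)
    qed
    finally show ?thesis unfolding S_def[symmetric] using lx by (simp add: mult_le_cancel_right)
  qed
  moreover have "c' > 0" using c M by (simp add: c'_def)
  ultimately show ?thesis by (intro that[of c' "max 2 (max (2 * M) (M\<^sup>2))"]) auto
qed

subsection \<open>From two elements to every power of the logarithm\<close>

text \<open>The exponent counts prime factors with multiplicity. This makes the weight dominate the \<open>k\<close>-fold divisor
  function, and summing over higher prime powers turns \<open>k / p\<close> into \<open>k / (p - k)\<close>, the sieve weight.\<close>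

definition omega_sum :: "nat \<Rightarrow> nat set \<Rightarrow> real \<Rightarrow> real" where
  "omega_sum k R x = (\<Sum>n | n \<in> Q_set R \<and> real n \<le> x. real k ^ size (prime_factorization n) / real n)"

text \<open>A divisor of \<open>p * n\<close> divides \<open>n\<close> or is \<open>p\<close> times
  a divisor of \<open>n\<close>; the second kind carries an additional factor \<open>k\<close>. Each
  prime factor thus multiplies the sum by at most \<open>1 + k\<close>.\<close>

lemma sum_divisors_power_omega_le:
  fixes n :: nat
  shows "n > 0 \<Longrightarrow> (\<Sum>d | d dvd n. real k ^ size (prime_factorization d)) \<le> real (Suc k) ^ size (prime_factorization n)"
proof (induction n rule: prime_divisors_induct)
  case (factor p n)
  have n: "n > 0" "p > 0" using factor by auto
  define f where "f d = real k ^ size (prime_factorization d)" for d :: nat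
  have finn: "finite {d. d dvd n}" using n by simp
  have "{d. d dvd p * n} \<subseteq> {d. d dvd n} \<union> (*) p ` {d. d dvd n}"
  proof
    fix d assume d: "d \<in> {d. d dvd p * n}"
    show "d \<in> {d. d dvd n} \<union> (*) p ` {d. d dvd n}"
    proof (cases "p dvd d")
      case True
      then obtain e where "d = p * e" by (auto elim: dvdE)
      then show ?thesis using d n by auto
    next
      case False
      then have "coprime d p" using factor(1) prime_imp_coprime[of p d] by (simp add: coprime_commute)
      then show ?thesis using d by (simp add: coprime_dvd_mult_right_iff)
    qed
  qed
  then have "(\<Sum>d | d dvd p * n. f d) \<le> (\<Sum>d\<in>{d. d dvd n} \<union> (*) p ` {d. d dvd n}. f d)"
    using finn by (intro sum_mono2) (auto simp: f_def)
  also have "\<dots> \<le> (\<Sum>d | d dvd n. f d) + (\<Sum>d\<in>(*) p ` {d. d dvd n}. f d)"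
    using finn by (subst sum.union_inter[symmetric]) (auto intro!: sum_nonneg simp: f_def)
  also have "(\<Sum>d\<in>(*) p ` {d. d dvd n}. f d) = (\<Sum>d | d dvd n. f (p * d))"
    using n by (subst sum.reindex) (auto simp: inj_on_def)
  also have "\<dots> = (\<Sum>d | d dvd n. real k * f d)"
  proof (intro sum.cong refl)
    fix d assume "d \<in> {d. d dvd n}"
    then have "d > 0" using n by (auto intro: Nat.gr0I)
    then show "f (p * d) = real k * f d" using factor n
      by (simp add: f_def prime_factorization_mult prime_factorization_prime)
  qed
  also have "(\<Sum>d | d dvd n. f d) + \<dots> = real (Suc k) * (\<Sum>d | d dvd n. f d)"
    by (simp add: sum_distrib_left[symmetric] algebra_simps)
  also have "\<dots> \<le> real (Suc k) * real (Suc k) ^ size (prime_factorization n)"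
    using factor.IH[OF n(1)] by (intro mult_left_mono) (auto simp: f_def)
  also have "\<dots> = real (Suc k) ^ size (prime_factorization (p * n))"
    using factor n by (simp add: prime_factorization_mult prime_factorization_prime)
  finally show ?case by (simp add: f_def)
qed (auto simp: dvd_def)

lemma Q_set_mult: "a \<in> Q_set R \<Longrightarrow> b \<in> Q_set R \<Longrightarrow> a * b \<in> Q_set R"
  by (auto simp: Q_set_def prime_dvd_mult_iff)

text \<open>Dirichlet convolution: the representations \<open>n = a * b\<close> are indexed by
  divisors \<open>a\<close> of \<open>n\<close>, and the divisor sum raises the base from
  \<open>k\<close> to \<open>Suc k\<close>.\<close>

lemma omega_sum_mult_le:
  assumes "y \<ge> 0" "z \<ge> 0"
  shows "omega_sum k R y * inv_sum R z \<le> omega_sum (Suc k) R (y * z)"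
proof -
  define A where "A = {m. m \<in> Q_set R \<and> real m \<le> y}"
  define B where "B = {m. m \<in> Q_set R \<and> real m \<le> z}"
  define N where "N = {m. m \<in> Q_set R \<and> real m \<le> y * z}"
  define f where "f d = real k ^ size (prime_factorization d)" for d :: nat
  have fin: "finite A" "finite B" "finite N"
    using finite_real_le[of "Q_set R"] by (auto simp: A_def B_def N_def)
  have "omega_sum k R y * inv_sum R z = (\<Sum>ab\<in>A \<times> B. f (fst ab) / real (fst ab * snd ab))"
    unfolding omega_sum_def inv_sum_def A_def[symmetric] B_def[symmetric] f_def[symmetric]
    by (simp add: sum_product sum.cartesian_product case_prod_unfold)
  also have "\<dots> = (\<Sum>n\<in>N. \<Sum>ab\<in>{ab\<in>A \<times> B. fst ab * snd ab = n}. f (fst ab) / real (fst ab * snd ab))"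
  proof (rule sum.group[symmetric])
    show "(\<lambda>ab. fst ab * snd ab) ` (A \<times> B) \<subseteq> N"
    proof (clarsimp simp: N_def A_def B_def)
      fix a b assume "a \<in> Q_set R" "real a \<le> y" "b \<in> Q_set R" "real b \<le> z"
      then show "a * b \<in> Q_set R \<and> real a * real b \<le> y * z"
        using assms by (auto intro!: Q_set_mult mult_mono)
    qed
  qed (use fin in auto)
  also have "\<dots> \<le> (\<Sum>n\<in>N. real (Suc k) ^ size (prime_factorization n) / real n)"
  proof (rule sum_mono)
    fix n assume n: "n \<in> N"
    then have n0: "n > 0" by (auto simp: N_def Q_set_def)
    define W where "W = {ab\<in>A \<times> B. fst ab * snd ab = n}"
    have inj: "inj_on fst W"
    proof (rule inj_onI)
      fix u v assume uv: "u \<in> W" "v \<in> W" "fst u = fst v"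
      then have "fst u * snd u = fst u * snd v" "fst u \<noteq> 0" using n0 by (auto simp: W_def)
      then show "u = v" using uv(3) by (auto intro: prod_eqI)
    qed
    have "(\<Sum>ab\<in>W. f (fst ab) / real (fst ab * snd ab)) = (\<Sum>ab\<in>W. f (fst ab)) / real n"
      unfolding sum_divide_distrib by (intro sum.cong refl) (auto simp: W_def)
    also have "(\<Sum>ab\<in>W. f (fst ab)) = (\<Sum>d\<in>fst ` W. f d)"
      by (simp add: sum.reindex[OF inj])
    also have "\<dots> \<le> (\<Sum>d | d dvd n. f d)"
      using n0 by (intro sum_mono2) (auto simp: W_def f_def)
    also have "\<dots> \<le> real (Suc k) ^ size (prime_factorization n)"
      unfolding f_def using n0 by (rule sum_divisors_power_omega_le)
    finally show "(\<Sum>ab\<in>{ab\<in>A \<times> B. fst ab * snd ab = n}. f (fst ab) / real (fst ab * snd ab))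
        \<le> real (Suc k) ^ size (prime_factorization n) / real n"
      by (simp add: W_def divide_right_mono)
  qed
  finally show ?thesis by (simp add: omega_sum_def N_def)
qed

lemma inv_sum_nonneg: "0 \<le> inv_sum R x"
  by (auto simp: inv_sum_def intro: sum_nonneg)

text \<open>Repeated convolution yields the \<open>k\<close>-th power of the known lower bound for
  \<open>inv_sum\<close>; the price is a range growing from \<open>y\<close> to
  \<open>y ^ k\<close>, which a power of the logarithm hardly notices.\<close>

lemma inv_sum_power_le:
  assumes "y \<ge> 1"
  shows "inv_sum R y ^ k \<le> omega_sum k R (y ^ k)"
proof (induction k)
  case 0
  have "{n. n \<in> Q_set R \<and> real n \<le> 1} = {1}" by (auto simp: Q_set_def)
  then show ?case by (simp add: omega_sum_def)
next
  case (Suc k)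
  have "inv_sum R y ^ Suc k \<le> omega_sum k R (y ^ k) * inv_sum R y"
    using Suc by (simp add: mult.commute mult_left_mono inv_sum_nonneg)
  also have "\<dots> \<le> omega_sum (Suc k) R (y ^ k * y)" using assms by (intro omega_sum_mult_le) auto
  finally show ?case by (simp add: mult.commute)
qed

lemma size_prime_factorization:
  "size (prime_factorization (n::nat)) = (\<Sum>p\<in>prime_factors n. multiplicity p n)"
  by (auto simp: size_multiset_overloaded_eq count_prime_factorization intro!: sum.cong)

lemma prod_prime_factors_le: "n > 0 \<Longrightarrow> \<Prod>(prime_factors n) \<le> (n::nat)"
proof -
  assume n: "n > 0"
  have "\<Prod>(prime_factors n) \<le> (\<Prod>p\<in>prime_factors n. p ^ multiplicity p n)"
  proof (intro prod_mono conjI)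
    fix p assume p: "p \<in> prime_factors n"
    then have "multiplicity p n \<ge> 1" "p \<ge> 1" using prime_ge_1_nat[of p] by (auto simp: prime_factors_multiplicity)
    then show "p \<le> p ^ multiplicity p n" by (simp add: self_le_power)
  qed auto
  also have "\<dots> = n" using n by (simp add: prod_prime_factors)
  finally show ?thesis .
qed

text \<open>Integers are grouped by their set \<open>I\<close> of prime factors. From
  \<open>\<Prod>I \<le> n \<le> Q\<close> the set is an admissible modulus, and
  \<open>k / (p - k)\<close> increases with \<open>k\<close>, so \<open>nu p\<close> may replace
  it.\<close>

lemma omega_sum_le_sieve_sum:
  assumes D: "D = {p \<in> R. real p \<le> Q}" and R: "\<And>p. p \<in> R \<Longrightarrow> prime p \<and> k < p"
    and nu: "\<And>p. p \<in> D \<Longrightarrow> k \<le> nu p \<and> nu p < p"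
  shows "omega_sum k R Q \<le> (\<Sum>I | I \<subseteq> D \<and> real (\<Prod>I) \<le> Q. \<Prod>p\<in>I. real (nu p) / real (p - nu p))"
proof -
  define F where "F = {I. I \<subseteq> D \<and> real (\<Prod>I) \<le> Q}"
  define N where "N = {n. n \<in> Q_set R \<and> real n \<le> Q}"
  have finD: "finite D" unfolding D by (rule finite_real_le)
  have finF: "finite F" using finD by (auto simp: F_def)
  have finN: "finite N" using finite_real_le[of "Q_set R" Q] by (simp add: N_def)
  have DF: "prime p" "k < p" if "I \<in> F" "p \<in> I" for I p
    using that R by (auto simp: F_def D)
  have "omega_sum k R Q = (\<Sum>n\<in>N. \<Prod>p\<in>prime_factors n. (real k / real p) ^ multiplicity p n)"
    unfolding omega_sum_def N_def[symmetric]
  proof (intro sum.cong refl)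
    fix n assume "n \<in> N"
    then have n: "n > 0" by (auto simp: N_def Q_set_def)
    have "(\<Prod>p\<in>prime_factors n. (real k / real p) ^ multiplicity p n)
        = (\<Prod>p\<in>prime_factors n. real k ^ multiplicity p n * (1 / real p) ^ multiplicity p n)"
      by (intro prod.cong refl) (simp add: power_divide)
    also have "\<dots> = real k ^ size (prime_factorization n) * (1 / real n)"
      unfolding prod.distrib prod_inverse_prime_factors[OF n] size_prime_factorization by (simp add: power_sum)
    finally show "real k ^ size (prime_factorization n) / real n = (\<Prod>p\<in>prime_factors n. (real k / real p) ^ multiplicity p n)"
      by simp
  qed
  also have "\<dots> = (\<Sum>I\<in>F. \<Sum>n\<in>{n\<in>N. prime_factors n = I}. \<Prod>p\<in>prime_factors n. (real k / real p) ^ multiplicity p n)"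
  proof (rule sum.group[symmetric])
    show "prime_factors ` N \<subseteq> F"
    proof
      fix I assume "I \<in> prime_factors ` N"
      then obtain n where n: "n \<in> N" "I = prime_factors n" by auto
      then have n0: "n > 0" "real n \<le> Q" "prime_factors n \<subseteq> R" by (auto simp: N_def Q_set_prime_factors)
      have "real p \<le> Q" if "p \<in> I" for p
      proof -
        have "p \<le> n" using that n n0 by (auto simp: prime_factors_dvd dvd_imp_le)
        then show ?thesis using n0 by linarith
      qed
      moreover have "real (\<Prod>I) \<le> Q"
        using prod_prime_factors_le[OF n0(1)] n0(2) unfolding n(2) by linarith
      ultimately show "I \<in> F" using n0 n by (auto simp: F_def D)
    qed
  qed (use finN finF in auto)
  also have "\<dots> = (\<Sum>I\<in>F. \<Sum>n\<in>{n\<in>N. prime_factors n = I}. \<Prod>p\<in>I. (real k / real p) ^ multiplicity p n)"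
    by (intro sum.cong refl) auto
  also have "\<dots> \<le> (\<Sum>I\<in>F. \<Prod>p\<in>I. (real k / real p) / (1 - real k / real p))"
  proof (intro sum_mono sum_fixed_prime_factors_le)
    fix I assume I: "I \<in> F"
    show "finite I" using I finD by (auto simp: F_def intro: finite_subset)
    show "prime p \<and> 0 \<le> real k / real p \<and> real k / real p < 1" if "p \<in> I" for p
      using DF[OF I that] by simp
    show "finite {n \<in> N. prime_factors n = I}" using finN by simp
    show "n > 0 \<and> prime_factors n = I" if "n \<in> {n \<in> N. prime_factors n = I}" for n
      using that by (auto simp: N_def Q_set_def)
  qed
  also have "\<dots> \<le> (\<Sum>I\<in>F. \<Prod>p\<in>I. real (nu p) / real (p - nu p))"
  proof (intro sum_mono prod_mono conjI)
    fix I p assume I: "I \<in> F" "p \<in> I"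
    have p: "k < p" using DF[OF I] by simp
    have n: "k \<le> nu p" "nu p < p" using nu[of p] I by (auto simp: F_def)
    show "0 \<le> (real k / real p) / (1 - real k / real p)" using p by simp
    have "(real k / real p) / (1 - real k / real p) = real k / (real p - real k)"
      using p by (simp add: field_simps)
    also have "\<dots> \<le> real (nu p) / (real p - real (nu p))"
      using p n by (intro frac_le) auto
    finally show "(real k / real p) / (1 - real k / real p) \<le> real (nu p) / real (p - nu p)"
      using n by (simp add: of_nat_diff)
  qed
  finally show ?thesis by (simp add: F_def)
qed

text \<open>What the upper bounds use of the sumset relation, with \<open>P\<close> standing for the
  primes outside \<open>T\<close>. It is symmetric in \<open>A\<close> and \<open>B\<close>, so each
  bound is proved for one of them only.\<close>

definition coprime_sums :: "nat set \<Rightarrow> nat \<Rightarrow> nat set \<Rightarrow> nat set \<Rightarrow> bool" where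
  "coprime_sums P x0 A B \<longleftrightarrow> 0 \<notin> A \<and> 0 \<notin> B \<and>
     (\<forall>a\<in>A. \<forall>b\<in>B. x0 \<le> a + b \<longrightarrow> (\<forall>p\<in>P. \<not> p dvd a + b))"

text \<open>Discarding the elements of \<open>A\<close> below \<open>x0\<close> makes every sum
  large enough while all of \<open>B\<close> is kept, including the small elements whose classes are
  counted.\<close>

lemma coprime_sums_sieve:
  fixes x :: real
  assumes c: "coprime_sums P x0 A B" and P: "\<And>p. p \<in> P \<Longrightarrow> prime p" and D: "finite D" "D \<subseteq> P" and x: "x \<ge> 3"
    and ne: "{a \<in> A. x0 \<le> a \<and> real a \<le> x} \<noteq> {}"
  defines "Bx \<equiv> {b \<in> B. real b \<le> x}"
  shows "\<And>p. p \<in> D \<Longrightarrow> residue_count Bx p < p"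
    and "real (card {a \<in> A. x0 \<le> a \<and> real a \<le> x}) * (\<Sum>I | I \<subseteq> D \<and> real (\<Prod>I) \<le> sqrt (x / ln x).
           \<Prod>p\<in>I. real (residue_count Bx p) / real (p - residue_count Bx p)) \<le> 3 * x"
proof -
  define Ax where "Ax = {a \<in> A. x0 \<le> a \<and> real a \<le> x}"
  have Ax: "Ax \<subseteq> {1..nat \<lfloor>x\<rfloor>}" "Ax \<noteq> {}"
    using c ne by (auto simp: Ax_def coprime_sums_def le_nat_floor Suc_le_eq intro: Nat.gr0I)
  have finB: "finite Bx" unfolding Bx_def by (rule finite_real_le)
  have nd: "\<not> p dvd a + b" if "p \<in> D" "a \<in> Ax" "b \<in> Bx" for p a b
    using that c D by (auto simp: coprime_sums_def Ax_def Bx_def subset_iff)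
  have pr: "prime p" if "p \<in> D" for p using that D P by auto
  show "residue_count Bx p < p" if "p \<in> D" for p
    using sumset_sieve(1)[OF D(1) pr Ax finB x nd that] .
  show "real (card {a \<in> A. x0 \<le> a \<and> real a \<le> x}) * (\<Sum>I | I \<subseteq> D \<and> real (\<Prod>I) \<le> sqrt (x / ln x).
           \<Prod>p\<in>I. real (residue_count Bx p) / real (p - residue_count Bx p)) \<le> 3 * x"
    using sumset_sieve(2)[OF D(1) pr Ax finB x nd] by (simp only: Ax_def)
qed

text \<open>The \<open>k\<close> chosen elements of \<open>B\<close> stay distinct modulo every
  larger prime, so the sieve has dimension \<open>k * \<rho>\<close> and saves that power of the
  logarithm.\<close>

lemma card_le_log_power:
  assumes d: "log_density P \<rho>" and r: "0 \<le> \<rho>" "\<rho> \<le> 1" and c: "coprime_sums P x0 A B"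
    and B0: "finite B0" "B0 \<subseteq> B" "card B0 = k" "k > 0"
  obtains C where "C > 0"
    "\<forall>\<^sub>F x in at_top. real (card {a \<in> A. x0 \<le> a \<and> real a \<le> x}) \<le> C * x * ln x powr (- (real k * \<rho>))"
proof -
  \<comment> \<open>Primes above \<open>p0\<close> exceed \<open>k\<close> and every element of
    \<open>B0\<close>.\<close>
  define p0 where "p0 = \<Sum>B0 + k"
  have b_le: "b \<le> p0" if "b \<in> B0" for b
    using member_le_sum[of b B0 "\<lambda>x. x"] that B0 by (simp add: p0_def)
  define R where "R = {p \<in> P. p0 < p}"
  have dR: "log_density R \<rho>" unfolding R_def using d by (rule log_density_tail)
  have Rp: "prime p" "p0 < p" "k < p" "p \<in> P" if "p \<in> R" for p
    using that log_density_prime[OF d, of p] by (auto simp: R_def p0_def)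
  obtain c1 where c1: "c1 > 0" "\<And>x. x \<ge> 2 \<Longrightarrow> c1 * ln x powr \<rho> \<le> inv_sum R x"
    using inv_sum_ge[OF dR r(2)] by blast
  define C where "C = 3 / (c1 * (1 / (4 * real k)) powr \<rho>) ^ k"
  have C0: "C > 0" using c1 B0 by (simp add: C_def)
  have ev1: "\<forall>\<^sub>F x::real in at_top. x powr (1/4) \<le> sqrt (x / ln x)" by real_asymp
  have ev2: "\<forall>\<^sub>F x::real in at_top. x powr (1 / (4 * real k)) \<ge> 2"
  proof -
    have "filterlim (\<lambda>x::real. x powr (1 / (4 * real k))) at_top at_top"
      using B0 by real_asymp
    then show ?thesis by (simp add: filterlim_at_top)
  qed
  have "\<forall>\<^sub>F x in at_top. real (card {a \<in> A. x0 \<le> a \<and> real a \<le> x}) \<le> C * x * ln x powr (- (real k * \<rho>))"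
    using ev1 ev2 eventually_ge_at_top[of 3] eventually_ge_at_top[of "real p0"]
  proof eventually_elim
    case (elim x)
    define Q where "Q = sqrt (x / ln x)"
    define Bx where "Bx = {b \<in> B. real b \<le> x}"
    define D where "D = {p \<in> R. real p \<le> Q}"
    \<comment> \<open>Then \<open>y ^ k = x powr (1/4)\<close> stays below \<open>Q\<close>, and
      \<open>ln y\<close> is a fixed fraction of \<open>ln x\<close>.\<close>
    define y where "y = x powr (1 / (4 * real k))"
    have lx: "ln x > 0" using elim by simp
    show ?case
    proof (cases "{a \<in> A. x0 \<le> a \<and> real a \<le> x} = {}")
      case True
      show ?thesis unfolding True using C0 elim by simp
    next
      case False
      have D: "finite D" "D \<subseteq> P" "\<And>p. p \<in> D \<Longrightarrow> p \<in> R"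
        using Rp finite_real_le[of R Q] by (auto simp: D_def)
      note sieve = coprime_sums_sieve[OF c log_density_prime[OF d] D(1,2) _ False, folded Bx_def Q_def]
      have nu: "k \<le> residue_count Bx p" if p: "p \<in> D" for p
      proof -
        have "inj_on (\<lambda>b. b mod p) B0"
        proof (rule inj_onI)
          fix b b' assume b: "b \<in> B0" "b' \<in> B0" "b mod p = b' mod p"
          have "b < p" "b' < p" using b_le[OF b(1)] b_le[OF b(2)] Rp(2)[OF D(3)[OF p]] by auto
          then show "b = b'" using b(3) by simp
        qed
        then have "k = card ((\<lambda>b. b mod p) ` B0)" using B0 by (simp add: card_image)
        also have "\<dots> \<le> card ((\<lambda>b. b mod p) ` Bx)"
        proof (rule card_mono)
          have "b \<in> Bx" if "b \<in> B0" for b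
          proof -
            have "real b \<le> real p0" using b_le[OF that] by simp
            then show ?thesis using that B0 elim by (auto simp: Bx_def)
          qed
          then show "(\<lambda>b. b mod p) ` B0 \<subseteq> (\<lambda>b. b mod p) ` Bx" by auto
          show "finite ((\<lambda>b. b mod p) ` Bx)" unfolding Bx_def by (intro finite_imageI finite_real_le)
        qed
        finally show ?thesis by (simp add: residue_count_def)
      qed
      have yk: "y ^ k \<le> Q"
      proof -
        have "y ^ k = x powr (1/4)" using elim B0 by (simp add: y_def powr_power)
        then show ?thesis using elim by (simp add: Q_def)
      qed
      have "(c1 * (1 / (4 * real k)) powr \<rho>) ^ k * ln x powr (real k * \<rho>) = (c1 * ln y powr \<rho>) ^ k"
      proof -
        have "ln y = (1 / (4 * real k)) * ln x" using elim by (simp add: y_def ln_powr)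
        then have "ln y powr \<rho> = (1 / (4 * real k)) powr \<rho> * ln x powr \<rho>" by (simp only: powr_mult)
        moreover have "(ln x powr \<rho>) ^ k = ln x powr (real k * \<rho>)"
          using lx by (simp add: powr_power mult.commute)
        ultimately show ?thesis by (simp add: power_mult_distrib)
      qed
      also have "\<dots> \<le> inv_sum R y ^ k"
        using c1(1) elim c1(2)[of y] by (intro power_mono) (simp_all only: y_def, simp)
      also have "\<dots> \<le> omega_sum k R (y ^ k)" using elim by (intro inv_sum_power_le) (simp add: y_def)
      also have "\<dots> \<le> omega_sum k R Q"
        unfolding omega_sum_def using yk finite_real_le[of "Q_set R" Q] by (intro sum_mono2) auto
      also have "\<dots> \<le> (\<Sum>I | I \<subseteq> D \<and> real (\<Prod>I) \<le> Q. \<Prod>p\<in>I. real (residue_count Bx p) / real (p - residue_count Bx p))"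
        by (rule omega_sum_le_sieve_sum[OF D_def]) (use Rp nu sieve(1) elim in auto)
      finally have L: "(c1 * (1 / (4 * real k)) powr \<rho>) ^ k * ln x powr (real k * \<rho>) \<le> \<dots>" .
      have "real (card {a \<in> A. x0 \<le> a \<and> real a \<le> x}) * ((c1 * (1 / (4 * real k)) powr \<rho>) ^ k * ln x powr (real k * \<rho>)) \<le> 3 * x"
        using mult_left_mono[OF L, of "real (card {a \<in> A. x0 \<le> a \<and> real a \<le> x})"] sieve(2) elim
        by linarith
      moreover have "0 < (c1 * (1 / (4 * real k)) powr \<rho>) ^ k * ln x powr (real k * \<rho>)"
        using c1 lx B0 by simp
      ultimately have "real (card {a \<in> A. x0 \<le> a \<and> real a \<le> x}) \<le> 3 * x / ((c1 * (1 / (4 * real k)) powr \<rho>) ^ k * ln x powr (real k * \<rho>))"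
        by (simp only: pos_le_divide_eq)
      also have "\<dots> = C * x * ln x powr (- (real k * \<rho>))"
        by (simp add: C_def powr_minus field_simps)
      finally show ?thesis .
    qed
  qed
  with C0 show ?thesis by (rule that)
qed

section \<open>Lower bounds for the counting functions\<close>

lemma counting_le: "real (counting A x) \<le> real x0 + real (card {a \<in> A. x0 \<le> a \<and> real a \<le> x})"
proof -
  have "{n \<in> A. real n \<le> x} \<subseteq> {..<x0} \<union> {a \<in> A. x0 \<le> a \<and> real a \<le> x}" by auto
  moreover have "finite {a \<in> A. x0 \<le> a \<and> real a \<le> x}"
    by (rule finite_subset[OF _ finite_real_le[of A x]]) auto
  ultimately have "counting A x \<le> card ({..<x0} \<union> {a \<in> A. x0 \<le> a \<and> real a \<le> x})"
    unfolding counting_def by (intro card_mono) auto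
  also have "\<dots> \<le> x0 + card {a \<in> A. x0 \<le> a \<and> real a \<le> x}"
    using card_Un_le[of "{..<x0}" "{a \<in> A. x0 \<le> a \<and> real a \<le> x}"] by simp
  finally show ?thesis by linarith
qed

text \<open>An element of the sumset up to \<open>x\<close> has both summands up to
  \<open>x\<close>, so the product of the counts is at least the number of elements of
  \<open>Q_set T\<close> between \<open>x0\<close> and \<open>x\<close>. Half of the main term
  absorbs \<open>x0\<close>.\<close>

lemma counting_product_ge:
  assumes d: "log_density T \<tau>" and t: "0 < \<tau>" "\<tau> \<le> 1"
    and e: "(A + B) \<inter> {x0..} = Q_set T \<inter> {x0..}"
  obtains c where "c > 0"
    "\<forall>\<^sub>F x in at_top. c * x * ln x powr (\<tau> - 1) \<le> real (counting A x) * real (counting B x)"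
proof -
  obtain c X where c: "c > 0" "\<And>x. x \<ge> X \<Longrightarrow> c * x * ln x powr (\<tau> - 1) \<le> real (card {n \<in> Q_set T. real n \<le> x})"
    using card_Q_set_ge[OF d t] by metis
  have "filterlim (\<lambda>x::real. (c / 2) * (x * ln x powr (\<tau> - 1))) at_top at_top"
  proof -
    have "\<forall>\<^sub>F x::real in at_top. x powr (1/2) \<le> x * ln x powr (- 1)" by real_asymp
    then have "\<forall>\<^sub>F x::real in at_top. (c / 2) * x powr (1/2) \<le> (c / 2) * (x * ln x powr (\<tau> - 1))"
      using eventually_ge_at_top[of 3]
    proof eventually_elim
      case (elim x)
      have "ln x \<ge> 1" using elim(2) exp_le by (subst ln_ge_iff) auto
      then have "ln x powr (- 1) \<le> ln x powr (\<tau> - 1)" using t by (intro powr_mono) auto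
      then have "x * ln x powr (- 1) \<le> x * ln x powr (\<tau> - 1)" using elim by (intro mult_left_mono) auto
      then show ?case using elim c(1) by (intro mult_left_mono) auto
    qed
    moreover have "filterlim (\<lambda>x::real. (c / 2) * x powr (1/2)) at_top at_top"
      using c(1) by real_asymp
    ultimately show ?thesis by (rule filterlim_at_top_mono[rotated])
  qed
  then have "\<forall>\<^sub>F x in at_top. real x0 \<le> (c / 2) * (x * ln x powr (\<tau> - 1))"
    by (simp add: filterlim_at_top)
  then have "\<forall>\<^sub>F x in at_top. (c / 2) * x * ln x powr (\<tau> - 1) \<le> real (counting A x) * real (counting B x)"
    using eventually_ge_at_top[of X]
  proof eventually_elim
    case (elim x)
    define Ax where "Ax = {n \<in> A. real n \<le> x}"
    define Bx where "Bx = {n \<in> B. real n \<le> x}"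
    have fin: "finite Ax" "finite Bx" unfolding Ax_def Bx_def by (rule finite_real_le)+
    have sub: "{n \<in> Q_set T. real n \<le> x} \<subseteq> {..<x0} \<union> (\<lambda>(a, b). a + b) ` (Ax \<times> Bx)"
    proof
      fix n assume n: "n \<in> {n \<in> Q_set T. real n \<le> x}"
      show "n \<in> {..<x0} \<union> (\<lambda>(a, b). a + b) ` (Ax \<times> Bx)"
      proof (cases "n < x0")
        case False
        then have "n \<in> (A + B) \<inter> {x0..}" unfolding e using n by auto
        then obtain a b where "a \<in> A" "b \<in> B" "n = a + b" by (auto elim: set_plus_elim)
        then show ?thesis using n by (auto simp: Ax_def Bx_def)
      qed auto
    qed
    have "card {n \<in> Q_set T. real n \<le> x} \<le> card ({..<x0} \<union> (\<lambda>(a, b). a + b) ` (Ax \<times> Bx))"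
      using fin by (intro card_mono[OF _ sub]) auto
    also have "\<dots> \<le> card {..<x0} + card ((\<lambda>(a, b). a + b) ` (Ax \<times> Bx))" by (rule card_Un_le)
    also have "\<dots> \<le> x0 + card (Ax \<times> Bx)" using fin card_image_le[of "Ax \<times> Bx" "\<lambda>(a, b). a + b"] by simp
    finally have "real (card {n \<in> Q_set T. real n \<le> x}) \<le> real x0 + real (counting A x) * real (counting B x)"
      using of_nat_mono[where ?'a = real] by (fastforce simp: card_cartesian_product counting_def Ax_def Bx_def)
    then show ?case using elim c(2)[of x] by simp
  qed
  moreover have "c / 2 > 0" using c(1) by simp
  ultimately show ?thesis by (intro that[of "c / 2"])
qed

text \<open>The sieve saves \<open>k * \<rho>\<close> powers of the logarithm in
  \<open>A(x)\<close>, and the sparsity of the sumset costs \<rho> of them.\<close>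

lemma counting_ge_log_power:
  assumes d: "log_density P \<rho>" and r: "0 < \<rho>" "\<rho> \<le> 1" and c: "coprime_sums P x0 A B"
    and prod: "c0 > 0" "\<forall>\<^sub>F x in at_top. c0 * x * ln x powr (- \<rho>) \<le> real (counting A x) * real (counting B x)"
    and B0: "finite B0" "B0 \<subseteq> B" "card B0 = k" "k > 0"
  obtains c' where "c' > 0" "\<forall>\<^sub>F x in at_top. c' * ln x powr ((real k - 1) * \<rho>) \<le> real (counting B x)"
proof -
  obtain C where C: "C > 0"
    "\<forall>\<^sub>F x in at_top. real (card {a \<in> A. x0 \<le> a \<and> real a \<le> x}) \<le> C * x * ln x powr (- (real k * \<rho>))"
    using card_le_log_power[OF d _ r(2) c B0] r by auto
  have "\<forall>\<^sub>F x::real in at_top. real x0 \<le> x powr (1/2)" by real_asymp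
  moreover have "\<forall>\<^sub>F x::real in at_top. x powr (1/2) \<le> x * ln x powr (- real k)" by real_asymp
  ultimately have "\<forall>\<^sub>F x in at_top. c0 / (C + 1) * ln x powr ((real k - 1) * \<rho>) \<le> real (counting B x)"
    using C(2) prod(2) eventually_ge_at_top[of 3]
  proof eventually_elim
    case (elim x)
    have l1: "ln x \<ge> 1" using elim exp_le by (subst ln_ge_iff) auto
    define L where "L = ln x powr (- (real k * \<rho>))"
    have L0: "L > 0" using l1 by (simp add: L_def)
    have "real k * \<rho> \<le> real k * 1" using r by (intro mult_left_mono) auto
    then have "ln x powr (- real k) \<le> L" unfolding L_def using l1 by (intro powr_mono) auto
    then have "x * ln x powr (- real k) \<le> x * L" using elim by (intro mult_left_mono) auto
    then have "real x0 \<le> x * L" using elim by linarith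
    then have A: "real (counting A x) \<le> (C + 1) * x * L"
      using elim(3) counting_le[of A x x0] by (simp add: L_def algebra_simps)
    have "c0 * x * ln x powr (- \<rho>) \<le> real (counting A x) * real (counting B x)" using elim by simp
    also have "\<dots> \<le> ((C + 1) * x * L) * real (counting B x)" using A by (intro mult_right_mono) auto
    finally have "c0 * x * ln x powr (- \<rho>) / ((C + 1) * x * L) \<le> real (counting B x)"
      using C(1) L0 elim by (subst pos_divide_le_eq) (auto simp: mult_ac)
    also have "c0 * x * ln x powr (- \<rho>) / ((C + 1) * x * L) = c0 / (C + 1) * (ln x powr (- \<rho>) / L)"
      using elim by simp
    also have "ln x powr (- \<rho>) / L = ln x powr ((real k - 1) * \<rho>)"
      unfolding L_def by (simp add: powr_diff[symmetric] algebra_simps)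
    finally show ?case .
  qed
  moreover have "c0 / (C + 1) > 0" using C(1) prod(1) by simp
  ultimately show ?thesis by (intro that[of "c0 / (C + 1)"])
qed

text \<open>One element of \<open>B\<close> would give exponent 0; two give \<rho>, and an unbounded
  counting function contradicts finiteness. An infinite \<open>B\<close> then supplies as many
  elements as wanted.\<close>

lemma counting_ge_any_log_power:
  fixes m :: nat
  assumes d: "log_density P \<rho>" and r: "0 < \<rho>" "\<rho> \<le> 1" and c: "coprime_sums P x0 A B"
    and prod: "c0 > 0" "\<forall>\<^sub>F x in at_top. c0 * x * ln x powr (- \<rho>) \<le> real (counting A x) * real (counting B x)"
    and two: "b1 \<in> B" "b2 \<in> B" "b1 \<noteq> b2"
  shows "\<forall>\<^sub>F x in at_top. ln x ^ m \<le> real (counting B x)"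
proof -
  have "infinite B"
  proof
    assume fin: "finite B"
    obtain c' where c': "c' > 0" "\<forall>\<^sub>F x in at_top. c' * ln x powr ((real 2 - 1) * \<rho>) \<le> real (counting B x)"
      by (rule counting_ge_log_power[OF d r c prod, of "{b1, b2}" 2]) (use two in auto)
    have "filterlim (\<lambda>x::real. c' * ln x powr \<rho>) at_top at_top"
      using c' r by real_asymp
    then have "\<forall>\<^sub>F x::real in at_top. c' * ln x powr \<rho> \<ge> real (card B) + 1" by (simp add: filterlim_at_top)
    with c'(2) have "\<forall>\<^sub>F x::real in at_top. False"
    proof eventually_elim
      case (elim x)
      have "counting B x \<le> card B" unfolding counting_def using fin by (intro card_mono) auto
      then show ?case using elim by simp
    qed
    then show False by simp
  qed
  \<comment> \<open>Makes \<open>(k - 1) * \<rho>\<close> at least \<open>m + 1\<close>; the surplus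
    logarithm swallows the constant \<open>c'\<close>.\<close>
  define k where "k = nat \<lceil>real (m + 1) / \<rho>\<rceil> + 1"
  obtain B0 where B0: "B0 \<subseteq> B" "finite B0" "card B0 = k"
    using infinite_arbitrarily_large[OF \<open>infinite B\<close>] by metis
  obtain c' where c': "c' > 0" "\<forall>\<^sub>F x in at_top. c' * ln x powr ((real k - 1) * \<rho>) \<le> real (counting B x)"
    by (rule counting_ge_log_power[OF d r c prod, of B0 k]) (use B0 in \<open>auto simp: k_def\<close>)
  have "real (m + 1) / \<rho> \<le> real k - 1" using r by (simp add: k_def of_nat_ceiling)
  then have ex: "real (m + 1) \<le> (real k - 1) * \<rho>" using r by (simp add: field_simps)
  have "\<forall>\<^sub>F x::real in at_top. 1 / c' \<le> ln x" by real_asymp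
  then show ?thesis using c'(2) eventually_ge_at_top[of 3]
  proof eventually_elim
    case (elim x)
    have l1: "ln x \<ge> 1" using elim exp_le by (subst ln_ge_iff) auto
    have "ln x ^ m \<le> c' * ln x * ln x ^ m"
    proof -
      have "1 \<le> c' * ln x" using elim(1) c'(1) by (simp add: field_simps)
      then show ?thesis using l1 mult_right_mono[of 1 "c' * ln x" "ln x ^ m"] by simp
    qed
    also have "\<dots> = c' * ln x powr real (m + 1)" using l1 by (subst powr_realpow) auto
    also have "\<dots> \<le> c' * ln x powr ((real k - 1) * \<rho>)"
      using c'(1) l1 ex by (intro mult_left_mono powr_mono) auto
    finally show ?case using elim by simp
  qed
qed

subsection \<open>From powers of the logarithm to the square root\<close>

text \<open>Gallagher's inequality bounds a harmonic mean of the residue counts, which is why primes with few residues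
  are rare even on the logarithmic scale.\<close>

lemma bad_primes_sum_le:
  fixes x y \<epsilon> :: real
  assumes B: "B \<subseteq> {1..nat \<lfloor>x\<rfloor>}" and x: "x \<ge> 4" and y: "1 \<le> y" "y \<le> real (card B)"
    and D: "\<And>p. p \<in> D \<Longrightarrow> prime p \<and> real p \<le> y" and e: "\<epsilon> > 0"
  shows "(\<Sum>p | p \<in> D \<and> real (residue_count B p) < \<epsilon> * real p. ln (real p) / real p) \<le> 2 * \<epsilon> * ln x"
proof -
  have cB: "card B > 0" using y by linarith
  then have finB: "finite B" "B \<noteq> {}" by (auto simp: card_gt_0_iff)
  have subD: "D \<subseteq> {p. prime p \<and> p \<le> nat \<lfloor>y\<rfloor>}" using D by (auto simp: le_nat_floor)
  have finD: "finite D" by (rule finite_subset[OF subD]) simp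
  have lp: "0 \<le> ln (real p)" "real p > 0" if "p \<in> D" for p
    using prime_ge_1_nat[of p] D[OF that] by auto
  \<comment> \<open>Here \<open>y \<le> card B\<close> enters: it keeps the diagonal term of the
    larger sieve at most \<open>ln 4\<close>.\<close>
  have theta: "(\<Sum>p\<in>D. ln (real p)) \<le> real (card B) * ln 4"
  proof -
    have "(\<Sum>p\<in>D. ln (real p)) \<le> (\<Sum>p | prime p \<and> p \<le> nat \<lfloor>y\<rfloor>. ln (real p))"
      using subD by (intro sum_mono2) (auto dest: prime_ge_1_nat)
    also have "\<dots> \<le> real (nat \<lfloor>y\<rfloor>) * ln 4" by (rule theta_le)
    also have "\<dots> \<le> real (card B) * ln 4" using y by (intro mult_right_mono) (linarith, simp)
    finally show ?thesis .
  qed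
  have "(\<Sum>p\<in>D. ln (real p) / real (residue_count B p)) \<le> ln (real (nat \<lfloor>x\<rfloor>)) + (\<Sum>p\<in>D. ln (real p)) / real (card B)"
    using B finB finD D by (intro larger_sieve) auto
  also have "(\<Sum>p\<in>D. ln (real p)) / real (card B) \<le> ln 4"
    using theta cB by (simp add: pos_divide_le_eq mult.commute)
  also have "ln (real (nat \<lfloor>x\<rfloor>)) \<le> ln x" using x by (subst ln_le_cancel_iff) (auto simp: le_nat_iff le_floor_iff)
  also have "ln 4 \<le> ln x" using x by simp
  finally have S: "(\<Sum>p\<in>D. ln (real p) / real (residue_count B p)) \<le> 2 * ln x" by simp
  have "(\<Sum>p | p \<in> D \<and> real (residue_count B p) < \<epsilon> * real p. ln (real p) / real p)
      \<le> (\<Sum>p | p \<in> D \<and> real (residue_count B p) < \<epsilon> * real p. \<epsilon> * (ln (real p) / real (residue_count B p)))"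
  proof (rule sum_mono)
    fix p assume p: "p \<in> {p. p \<in> D \<and> real (residue_count B p) < \<epsilon> * real p}"
    have r: "real (residue_count B p) > 0" using residue_count_pos[OF finB] by simp
    have "1 / real p \<le> \<epsilon> / real (residue_count B p)"
      using p r lp[of p] by (simp add: field_simps)
    from mult_left_mono[OF this lp(1)[of p]] p
    show "ln (real p) / real p \<le> \<epsilon> * (ln (real p) / real (residue_count B p))" by (simp add: mult.commute)
  qed
  also have "\<dots> \<le> (\<Sum>p\<in>D. \<epsilon> * (ln (real p) / real (residue_count B p)))"
    using finD lp e by (intro sum_mono2) auto
  also have "\<dots> \<le> \<epsilon> * (2 * ln x)"
    unfolding sum_distrib_left[symmetric] using S e by (intro mult_left_mono) auto
  finally show ?thesis by simp
qed

text \<open>Of all moduli only the products over \<open>F\<close> are kept; each counts at least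
  \<open>\<epsilon> ^ m\<close>, because
  \<open>nu / (p - nu) \<ge> nu / p \<ge> \<epsilon>\<close>.\<close>

lemma coprime_sums_sieve_family:
  fixes x \<epsilon> :: real
  assumes c: "coprime_sums P x0 A B" and P: "\<And>p. p \<in> P \<Longrightarrow> prime p" and D: "finite D" "D \<subseteq> P" and x: "x \<ge> 3"
    and good: "\<And>p. p \<in> D \<Longrightarrow> \<epsilon> * real p \<le> real (residue_count {b \<in> B. real b \<le> x} p)" and e: "\<epsilon> \<ge> 0"
    and F: "\<And>I. I \<in> F \<Longrightarrow> I \<subseteq> D \<and> card I = m \<and> real (\<Prod>I) \<le> sqrt (x / ln x)"
  shows "real (card {a \<in> A. x0 \<le> a \<and> real a \<le> x}) * (real (card F) * \<epsilon> ^ m) \<le> 3 * x"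
proof (cases "{a \<in> A. x0 \<le> a \<and> real a \<le> x} = {}")
  case True
  show ?thesis unfolding True using x by simp
next
  case False
  define nu where "nu p = residue_count {b \<in> B. real b \<le> x} p" for p
  have lt: "nu p < p" if "p \<in> D" for p
    unfolding nu_def by (rule coprime_sums_sieve(1)[OF c P D x False that])
  have sieve: "real (card {a \<in> A. x0 \<le> a \<and> real a \<le> x}) * (\<Sum>I | I \<subseteq> D \<and> real (\<Prod>I) \<le> sqrt (x / ln x).
           \<Prod>p\<in>I. real (nu p) / real (p - nu p)) \<le> 3 * x"
    unfolding nu_def by (rule coprime_sums_sieve(2)[OF c P D x False])
  have h: "\<epsilon> \<le> real (nu p) / real (p - nu p)" if p: "p \<in> D" for p
  proof -
    have "\<epsilon> \<le> real (nu p) / real p" using good[OF p] lt[OF p] by (simp add: nu_def field_simps)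
    also have "\<dots> \<le> real (nu p) / real (p - nu p)" using lt[OF p] by (intro divide_left_mono mult_pos_pos) auto
    finally show ?thesis .
  qed
  have ID: "p \<in> D" if "I \<in> F" "p \<in> I" for I p using F[OF that(1)] that(2) by blast
  have "real (card F) * \<epsilon> ^ m = (\<Sum>I\<in>F. \<Prod>p\<in>I. \<epsilon>)"
    using F by simp
  also have "\<dots> \<le> (\<Sum>I\<in>F. \<Prod>p\<in>I. real (nu p) / real (p - nu p))"
    using h e ID by (intro sum_mono prod_mono) auto
  also have "\<dots> \<le> (\<Sum>I | I \<subseteq> D \<and> real (\<Prod>I) \<le> sqrt (x / ln x). \<Prod>p\<in>I. real (nu p) / real (p - nu p))"
    using F D by (intro sum_mono2 prod_nonneg) auto
  finally have "real (card {a \<in> A. x0 \<le> a \<and> real a \<le> x}) * (real (card F) * \<epsilon> ^ m)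
     \<le> real (card {a \<in> A. x0 \<le> a \<and> real a \<le> x}) * (\<Sum>I | I \<subseteq> D \<and> real (\<Prod>I) \<le> sqrt (x / ln x). \<Prod>p\<in>I. real (nu p) / real (p - nu p))"
    by (intro mult_left_mono) auto
  with sieve show ?thesis by linarith
qed

text \<open>Here the moduli are products of about \<open>ln Q / ln y\<close> good primes near \<open>y = (ln x)\<^sup>3\<^sup>0\<close>.
  Each factor contributes about \<open>y\<close> up to three powers of \<open>ln x\<close>, that is \<open>y\<close> to the power \<open>9/10\<close>.\<close>

lemma card_le_powr_three_fifths:
  assumes d: "log_density P \<rho>" and r: "\<rho> > 0" and c: "coprime_sums P x0 A B"
    and evB: "\<forall>\<^sub>F x in at_top. ln x ^ 30 \<le> real (counting B x)"
  shows "\<forall>\<^sub>F x in at_top. real (card {a \<in> A. x0 \<le> a \<and> real a \<le> x}) \<le> x powr (3/5)"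
proof -
  obtain M C where M: "M > 1"
    "\<And>z. z \<ge> M \<Longrightarrow> 2 \<le> (\<Sum>p | p \<in> P \<and> z / M < real p \<and> real p \<le> z. ln (real p) / real p)"
    by (rule log_density_window[OF d r, of 2]) blast
  have M0: "M > 0" using M(1) by simp
  have e1: "\<forall>\<^sub>F x::real in at_top. M \<le> ln x ^ 30" by real_asymp
  have e2: "\<forall>\<^sub>F x::real in at_top. 60 * M * ln (ln x) \<le> ln x" by real_asymp
  have e3: "\<forall>\<^sub>F x::real in at_top. ln x ^ 30 \<le> sqrt (x / ln x)" by real_asymp
  have e4: "\<forall>\<^sub>F x::real in at_top. 1 \<le> ln (ln x)" by real_asymp
  \<comment> \<open>Up to logarithms the right side has exponent
    \<open>3/5 + 9/20 > 1\<close>.\<close>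
  have e5: "\<forall>\<^sub>F x::real in at_top. 3 * x \<le> x powr (3/5) * (sqrt (x / ln x) / ln x ^ 30) powr (9/10)" by real_asymp
  show ?thesis
    using evB e1 e2 e3 e4 e5 eventually_ge_at_top[of 16]
  proof eventually_elim
    case (elim x)
    define Q where "Q = sqrt (x / ln x)"
    define y where "y = ln x ^ 30"
    define Bx where "Bx = {b \<in> B. real b \<le> x}"
    \<comment> \<open>Chosen so that the bad primes weigh at most 1, half of the mass 2 secured for
      the window.\<close>
    define \<epsilon> where "\<epsilon> = 1 / (2 * ln x)"
    define D where "D = {p. p \<in> P \<and> y / M < real p \<and> real p \<le> y}"
    define G where "G = {p \<in> D. \<epsilon> * real p \<le> real (residue_count Bx p)}"
    have l1: "ln x \<ge> 1" using elim exp_le by (subst ln_ge_iff) auto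
    have y1: "y \<ge> 1" using l1 by (simp add: y_def)
    have ly: "ln y = 30 * ln (ln x)" using l1 by (simp add: y_def ln_realpow)
    have ly1: "ln y \<ge> 1" using elim by (simp add: ly)
    have Qx: "Q \<le> x"
    proof -
      have "1 * 1 \<le> x * ln x" using l1 elim by (intro mult_mono) auto
      then have "x / ln x \<le> x * x" using l1 elim by (simp add: field_simps)
      then have "Q \<le> sqrt (x * x)" unfolding Q_def by (rule real_sqrt_le_mono)
      then show ?thesis using elim by simp
    qed
    have yQ: "y \<le> Q" using elim by (simp add: y_def Q_def)
    have lQ: "ln y \<le> ln Q" "ln Q \<le> ln x" using yQ Qx y1 by auto
    have e0: "\<epsilon> > 0" using l1 by (simp add: \<epsilon>_def)
    have finD: "finite D" unfolding D_def by (rule finite_subset[OF _ finite_real_le[of P y]]) auto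
    have Dp: "prime p" "p \<in> P" "y / M < real p" "real p \<le> y" "real p > 0" if "p \<in> D" for p
      using that log_density_prime[OF d, of p] prime_gt_0_nat[of p] by (auto simp: D_def)
    have Bx: "Bx \<subseteq> {1..nat \<lfloor>x\<rfloor>}" "y \<le> real (card Bx)"
      using c elim by (auto simp: Bx_def coprime_sums_def le_nat_floor Suc_le_eq y_def counting_def intro: Nat.gr0I)
    have bad: "(\<Sum>p | p \<in> D \<and> real (residue_count Bx p) < \<epsilon> * real p. ln (real p) / real p) \<le> 1"
      using bad_primes_sum_le[OF Bx(1) _ y1 Bx(2), of D \<epsilon>] Dp e0 l1 elim by (simp add: \<epsilon>_def)
    have "2 \<le> (\<Sum>p\<in>D. ln (real p) / real p)" unfolding D_def using elim by (intro M(2)) (simp add: y_def)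
    also have "\<dots> = (\<Sum>p\<in>G. ln (real p) / real p) + (\<Sum>p | p \<in> D \<and> real (residue_count Bx p) < \<epsilon> * real p. ln (real p) / real p)"
      using finD by (subst sum.union_disjoint[symmetric]) (auto simp: G_def intro!: sum.cong)
    finally have "1 \<le> (\<Sum>p\<in>G. ln (real p) / real p)" using bad by simp
    also have "\<dots> \<le> (\<Sum>p\<in>G. ln y / (y / M))"
      using Dp y1 M0 by (intro sum_mono frac_le) (auto simp: G_def intro: less_imp_le[OF Dp(3)])
    also have "\<dots> = real (card G) * (M * ln y / y)" by simp
    finally have g: "y \<le> real (card G) * (M * ln y)" using y1 by (simp add: field_simps)
    \<comment> \<open>The largest \<open>m\<close> with \<open>y ^ m \<le> Q\<close>; rounding down
      loses at most one factor \<open>y\<close>.\<close>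
    define m where "m = nat \<lfloor>ln Q / ln y\<rfloor>"
    have m1: "m \<ge> 1" using lQ ly1 by (simp add: m_def le_nat_iff le_floor_iff)
    have m2: "real m \<le> ln Q / ln y" "ln Q / ln y < real m + 1"
    proof -
      have "0 \<le> ln Q / ln y" using lQ ly1 by simp
      then show "real m \<le> ln Q / ln y" "ln Q / ln y < real m + 1" by (simp_all add: m_def)
    qed
    have mx: "real m \<le> ln x"
    proof -
      have "ln Q / ln y \<le> ln Q / 1" using ly1 lQ by (intro divide_left_mono) auto
      then show ?thesis using m2 lQ by simp
    qed
    \<comment> \<open>The three lost powers of \<open>ln x\<close>: one in
      \<open>1 / \<epsilon> = 2 * ln x\<close>, one in \<open>m \<le> ln x\<close> from the binomial
      coefficient, and one for \<open>M * ln y\<close>, which even with the factor 2 is at most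
      \<open>ln x\<close>.\<close>
    have key: "ln x ^ 27 * real m \<le> real (card G) * \<epsilon>"
    proof -
      have "ln x ^ 27 * real m * (M * ln y * (2 * ln x)) \<le> ln x ^ 27 * ln x * (ln x * ln x)"
      proof (rule mult_mono)
        show "ln x ^ 27 * real m \<le> ln x ^ 27 * ln x" using mx l1 by (intro mult_left_mono) auto
        show "M * ln y * (2 * ln x) \<le> ln x * ln x"
          using mult_right_mono[OF elim(3), of "ln x"] l1 by (simp add: ly mult_ac)
      qed (use mx l1 M0 ly1 in auto)
      also have "\<dots> = y" by (simp add: y_def eval_nat_numeral)
      also have "\<dots> \<le> real (card G) * (M * ln y)" by (rule g)
      finally have "ln x ^ 27 * real m * (2 * ln x) * (M * ln y) \<le> real (card G) * (M * ln y)" by (simp add: mult_ac)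
      then have "ln x ^ 27 * real m * (2 * ln x) \<le> real (card G)" using M0 ly1 by (simp add: mult_le_cancel_right)
      then show ?thesis using l1 by (simp add: \<epsilon>_def field_simps)
    qed
    have mg: "m \<le> card G"
    proof -
      have "1 * real m \<le> ln x ^ 27 * real m" using l1 by (intro mult_right_mono) auto
      also note key
      also have "real (card G) * \<epsilon> \<le> real (card G) * 1" using l1 by (intro mult_left_mono) (auto simp: \<epsilon>_def field_simps)
      finally show ?thesis by simp
    qed
    define F where "F = {I. I \<subseteq> G \<and> card I = m}"
    have finG: "finite G" using finD by (simp add: G_def)
    have cF: "card F = card G choose m" unfolding F_def using finG by (rule n_subsets)
    have ym: "y ^ m \<le> Q"
    proof -
      have "real m * ln y \<le> ln Q" using m2(1) ly1 by (simp add: field_simps)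
      then have "ln (y ^ m) \<le> ln Q" using y1 by (simp add: ln_realpow)
      then show ?thesis using y1 yQ by (subst (asm) ln_le_cancel_iff) auto
    qed
    have sv: "real (card {a \<in> A. x0 \<le> a \<and> real a \<le> x}) * (real (card F) * \<epsilon> ^ m) \<le> 3 * x"
    proof (rule coprime_sums_sieve_family[OF c log_density_prime[OF d] finG])
      show "G \<subseteq> P" using Dp by (auto simp: G_def)
      fix I assume I: "I \<in> F"
      have "real (\<Prod>I) = (\<Prod>p\<in>I. real p)" by simp
      also have "\<dots> \<le> (\<Prod>p\<in>I. y)" using I Dp by (intro prod_mono) (auto simp: F_def G_def)
      also have "\<dots> = y ^ m" using I by (simp add: F_def)
      finally show "I \<subseteq> G \<and> card I = m \<and> real (\<Prod>I) \<le> sqrt (x / ln x)" using I ym by (auto simp: F_def Q_def)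
    qed (use elim e0 in \<open>auto simp: G_def Bx_def\<close>)
    have "(Q / y) powr (9/10) \<le> (y ^ m) powr (9/10)"
    proof (rule powr_mono2)
      have "ln Q < (real m + 1) * ln y" using m2(2) ly1 by (simp add: field_simps)
      then have "ln Q < ln (y ^ Suc m)" using y1 by (simp add: ln_realpow algebra_simps del: power_Suc)
      then have "Q < y ^ Suc m" using y1 yQ by (subst (asm) ln_less_cancel_iff) auto
      then show "Q / y \<le> y ^ m" using y1 by (simp add: field_simps)
    qed (use y1 yQ in auto)
    also have "(y ^ m) powr (9/10) = (ln x ^ 27) ^ m"
    proof -
      have "y ^ m = ln x ^ (30 * m)" by (simp only: y_def power_mult)
      also have "\<dots> = ln x powr real (30 * m)"
        using l1 by (intro powr_realpow[symmetric]) auto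
      finally have "(y ^ m) powr (9/10) = ln x powr (real (30 * m) * (9/10))"
        by (simp only: powr_powr)
      also have "real (30 * m) * (9/10) = real (27 * m)" by simp
      also have "ln x powr real (27 * m) = ln x ^ (27 * m)"
        using l1 by (intro powr_realpow) auto
      finally show ?thesis by (simp only: power_mult)
    qed
    also have "\<dots> \<le> (real (card G) * \<epsilon> / real m) ^ m"
      using key m1 l1 by (intro power_mono) (auto simp: field_simps)
    also have "\<dots> = (real (card G) / real m) ^ m * \<epsilon> ^ m" by (simp add: power_mult_distrib[symmetric])
    also have "\<dots> \<le> real (card F) * \<epsilon> ^ m"
      unfolding cF using binomial_ge_n_over_k_pow_k[OF mg, where ?'a = real] e0 by (intro mult_right_mono) auto
    finally have "(Q / y) powr (9/10) \<le> real (card F) * \<epsilon> ^ m" .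
    from mult_left_mono[OF this, of "real (card {a \<in> A. x0 \<le> a \<and> real a \<le> x})"]
    have "real (card {a \<in> A. x0 \<le> a \<and> real a \<le> x}) * (Q / y) powr (9/10) \<le> 3 * x" using sv by simp
    also have "\<dots> \<le> x powr (3/5) * (Q / y) powr (9/10)" using elim by (simp add: Q_def y_def)
    finally show ?case using y1 yQ by (simp add: mult_le_cancel_right)
  qed
qed

text \<open>Here the moduli are products of two good primes close to \<open>Q\<close>; almost all primes are good, so almost all
  pairs are.\<close>

lemma card_le_sqrt_log:
  assumes d: "log_density P \<rho>" and r: "\<rho> > 0"
  obtains K where "K > 0"
    "\<And>A B x0. coprime_sums P x0 A B \<Longrightarrow> \<forall>\<^sub>F x in at_top. x powr (3/8) \<le> real (counting B x) \<Longrightarrow>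
       \<forall>\<^sub>F x in at_top. real (card {a \<in> A. x0 \<le> a \<and> real a \<le> x}) \<le> K * (x powr (1/2) * ln x ^ 2)"
proof -
  obtain M C2 where M: "M > 1" "C2 \<ge> 0"
    "\<And>z. z \<ge> M \<Longrightarrow> 1 \<le> (\<Sum>p | p \<in> P \<and> z / M < real p \<and> real p \<le> z. ln (real p) / real p)"
    "\<And>z. z \<ge> M \<Longrightarrow> (\<Sum>p | p \<in> P \<and> z / M < real p \<and> real p \<le> z. ln (real p) / real p) \<le> C2"
    by (rule log_density_window[OF d r, of 1]) blast
  obtain C where C: "C \<ge> 0" "\<And>x. x \<ge> 1 \<Longrightarrow> \<bar>mertens_sum P x - \<rho> * ln x\<bar> \<le> C" using log_densityE[OF d] by blast
  have M0: "M > 0" using M(1) by simp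
  \<comment> \<open>Bad primes weigh at most \<open>2 * \<epsilon> * ln x\<close>. They are removed
    as first factors and, with partners of mass at most \<open>C2\<close>, as second factors; this
    \<epsilon> makes the total \<open>\<rho> / 40 * ln x\<close>.\<close>
  define \<epsilon> where "\<epsilon> = \<rho> / (80 * (1 + C2))"
  have e0: "\<epsilon> > 0" using r M(2) by (simp add: \<epsilon>_def)
  have eC: "2 * \<epsilon> * (1 + C2) = \<rho> / 40" using M(2) by (simp add: \<epsilon>_def field_simps)
  \<comment> \<open>75 is the 3 of the sieve bound times the 25 of \<open>low\<close>.\<close>
  define K where "K = 75 * M / (\<rho> * \<epsilon>\<^sup>2)"
  have K0: "K > 0" using M0 r e0 by (simp add: K_def)
  \<comment> \<open>\<open>K\<close> is fixed before \<open>A\<close>, \<open>B\<close> and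
    \<open>x0\<close>, as the uniformity of the final constant demands.\<close>
  have main: "\<forall>\<^sub>F x in at_top. real (card {a \<in> A. x0 \<le> a \<and> real a \<le> x}) \<le> K * (x powr (1/2) * ln x ^ 2)"
    if c: "coprime_sums P x0 A B" and evB: "\<forall>\<^sub>F x in at_top. x powr (3/8) \<le> real (counting B x)" for A B x0
  proof -
    have e1: "\<forall>\<^sub>F x::real in at_top. sqrt (x / ln x) / x powr (1/8) \<le> x powr (3/8)" by real_asymp
    have e2: "\<forall>\<^sub>F x::real in at_top. M \<le> sqrt (x / ln x) / x powr (3/8)" by real_asymp
    have e3: "\<forall>\<^sub>F x::real in at_top. M * x powr (1/5) \<le> sqrt (x / ln x) / x powr (1/5)" by real_asymp
    have e4: "\<forall>\<^sub>F x::real in at_top. 2 * C \<le> \<rho> / 100 * ln x" using r by real_asymp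
    have e5: "\<forall>\<^sub>F x::real in at_top. x * ln x / sqrt (x / ln x) \<le> x powr (1/2) * ln x ^ 2" by real_asymp
    show ?thesis
      using evB e1 e2 e3 e4 e5 eventually_ge_at_top[of 4]
    proof eventually_elim
      case (elim x)
      define Q where "Q = sqrt (x / ln x)"
      define y where "y = x powr (3/8)"
      define Bx where "Bx = {b \<in> B. real b \<le> x}"
      define u where "u p = ln (real p) / real p" for p :: nat
      define D where "D = {p \<in> P. real p \<le> y}"
      define bad where "bad = {p. p \<in> D \<and> real (residue_count Bx p) < \<epsilon> * real p}"
      define G where "G = {p \<in> D. \<epsilon> * real p \<le> real (residue_count Bx p)}"
      \<comment> \<open>The lower end forces \<open>q \<le> Q / p\<close> into the range up to
        \<open>x powr (3/8)\<close> where \<open>B\<close> is under control. The upper end keeps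
        \<open>p\<close> below \<open>q\<close>, so the two primes are distinct and each product
        arises from one pair.\<close>
      define P1 where "P1 = {p. p \<in> P \<and> x powr (1/8) < real p \<and> real p \<le> x powr (1/5)}"
      define W where "W p = {q \<in> P. Q / M < real p * real q \<and> real p * real q \<le> Q}" for p
      have l1: "ln x \<ge> 1" using elim exp_le by (subst ln_ge_iff) auto
      have Q0: "Q > 0" using elim l1 by (simp add: Q_def)
      have y1: "y \<ge> 1" using elim by (simp add: y_def ge_one_powr_ge_zero)
      have Pp: "prime p" "real p > 0" "0 \<le> u p" if "p \<in> P" for p
        using log_density_prime[OF d that] prime_gt_0_nat[of p] prime_ge_1_nat[of p] by (auto simp: u_def)
      have Bx: "Bx \<subseteq> {1..nat \<lfloor>x\<rfloor>}" "y \<le> real (card Bx)"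
        using c elim by (auto simp: Bx_def coprime_sums_def le_nat_floor Suc_le_eq y_def counting_def intro: Nat.gr0I)
      have finD: "finite D" unfolding D_def by (rule finite_real_le)
      have DG: "finite G" "finite bad" "G \<subseteq> D" "bad \<subseteq> D" "D = G \<union> bad" "G \<inter> bad = {}" "D \<subseteq> P"
        using finD by (simp_all add: G_def bad_def) (auto simp: D_def)
      have badsum: "sum u bad \<le> 2 * \<epsilon> * ln x"
        unfolding bad_def u_def
        by (rule bad_primes_sum_le[OF Bx(1) _ y1 Bx(2)]) (use elim Pp e0 in \<open>auto simp: D_def\<close>)
      have P1D: "P1 \<subseteq> D"
      proof -
        have "x powr (1/5) \<le> y" unfolding y_def using elim by (intro powr_mono) auto
        then show ?thesis by (auto simp: P1_def D_def)
      qed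
      have finP1: "finite P1" using P1D finD by (rule finite_subset)
      have Weq: "W p = {q. q \<in> P \<and> (Q / real p) / M < real q \<and> real q \<le> Q / real p}" if "p \<in> P" for p
        using Pp(2)[OF that] M0 by (auto simp: W_def field_simps)
      have Wsym: "q \<in> W p \<longleftrightarrow> p \<in> W q" if "p \<in> P" "q \<in> P" for p q
        using that by (auto simp: W_def mult.commute)
      have QM: "M \<le> Q / real p" if "p \<in> D" for p
      proof -
        have "Q / y \<le> Q / real p" using that Pp(2)[of p] Q0 y1 by (intro divide_left_mono mult_pos_pos) (auto simp: D_def)
        then show ?thesis using elim by (simp add: Q_def y_def)
      qed
      have W1: "1 \<le> sum u (W p)" "sum u (W p) \<le> C2" if "p \<in> D" for p
        using M(3,4)[OF QM[OF that]] Weq[of p] that by (auto simp: u_def D_def)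
      have WD: "W p \<subseteq> D" if "p \<in> P1" for p
      proof
        fix q assume "q \<in> W p"
        then have q: "q \<in> P" "real q \<le> Q / real p" using Weq[of p] that by (auto simp: P1_def)
        have "Q / real p \<le> Q / x powr (1/8)"
          using that Q0 elim Pp(2)[of p] by (intro divide_left_mono mult_pos_pos) (auto simp: P1_def)
        then show "q \<in> D" using q elim by (simp add: D_def y_def Q_def)
      qed
      have finW: "finite (W p)" if "p \<in> P1" for p using WD[OF that] finD by (rule finite_subset)
      have T1: "\<rho> * (3/40) * ln x - 2 * C \<le> sum u P1"
      proof -
        have "x powr (1/8) \<le> x powr (1/5)" using elim by (intro powr_mono) auto
        from mertens_sum_split[OF this, of P]
        have "sum u P1 = mertens_sum P (x powr (1/5)) - mertens_sum P (x powr (1/8))" by (simp add: P1_def u_def)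
        moreover have "x powr (1/5) \<ge> 1" "x powr (1/8) \<ge> 1" using elim by (auto intro: ge_one_powr_ge_zero)
        note C(2)[OF this(1)] C(2)[OF this(2)]
        moreover have "ln (x powr (1/5)) = ln x / 5" "ln (x powr (1/8)) = ln x / 8" using elim by (auto simp: ln_powr)
        ultimately show ?thesis by (auto simp: abs_le_iff)
      qed
      have "sum u P1 - 2 * \<epsilon> * ln x \<le> sum u (P1 \<inter> G)"
      proof -
        have "sum u P1 = sum u (P1 \<inter> G) + sum u (P1 \<inter> bad)"
          using finP1 DG P1D by (subst sum.union_disjoint[symmetric]) (auto intro!: sum.cong)
        moreover have "sum u (P1 \<inter> bad) \<le> sum u bad" using DG Pp by (intro sum_mono2) auto
        ultimately show ?thesis using badsum by simp
      qed
      also have "sum u (P1 \<inter> G) \<le> (\<Sum>p\<in>P1 \<inter> G. u p * sum u (W p))"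
      proof (rule sum_mono)
        fix p assume "p \<in> P1 \<inter> G"
        then have "p \<in> D" "p \<in> P" using P1D DG by auto
        then show "u p \<le> u p * sum u (W p)" using mult_left_mono[OF W1(1)[of p] Pp(3)[of p]] by simp
      qed
      also have "\<dots> = (\<Sum>p\<in>P1 \<inter> G. u p * sum u (W p \<inter> G)) + (\<Sum>p\<in>P1 \<inter> G. u p * sum u (W p \<inter> bad))"
      proof -
        have "sum u (W p) = sum u (W p \<inter> G) + sum u (W p \<inter> bad)" if "p \<in> P1" for p
          using finW[OF that] DG WD[OF that] by (subst sum.union_disjoint[symmetric]) (auto intro!: sum.cong)
        then show ?thesis by (simp add: sum.distrib[symmetric] distrib_left)
      qed
      \<comment> \<open>After exchanging the sums, the \<open>p\<close> paired with a bad
        \<open>q\<close> lie in \<open>W q\<close> by symmetry, again a window of mass at most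
        \<open>C2\<close>.\<close>
      also have "(\<Sum>p\<in>P1 \<inter> G. u p * sum u (W p \<inter> bad)) \<le> C2 * (2 * \<epsilon> * ln x)"
      proof -
        have "(\<Sum>p\<in>P1 \<inter> G. u p * sum u (W p \<inter> bad)) = (\<Sum>p\<in>P1 \<inter> G. \<Sum>q\<in>bad. if q \<in> W p then u p * u q else 0)"
          using DG by (intro sum.cong refl) (simp add: sum_distrib_left sum.inter_restrict Int_commute if_distrib cong: if_cong)
        also have "\<dots> = (\<Sum>q\<in>bad. \<Sum>p\<in>P1 \<inter> G. if q \<in> W p then u p * u q else 0)" by (rule sum.swap)
        also have "\<dots> \<le> (\<Sum>q\<in>bad. C2 * u q)"
        proof (rule sum_mono)
          fix q assume q: "q \<in> bad"
          then have qD: "q \<in> D" "q \<in> P" using DG by auto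
          have finWq: "finite (W q)" unfolding Weq[OF qD(2)]
            by (rule finite_subset[OF _ finite_real_le[of P "Q / real q"]]) auto
          have "(\<Sum>p\<in>P1 \<inter> G. if q \<in> W p then u p * u q else 0) = (\<Sum>p\<in>{p\<in>P1 \<inter> G. q \<in> W p}. u p * u q)"
            by (rule sum.inter_filter[symmetric]) (use DG in auto)
          also have "\<dots> \<le> (\<Sum>p\<in>W q. u p * u q)"
          proof (rule sum_mono2[OF finWq])
            show "{p\<in>P1 \<inter> G. q \<in> W p} \<subseteq> W q" using Wsym qD by (auto simp: P1_def)
            show "0 \<le> u p * u q" if "p \<in> W q - {p\<in>P1 \<inter> G. q \<in> W p}" for p
              using that Pp(3)[of p] Pp(3)[OF qD(2)] by (auto simp: W_def)
          qed
          also have "\<dots> = sum u (W q) * u q" by (simp add: sum_distrib_right)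
          also have "\<dots> \<le> C2 * u q" using W1(2)[OF qD(1)] Pp(3)[OF qD(2)] by (intro mult_right_mono)
          finally show "(\<Sum>p\<in>P1 \<inter> G. if q \<in> W p then u p * u q else 0) \<le> C2 * u q" .
        qed
        also have "\<dots> \<le> C2 * (2 * \<epsilon> * ln x)"
          unfolding sum_distrib_left[symmetric] using badsum M(2) by (intro mult_left_mono)
        finally show ?thesis .
      qed
      finally have up: "sum u P1 - 2 * \<epsilon> * ln x \<le> (\<Sum>p\<in>P1 \<inter> G. u p * sum u (W p \<inter> G)) + C2 * (2 * \<epsilon> * ln x)"
        by simp
      \<comment> \<open>In units of \<open>\<rho> * ln x\<close>: the range \<open>P1\<close> has
        mass \<open>1/5 - 1/8 = 3/40\<close>, bad primes take \<open>1/40\<close>, the error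
        \<open>2 * C\<close> takes at most \<open>1/100\<close>, and \<open>1/25\<close>
        remains.\<close>
      have low: "\<rho> / 25 * ln x \<le> (\<Sum>p\<in>P1 \<inter> G. u p * sum u (W p \<inter> G))"
      proof -
        from up have "sum u P1 - (2 * \<epsilon> * (1 + C2)) * ln x \<le> (\<Sum>p\<in>P1 \<inter> G. u p * sum u (W p \<inter> G))"
          by (simp add: algebra_simps)
        then have "sum u P1 - \<rho> / 40 * ln x \<le> (\<Sum>p\<in>P1 \<inter> G. u p * sum u (W p \<inter> G))" by (simp only: eC)
        then show ?thesis using T1 elim(5) by (simp add: field_simps)
      qed
      define V where "V = Sigma (P1 \<inter> G) (\<lambda>p. W p \<inter> G)"
      have finV: "finite V" unfolding V_def using DG by (intro finite_SigmaI) auto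
      have Vp: "p \<in> P" "q \<in> P" "p \<in> G" "q \<in> G" "p < q" "Q / M < real p * real q" "real p * real q \<le> Q" if "(p, q) \<in> V" for p q
      proof -
        show pq: "p \<in> P" "q \<in> P" "p \<in> G" "q \<in> G" "Q / M < real p * real q" "real p * real q \<le> Q"
          using that by (auto simp: V_def W_def P1_def)
        have p5: "real p \<le> x powr (1/5)" using that by (auto simp: V_def P1_def)
        have "real p \<le> x powr (1/5)" by fact
        also have "\<dots> \<le> Q / x powr (1/5) / M" using elim(4) M0 by (subst pos_le_divide_eq) (simp_all add: Q_def mult.commute)
        also have "\<dots> \<le> Q / real p / M"
          using p5 Pp(2)[OF pq(1)] Q0 M0 elim by (intro divide_right_mono divide_left_mono mult_pos_pos) auto
        also have "\<dots> < real q" using pq(5) Pp(2)[OF pq(1)] M0 by (simp add: field_simps)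
        finally show "p < q" by simp
      qed
      have "\<rho> / 25 * ln x \<le> (\<Sum>pq\<in>V. u (fst pq) * u (snd pq))"
      proof -
        have "(\<Sum>p\<in>P1 \<inter> G. u p * sum u (W p \<inter> G)) = (\<Sum>p\<in>P1 \<inter> G. \<Sum>q\<in>W p \<inter> G. u p * u q)"
          by (simp add: sum_distrib_left)
        also have "\<dots> = (\<Sum>pq\<in>V. u (fst pq) * u (snd pq))"
          unfolding V_def using DG by (subst sum.Sigma) (auto simp: case_prod_unfold)
        finally show ?thesis using low by simp
      qed
      \<comment> \<open>Since \<open>p * q > Q / M\<close>, no pair weighs more than
        \<open>M * (ln x)\<^sup>2 / Q\<close>; this turns the mass into at least a constant times
        \<open>Q / ln x\<close> pairs.\<close>
      also have "\<dots> \<le> (\<Sum>pq\<in>V. ln x * ln x / (Q / M))"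
      proof (rule sum_mono)
        fix pq assume "pq \<in> V"
        then obtain p q where pq: "pq = (p, q)" "(p, q) \<in> V" by (cases pq) auto
        have yx: "y \<le> x" using elim powr_mono[of "3/8" 1 x] by (simp add: y_def)
        have "p \<in> D" "q \<in> D" using Vp[OF pq(2)] DG by auto
        then have b: "real p \<le> x" "real q \<le> x" using yx by (auto simp: D_def)
        have pos: "0 < real p" "0 < real q" using Vp[OF pq(2)] Pp by auto
        have ge1: "1 \<le> real p" "1 \<le> real q" using pos by (simp_all add: Suc_le_eq)
        have "u p * u q = (ln (real p) * ln (real q)) / (real p * real q)" by (simp add: u_def)
        also have "\<dots> \<le> (ln x * ln x) / (Q / M)"
          using Vp(6)[OF pq(2)] b pos ge1 Q0 M0 l1 by (intro frac_le mult_mono mult_nonneg_nonneg) auto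
        finally show "u (fst pq) * u (snd pq) \<le> ln x * ln x / (Q / M)" by (simp add: pq)
      qed
      also have "\<dots> = real (card V) * (ln x * ln x * M / Q)" by simp
      finally have cV: "\<rho> / 25 * Q \<le> real (card V) * (ln x * M)"
        using l1 Q0 by (simp add: field_simps)
      define F where "F = (\<lambda>(p, q). {p, q}) ` V"
      have "inj_on (\<lambda>(p, q). {p, q}) V"
      proof (rule inj_onI)
        fix v w assume vw: "v \<in> V" "w \<in> V" "(\<lambda>(p, q). {p, q}) v = (\<lambda>(p, q). {p, q}) w"
        obtain p q p' q' where e: "v = (p, q)" "w = (p', q')" by (cases v, cases w)
        have "p < q" "p' < q'" "{p, q} = {p', q'}" using vw Vp(5) by (auto simp: e)
        then show "v = w" unfolding e by (auto simp: doubleton_eq_iff)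
      qed
      then have cF: "card F = card V" by (simp add: F_def card_image)
      have sv: "real (card {a \<in> A. x0 \<le> a \<and> real a \<le> x}) * (real (card F) * \<epsilon> ^ 2) \<le> 3 * x"
      proof (rule coprime_sums_sieve_family[OF c log_density_prime[OF d] DG(1)])
        show "G \<subseteq> P" using DG by auto
        fix I assume "I \<in> F"
        then obtain p q where pq: "(p, q) \<in> V" "I = {p, q}" by (auto simp: F_def)
        then show "I \<subseteq> G \<and> card I = 2 \<and> real (\<Prod>I) \<le> sqrt (x / ln x)"
          using Vp[OF pq(1)] by (auto simp: Q_def)
      qed (use elim e0 in \<open>auto simp: G_def Bx_def\<close>)
      define a where "a = real (card {a \<in> A. x0 \<le> a \<and> real a \<le> x})"
      have "a * (\<rho> / 25 * Q * \<epsilon>\<^sup>2) \<le> a * (real (card V) * (ln x * M) * \<epsilon>\<^sup>2)"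
        using cV by (intro mult_left_mono mult_right_mono) (auto simp: a_def)
      also have "\<dots> = (a * (real (card F) * \<epsilon> ^ 2)) * (ln x * M)" by (simp add: cF)
      also have "\<dots> \<le> 3 * x * (ln x * M)" using sv l1 M0 by (intro mult_right_mono) (auto simp: a_def)
      finally have "a * (\<rho> / 25 * Q * \<epsilon>\<^sup>2) \<le> 3 * x * (ln x * M)" .
      then have "a \<le> 3 * x * (ln x * M) / (\<rho> / 25 * Q * \<epsilon>\<^sup>2)"
        using r Q0 e0 by (subst pos_le_divide_eq) auto
      also have "\<dots> = K * (x * ln x / Q)" using r Q0 e0 by (simp add: K_def field_simps)
      also have "\<dots> \<le> K * (x powr (1/2) * ln x ^ 2)" using elim K0 by (intro mult_left_mono) (auto simp: Q_def)
      finally show ?case by (simp add: a_def)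
    qed
  qed
  show ?thesis by (rule that[OF K0 main])
qed

section \<open>Exchanging the two sets and the final estimate\<close>

lemma coprime_sums_commute: "coprime_sums P x0 A B \<Longrightarrow> coprime_sums P x0 B A"
  unfolding coprime_sums_def by (metis add.commute)

text \<open>The exponents \<open>3/5\<close> and \<open>3/8\<close> add up to \<open>39/40\<close>;
  the remaining \<open>1/40\<close> absorbs the logarithms, \<open>c0\<close> and
  \<open>x0\<close>.\<close>

lemma counting_ge_three_eighths:
  assumes d: "log_density P \<rho>" and r: "0 < \<rho>" "\<rho> \<le> 1" and c: "coprime_sums P x0 A B"
    and prod: "c0 > 0" "\<forall>\<^sub>F x in at_top. c0 * x * ln x powr (- \<rho>) \<le> real (counting A x) * real (counting B x)"
    and two: "b1 \<in> B" "b2 \<in> B" "b1 \<noteq> b2"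
  shows "\<forall>\<^sub>F x in at_top. x powr (3/8) \<le> real (counting B x)"
proof -
  have "\<forall>\<^sub>F x in at_top. ln x ^ 30 \<le> real (counting B x)"
    by (rule counting_ge_any_log_power[OF d r c prod two])
  then have evA: "\<forall>\<^sub>F x in at_top. real (card {a \<in> A. x0 \<le> a \<and> real a \<le> x}) \<le> x powr (3/5)"
    by (rule card_le_powr_three_fifths[OF d r(1) c])
  have ev: "\<forall>\<^sub>F x::real in at_top. (real x0 + x powr (3/5)) * x powr (3/8) \<le> c0 * x * ln x powr (- 1)"
    using prod(1) by real_asymp
  show ?thesis
    using evA ev prod(2) eventually_ge_at_top[of 3]
  proof eventually_elim
    case (elim x)
    have l1: "ln x \<ge> 1" using elim exp_le by (subst ln_ge_iff) auto
    have "(real x0 + x powr (3/5)) * x powr (3/8) \<le> c0 * x * ln x powr (- 1)" by (rule elim(2))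
    also have "\<dots> \<le> c0 * x * ln x powr (- \<rho>)"
      using l1 r prod(1) elim by (intro mult_left_mono powr_mono) auto
    also have "\<dots> \<le> real (counting A x) * real (counting B x)" by (rule elim(3))
    also have "\<dots> \<le> (real x0 + x powr (3/5)) * real (counting B x)"
      using counting_le[of A x x0] elim(1) by (intro mult_right_mono) auto
    finally show ?case
    proof (rule mult_left_le_imp_le)
      show "0 < real x0 + x powr (3/5)" using elim by (intro add_nonneg_pos) auto
    qed
  qed
qed

theorem theorem2p4:
  fixes \<tau> C :: real and T :: "nat set"
  assumes "0 < \<tau>" and "\<tau> < 1"
    and "T \<subseteq> {p. prime p}"
    and "(\<lambda>x::real. (\<Sum>p | p \<in> T \<and> real p \<le> x. ln (real p) / real p) - (\<tau> * ln x + C))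
           \<in> o[at_top](\<lambda>_. 1)"
  shows "\<exists>C0::real. C0 > 0 \<and>
    (\<forall>A B :: nat set.
       0 \<notin> A \<longrightarrow> 0 \<notin> B \<longrightarrow>
       (\<exists>a\<in>A. \<exists>a'\<in>A. a \<noteq> a') \<longrightarrow> (\<exists>b\<in>B. \<exists>b'\<in>B. b \<noteq> b') \<longrightarrow>
       eventually_same (Q_set T) (A + B) \<longrightarrow>
       (\<forall>\<^sub>F x::real in at_top.
          real (max (counting A x) (counting B x)) \<le> C0 * (x powr (1/2) * ln x ^ 4)))"
proof -
  define P where "P = {p. prime p \<and> p \<notin> T}"
  have dT: "log_density T \<tau>"
    using assms by (intro log_density_asymp[where C = C]) (auto simp: mertens_sum_def)
  have dP: "log_density P (1 - \<tau>)" unfolding P_def by (rule log_density_complement[OF dT])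
  have r: "0 < 1 - \<tau>" "1 - \<tau> \<le> 1" using assms by auto
  obtain K where K: "K > 0"
    "\<And>A B x0. coprime_sums P x0 A B \<Longrightarrow> \<forall>\<^sub>F x in at_top. x powr (3/8) \<le> real (counting B x) \<Longrightarrow>
       \<forall>\<^sub>F x in at_top. real (card {a \<in> A. x0 \<le> a \<and> real a \<le> x}) \<le> K * (x powr (1/2) * ln x ^ 2)"
    by (rule card_le_sqrt_log[OF dP r(1)]) blast
  have bound: "\<forall>\<^sub>F x in at_top. real (counting A x) \<le> (K + 1) * (x powr (1/2) * ln x ^ 4)"
    if c: "coprime_sums P x0 A B" and p: "c0 > 0"
      "\<forall>\<^sub>F x in at_top. c0 * x * ln x powr (- (1 - \<tau>)) \<le> real (counting A x) * real (counting B x)"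
      and two: "b1 \<in> B" "b2 \<in> B" "b1 \<noteq> b2" for A B x0 c0 b1 b2
  proof -
    have "\<forall>\<^sub>F x::real in at_top. real x0 \<le> x powr (1/2) * ln x ^ 2" by real_asymp
    moreover have "\<forall>\<^sub>F x in at_top. real (card {a \<in> A. x0 \<le> a \<and> real a \<le> x}) \<le> K * (x powr (1/2) * ln x ^ 2)"
      by (rule K(2)[OF c counting_ge_three_eighths[OF dP r c p two]])
    ultimately show ?thesis using eventually_ge_at_top[of 3]
    proof eventually_elim
      case (elim x)
      have l1: "ln x \<ge> 1" using elim exp_le by (subst ln_ge_iff) auto
      have "real (counting A x) \<le> (K + 1) * (x powr (1/2) * ln x ^ 2)"
        using elim counting_le[of A x x0] by (simp add: algebra_simps)
      \<comment> \<open>The argument ends with the square of the logarithm, relaxed here to the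
        stated fourth power.\<close>
      also have "\<dots> \<le> (K + 1) * (x powr (1/2) * ln x ^ 4)"
        using l1 K(1) by (intro mult_left_mono power_increasing) auto
      finally show ?case .
    qed
  qed
  show ?thesis
  proof (intro exI[of _ "K + 1"] conjI allI impI)
    show "K + 1 > 0" using K(1) by simp
    fix A B :: "nat set"
    assume AB: "0 \<notin> A" "0 \<notin> B" and A2: "\<exists>a\<in>A. \<exists>a'\<in>A. a \<noteq> a'" and B2: "\<exists>b\<in>B. \<exists>b'\<in>B. b \<noteq> b'"
      and es: "eventually_same (Q_set T) (A + B)"
    obtain x0 where x0: "(A + B) \<inter> {x0..} = Q_set T \<inter> {x0..}" using es by (auto simp: eventually_same_def)
    have c: "coprime_sums P x0 A B"
      unfolding coprime_sums_def
    proof (intro conjI ballI impI AB notI)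
      fix a b p assume ab: "a \<in> A" "b \<in> B" "x0 \<le> a + b" and p: "p \<in> P" "p dvd a + b"
      have "a + b \<in> (A + B) \<inter> {x0..}" using ab by (auto intro: set_plus_intro)
      then have "a + b \<in> Q_set T" unfolding x0 by simp
      then show False using p by (auto simp: Q_set_def P_def)
    qed
    obtain c0 where c0: "c0 > 0"
      "\<forall>\<^sub>F x in at_top. c0 * x * ln x powr (\<tau> - 1) \<le> real (counting A x) * real (counting B x)"
      by (rule counting_product_ge[OF dT _ _ x0]) (use assms in auto)
    \<comment> \<open>The product bound is kept in both orders: two elements of \<open>B\<close>
      serve to bound \<open>A\<close>, and two elements of \<open>A\<close> to bound
      \<open>B\<close>.\<close>
    have prodA: "\<forall>\<^sub>F x in at_top. c0 * x * ln x powr (- (1 - \<tau>)) \<le> real (counting A x) * real (counting B x)"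
      using c0(2) by simp
    have prodB: "\<forall>\<^sub>F x in at_top. c0 * x * ln x powr (- (1 - \<tau>)) \<le> real (counting B x) * real (counting A x)"
      using c0(2) by (simp add: mult.commute)
    have "\<forall>\<^sub>F x in at_top. real (counting A x) \<le> (K + 1) * (x powr (1/2) * ln x ^ 4)"
      using B2 bound[OF c c0(1) prodA] by blast
    moreover have "\<forall>\<^sub>F x in at_top. real (counting B x) \<le> (K + 1) * (x powr (1/2) * ln x ^ 4)"
      using A2 bound[OF coprime_sums_commute[OF c] c0(1) prodB] by blast
    ultimately show "\<forall>\<^sub>F x::real in at_top.
          real (max (counting A x) (counting B x)) \<le> (K + 1) * (x powr (1/2) * ln x ^ 4)"
      by eventually_elim simp
  qed
qed

end
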